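(* Let $(P_t)_{t\ge0}$ be a non-explosive homogeneous PDMP semigroup on $\mathsf M$ with characteristics $(\varphi,\lambda,Q)$ and let $\mu$ be a probability measure on $(\mathsf M,\mathcal B(\mathsf M))$. Assume that $\int_{\mathsf M}|\lambda|(x)\,\mu(dx)<+\infty$ and that $(P_t)_{t\ge0}$ is smoothly and compactly approximable (defined in the context). In addition, suppose that the generator $\mathcal A$ associated with $(P_t)_{t\ge0}$ satisfies, for all $f\in C^1_c(\mathsf M)$, $$\int_{\mathsf M}\mathcal Af(x)\,\mu(dx)=0.$$ Then $\mu$ is invariant for $(P_t)_{t\ge0}$.
   Context: $\mathsf M$ is a smooth closed Riemannian submanifold of $\mathbb R^N$ with Borel $\sigma$-field $\mathcal B(\mathsf M)$, Riemannian distance and closed balls $\overline B(x,r)$; $\infty\notin\mathsf M$ is a cemetery point; $\inf\emptyset=+\infty$. $C^1(\mathsf M)$: continuously differentiable real functions; $C^1_c(\mathsf M)$: those with compact support; $\|F\|_{\infty,K}=\sup_{x\in K}|F(x)|$. A homogeneous differential flow is a measurable map $(t,x)\mapsto\varphi_t(x)$ from $\mathbb R_+\times\mathsf M$ to $\mathsf M$ with $\varphi_0=\mathrm{Id}$, $\varphi_{t+s}=\varphi_s\circ\varphi_t$, $t\mapsto\varphi_t(x)$ continuously differentiable for all $x$, and each $\varphi_t$ a $C^1$-diffeomorphism of $\mathsf M$. A homogeneous jump rate is a measurable $\lambda:\mathsf M\to\mathbb R_+$ bounded on compact sets, and a homogeneous Markov kernel $Q$ is a Markov kernel on $(\mathsf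 M,\mathcal B(\mathsf M))$; $Qf(x)=\int f(y)Q(x,dy)$. Together $(\varphi,\lambda,Q)$ are homogeneous characteristics. A PDMP with these characteristics and initial law $\mu_0$ is a process with the law of the following one. Let $G:\mathsf M\times[0,1]\to\mathsf M$ be measurable with $Q(x,A)=\mathbb P(G(x,U)\in A)$, $U$ uniform on $[0,1]$; let $W_0\sim\mu_0$ and, independently, $(E_k,U_k)_{k\ge1}$ i.i.d., $E_k$ exponential with parameter $1$, $U_k$ uniform on $[0,1]$, independent. Set $S_0=0$, $X_0=X'_0=W_0$; given $X_k'\in\mathsf M$, $S_k<\infty$, set $S_{k+1}=\inf\{t\ge S_k:E_{k+1}<\int_{S_k}^t\lambda(\varphi_{s-S_k}(X'_k))\,ds\}$; if $S_{k+1}=+\infty$, set $S_m=+\infty$ for $m>k$ and $X_t=\varphi_{t-S_k}(X_k')$ for $t\ge S_k$; otherwise $X_t=\varphi_{t-S_k}(X'_k)$ for $t\in(S_k,S_{k+1})$ and $X_{S_{k+1}}=X'_{k+1}=G(\varphi_{S_{k+1}-S_k}(X'_k),U_{k+1})$. For $t\ge\sup_kS_k$, $X_t=\infty$. The characteristics (and semigroup) are non-explosive if for every initial law $\inf\{t:X_t=\infty\}=+\infty$ a.s. The semigroup is $P_t(x,A)=\mathbb P(X_t\in A)$ with $X_0=x$, and $P_tf(x)=\mathbb E[f(X_t)]$. A measure $\mu$ is invariant if $\mu P_t=\mu$ for all $t\ge0$. Generator: $\mathcal A$ is the extended generator of the PDMP; for $f\in C^1_c(\mathsf M)$ it is given by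 $\mathcal Af(x)=\langle b(x),\nabla f(x)\rangle+\lambda(x)(Qf(x)-f(x))$, where $b(x)=\partial_t\varphi_t(x)|_{t=0}$. Bounded-displacement property of $(\varphi,\lambda,Q)$: the characteristics are non-explosive and for all $T\ge0$ there exists $r\ge0$ such that $\mathrm{supp}\,P_t(x,\cdot)\subset\overline B(x,r)$ for all $x\in\mathsf M$, $t\in[0,T]$. Compact compatibility: $\varphi$ and $Q$ are compactly compatible if for all compact $K\subset\mathsf M$ and $T\ge0$ there exists a compact set $\tilde K\subset\mathsf M$ such that: for all $n\in\{1,2,\dots\}$ and $(t_i)_{1\le i\le n}\in\mathbb R_+^n$ with $\sum_{i=1}^nt_i\le T$, there exist compact sets $(K_i)_{1\le i\le n}$ of $\mathsf M$ such that, setting $K_0=K$: (1) for all $i\in\{1,\dots,n\}$, $K_i$ only depends on $(t_j)_{1\le j\le i}$, and $\bigcup_{i=0}^nK_i\subset\tilde K$; (2) for all $i\in\{0,\dots,n-1\}$, $s_{i+1}\in[0,t_{i+1}]$ and $s_{n+1}\in[0,T-\sum_{j=1}^nt_j]$, $\bigcup_{x\in K_i}\mathrm{supp}\,Q(\varphi_{t_{i+1}}(x),\cdot)\subset K_{i+1}$, $\varphi_{s_{i+1}}(K_i)\subset\tilde K$ and $\varphi_{s_{n+1}}(K_n)\subset\tilde K$. Stability property of $(\varphi,\lambda,Q)$: (i) $\varphi$ and $Q$ are compactly compatible; (ii) $\lambda\in C^1(\mathsf M)$, $\lambda Qf\in C^1(\mathsf M)$ for all $f\in C^1(\mathsf M)$,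 and there exists a locally bounded function $\Psi:\mathsf M\to\mathbb R_+$ such that for all $f\in C^1(\mathsf M)$, all compact $K\subset\mathsf M$ and all $x\in K$, $\|\nabla(\lambda Qf)(x)\|\le\|\Psi\|_{\infty,K}\sup\{|f(y)|+\|\nabla f(y)\|:y\in\mathrm{supp}\,Q(x,\cdot)\}$; (iii) $(t,x)\mapsto\varphi_t(x)$ is $C^1$ on $\mathbb R_+\times\mathsf M$ and for all compact $K\subset\mathsf M$ and $t\ge0$, $\sup\{\|\nabla\varphi_s(x)\|:s\in[0,t],x\in K\}<+\infty$. The semigroup with characteristics $(\varphi,\lambda,Q)$ is smoothly and compactly approximable if for all $\varepsilon>0$ there exist characteristics $(\varphi,\lambda^\varepsilon,Q^\varepsilon)$ (same flow) with the bounded-displacement property and the stability property such that $$\sup_{x\in\mathsf M,\,A\in\mathcal B(\mathsf M)}\Big\{(\lambda^\varepsilon(x)\wedge\lambda(x))\,|Q^\varepsilon(x,A)-Q(x,A)|+|\lambda^\varepsilon(x)-\lambda(x)|\Big\}\le\varepsilon.$$ *)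

theory Defs
  imports "HOL-Probability.Probability"
begin

text \<open>
  Maps on \<open>M\<close> are total functions on the ambient Euclidean space of which only the values on \<open>M\<close>
  (and, for the time variable, on the half-line \<open>t \<ge> 0\<close>) are ever used.
\<close>

section \<open>Differential calculus on submanifolds\<close>

text \<open>\<open>C\<^sup>k\<close> regularity is only meant for open sets; in finite dimension it suffices to ask for
  continuity of all iterated directional derivatives.\<close>

primrec Ck_on :: "nat \<Rightarrow> 'a::euclidean_space set \<Rightarrow> ('a \<Rightarrow> 'b::euclidean_space) \<Rightarrow> bool" where
  "Ck_on 0 U f \<longleftrightarrow> continuous_on U f"
| "Ck_on (Suc k) U f \<longleftrightarrow>
     (\<forall>x\<in>U. f differentiable (at x)) \<and>
     (\<forall>v. Ck_on k U (\<lambda>x. frechet_derivative f (at x) v))"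

definition smooth_on :: "'a::euclidean_space set \<Rightarrow> ('a \<Rightarrow> 'b::euclidean_space) \<Rightarrow> bool" where
  "smooth_on U f \<longleftrightarrow> (\<forall>k. Ck_on k U f)"

definition smooth_submanifold :: "'a::euclidean_space set \<Rightarrow> bool" where
  "smooth_submanifold M \<longleftrightarrow>
     (\<exists>d. \<forall>p\<in>M. \<exists>U V (\<Phi> :: 'a \<Rightarrow> 'a) \<Psi> (L :: 'a set).
        open U \<and> open V \<and> p \<in> U \<and> homeomorphism U V \<Phi> \<Psi> \<and>
        smooth_on U \<Phi> \<and> smooth_on V \<Psi> \<and>
        subspace L \<and> dim L = d \<and> \<Phi> ` (U \<inter> M) = V \<inter> L)"

text \<open>\<open>C\<^sup>1\<close> maps on a non-open set (a submanifold \<open>M\<close>, or \<open>[0,\<infinity>) \<times> M\<close>) are those that extend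
  locally to \<open>C\<^sup>1\<close> maps on open subsets of the ambient space.\<close>

definition C1_on :: "'a::euclidean_space set \<Rightarrow> ('a \<Rightarrow> 'b::euclidean_space) \<Rightarrow> bool" where
  "C1_on S f \<longleftrightarrow>
     (\<forall>p\<in>S. \<exists>U F. open U \<and> p \<in> U \<and> Ck_on 1 U F \<and> (\<forall>x\<in>U \<inter> S. F x = f x))"

definition C1c_on :: "'a::euclidean_space set \<Rightarrow> ('a \<Rightarrow> real) \<Rightarrow> bool" where
  "C1c_on M f \<longleftrightarrow> C1_on M f \<and> (\<exists>K. compact K \<and> K \<subseteq> M \<and> (\<forall>x\<in>M - K. f x = 0))"

definition C1_diffeo :: "'a::euclidean_space set \<Rightarrow> ('a \<Rightarrow> 'a) \<Rightarrow> bool" where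
  "C1_diffeo M f \<longleftrightarrow> bij_betw f M M \<and> C1_on M f \<and> C1_on M (inv_into M f)"

definition curve_at :: "'a::euclidean_space set \<Rightarrow> 'a \<Rightarrow> 'a \<Rightarrow> (real \<Rightarrow> 'a) \<Rightarrow> bool" where
  "curve_at M x v \<gamma> \<longleftrightarrow>
     (\<exists>e>0. smooth_on {-e<..<e} \<gamma> \<and> \<gamma> ` {-e<..<e} \<subseteq> M) \<and>
     \<gamma> 0 = x \<and> (\<gamma> has_vector_derivative v) (at 0)"

definition tangent_space :: "'a::euclidean_space set \<Rightarrow> 'a \<Rightarrow> 'a set" where
  "tangent_space M x = {v. \<exists>\<gamma>. curve_at M x v \<gamma>}"

definition mdiff ::
    "'a::euclidean_space set \<Rightarrow> ('a \<Rightarrow> 'b::euclidean_space) \<Rightarrow> 'a \<Rightarrow> 'a \<Rightarrow> 'b" where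
  "mdiff M f x v =
     (THE w. \<forall>\<gamma>. curve_at M x v \<gamma> \<longrightarrow> ((\<lambda>t. f (\<gamma> t)) has_vector_derivative w) (at 0))"

text \<open>Operator norm of the differential on the tangent space, which carries the metric induced
  from the ambient space.\<close>

definition mdiff_norm ::
    "'a::euclidean_space set \<Rightarrow> ('a \<Rightarrow> 'b::euclidean_space) \<Rightarrow> 'a \<Rightarrow> real" where
  "mdiff_norm M f x = (SUP v \<in> {v \<in> tangent_space M x. norm v \<le> 1}. norm (mdiff M f x v))"

definition mgrad :: "'a::euclidean_space set \<Rightarrow> ('a \<Rightarrow> real) \<Rightarrow> 'a \<Rightarrow> 'a" where
  "mgrad M f x =
     (THE g. g \<in> tangent_space M x \<and> (\<forall>v\<in>tangent_space M x. g \<bullet> v = mdiff M f x v))"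

text \<open>The infimum over the empty set is \<open>\<infinity>\<close>, so points in different components are at
  infinite distance.\<close>

definition riem_dist :: "'a::euclidean_space set \<Rightarrow> 'a \<Rightarrow> 'a \<Rightarrow> ennreal" where
  "riem_dist M x y =
     (INF \<gamma> \<in> {\<gamma>. \<gamma> piecewise_C1_differentiable_on {0..1} \<and> path_image \<gamma> \<subseteq> M \<and>
                   pathstart \<gamma> = x \<and> pathfinish \<gamma> = y}.
        \<integral>\<^sup>+ t\<in>{0..1}. ennreal (norm (vector_derivative \<gamma> (at t))) \<partial>lborel)"

definition riem_cball :: "'a::euclidean_space set \<Rightarrow> 'a \<Rightarrow> real \<Rightarrow> 'a set" where
  "riem_cball M x r = {y \<in> M. riem_dist M x y \<le> ennreal r}"


section \<open>Characteristics\<close>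

abbreviation mborel :: "'a::euclidean_space set \<Rightarrow> 'a measure" where
  "mborel M \<equiv> restrict_space borel M"

definition msupport :: "'a::topological_space measure \<Rightarrow> 'a set" where
  "msupport \<nu> = {y \<in> space \<nu>. \<forall>U. open U \<and> y \<in> U \<longrightarrow> emeasure \<nu> (U \<inter> space \<nu>) > 0}"

definition differential_flow :: "'a::euclidean_space set \<Rightarrow> (real \<Rightarrow> 'a \<Rightarrow> 'a) \<Rightarrow> bool" where
  "differential_flow M \<phi> \<longleftrightarrow>
     (\<lambda>(t, x). \<phi> t x) \<in> restrict_space borel {0..} \<Otimes>\<^sub>M mborel M \<rightarrow>\<^sub>M mborel M \<and>
     (\<forall>x\<in>M. \<phi> 0 x = x) \<and>
     (\<forall>s\<ge>0. \<forall>t\<ge>0. \<forall>x\<in>M. \<phi> (t + s) x = \<phi> s (\<phi> t x)) \<and>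
     (\<forall>x\<in>M. C1_on {0..} (\<lambda>t. \<phi> t x)) \<and>
     (\<forall>t\<ge>0. C1_diffeo M (\<phi> t))"

definition jump_rate :: "'a::euclidean_space set \<Rightarrow> ('a \<Rightarrow> real) \<Rightarrow> bool" where
  "jump_rate M l \<longleftrightarrow>
     l \<in> borel_measurable (mborel M) \<and> (\<forall>x\<in>M. 0 \<le> l x) \<and>
     (\<forall>K. compact K \<and> K \<subseteq> M \<longrightarrow> bounded (l ` K))"

definition markov_kernel :: "'a::euclidean_space set \<Rightarrow> ('a \<Rightarrow> 'a measure) \<Rightarrow> bool" where
  "markov_kernel M Q \<longleftrightarrow> Q \<in> mborel M \<rightarrow>\<^sub>M prob_algebra (mborel M)"

definition characteristics ::
    "'a::euclidean_space set \<Rightarrow> (real \<Rightarrow> 'a \<Rightarrow> 'a) \<Rightarrow> ('a \<Rightarrow> real) \<Rightarrow> ('a \<Rightarrow> 'a measure) \<Rightarrow> bool"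
  where
  "characteristics M \<phi> l Q \<longleftrightarrow> differential_flow M \<phi> \<and> jump_rate M l \<and> markov_kernel M Q"

definition kernel_apply :: "('a \<Rightarrow> 'a measure) \<Rightarrow> ('a \<Rightarrow> real) \<Rightarrow> 'a \<Rightarrow> real" where
  "kernel_apply Q f x = (\<integral>y. f y \<partial>Q x)"


section \<open>Construction of the process\<close>

definition unit_uniform :: "real measure" where
  "unit_uniform = restrict_space lborel {0..1}"

text \<open>The law of the i.i.d. pairs; component \<open>k\<close> plays the role of \<open>(E\<^sub>k\<^sub>+\<^sub>1, U\<^sub>k\<^sub>+\<^sub>1)\<close>.\<close>

definition noise :: "(nat \<Rightarrow> real \<times> real) measure" where
  "noise = Pi\<^sub>M UNIV (\<lambda>_. density lborel (exponential_density 1) \<Otimes>\<^sub>M unit_uniform)"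

text \<open>\<open>G\<close> simulates the kernel \<open>Q\<close>.  The law of the process below depends on \<open>G\<close> through
  \<open>Q\<close> only, so the notions stated with \<open>G\<close> are properties of the characteristics.\<close>

definition simulates ::
    "'a::euclidean_space set \<Rightarrow> ('a \<Rightarrow> real \<Rightarrow> 'a) \<Rightarrow> ('a \<Rightarrow> 'a measure) \<Rightarrow> bool" where
  "simulates M G Q \<longleftrightarrow>
     (\<lambda>(x, u). G x u) \<in> mborel M \<Otimes>\<^sub>M unit_uniform \<rightarrow>\<^sub>M mborel M \<and>
     (\<forall>x\<in>M. \<forall>A\<in>sets (mborel M).
        emeasure (Q x) A = emeasure unit_uniform {u \<in> {0..1}. G x u \<in> A})"

definition next_jump ::
    "(real \<Rightarrow> 'a \<Rightarrow> 'a) \<Rightarrow> ('a \<Rightarrow> real) \<Rightarrow> real \<Rightarrow> 'a \<Rightarrow> real \<Rightarrow> ereal" where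
  "next_jump \<phi> l S y e =
     Inf {ereal t | t. S \<le> t \<and> e < (LBINT s:{S..t}. l (\<phi> (s - S) y))}"

text \<open>The pairs \<open>(S\<^sub>k, X'\<^sub>k)\<close>; the second component is irrelevant once \<open>S\<^sub>k = \<infinity>\<close>.\<close>

primrec skeleton ::
    "(real \<Rightarrow> 'a \<Rightarrow> 'a) \<Rightarrow> ('a \<Rightarrow> real) \<Rightarrow> ('a \<Rightarrow> real \<Rightarrow> 'a) \<Rightarrow> 'a \<Rightarrow> (nat \<Rightarrow> real \<times> real) \<Rightarrow>
     nat \<Rightarrow> ereal \<times> 'a" where
  "skeleton \<phi> l G x \<omega> 0 = (0, x)"
| "skeleton \<phi> l G x \<omega> (Suc k) =
     (let (S, y) = skeleton \<phi> l G x \<omega> k in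
      if S = \<infinity> then (\<infinity>, y)
      else let S' = next_jump \<phi> l (real_of_ereal S) y (fst (\<omega> k)) in
        if S' = \<infinity> then (\<infinity>, y)
        else (S', G (\<phi> (real_of_ereal S' - real_of_ereal S) y) (snd (\<omega> k))))"

text \<open>The position at time \<open>t\<close>, where \<open>None\<close> is the cemetery point.  As \<open>\<phi>\<^sub>0\<close> is the identity,
  the case \<open>t = S\<^sub>k\<close> gives \<open>X'\<^sub>k\<close>.\<close>

definition pdmp_path ::
    "(real \<Rightarrow> 'a \<Rightarrow> 'a) \<Rightarrow> ('a \<Rightarrow> real) \<Rightarrow> ('a \<Rightarrow> real \<Rightarrow> 'a) \<Rightarrow> 'a \<Rightarrow> (nat \<Rightarrow> real \<times> real) \<Rightarrow>
     real \<Rightarrow> 'a option" where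
  "pdmp_path \<phi> l G x \<omega> t =
     (let S = (\<lambda>k. fst (skeleton \<phi> l G x \<omega> k)); X' = (\<lambda>k. snd (skeleton \<phi> l G x \<omega> k)) in
      if ereal t < (SUP k. S k)
      then let k = (THE k. S k \<le> ereal t \<and> ereal t < S (Suc k))
           in Some (\<phi> (t - real_of_ereal (S k)) (X' k))
      else None)"

definition explosion_time ::
    "(real \<Rightarrow> 'a \<Rightarrow> 'a) \<Rightarrow> ('a \<Rightarrow> real) \<Rightarrow> ('a \<Rightarrow> real \<Rightarrow> 'a) \<Rightarrow> 'a \<Rightarrow> (nat \<Rightarrow> real \<times> real) \<Rightarrow> ereal"
  where
  "explosion_time \<phi> l G x \<omega> = Inf {ereal t | t. 0 \<le> t \<and> pdmp_path \<phi> l G x \<omega> t = None}"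

definition non_explosive ::
    "'a::euclidean_space set \<Rightarrow> (real \<Rightarrow> 'a \<Rightarrow> 'a) \<Rightarrow> ('a \<Rightarrow> real) \<Rightarrow> ('a \<Rightarrow> real \<Rightarrow> 'a) \<Rightarrow> bool"
  where
  "non_explosive M \<phi> l G \<longleftrightarrow>
     (\<forall>\<mu>\<^sub>0. prob_space \<mu>\<^sub>0 \<and> sets \<mu>\<^sub>0 = sets (mborel M) \<longrightarrow>
        (AE p in \<mu>\<^sub>0 \<Otimes>\<^sub>M noise. explosion_time \<phi> l G (fst p) (snd p) = \<infinity>))"

definition pdmp_semigroup ::
    "'a::euclidean_space set \<Rightarrow> (real \<Rightarrow> 'a \<Rightarrow> 'a) \<Rightarrow> ('a \<Rightarrow> real) \<Rightarrow> ('a \<Rightarrow> real \<Rightarrow> 'a) \<Rightarrow>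
     real \<Rightarrow> 'a \<Rightarrow> 'a measure" where
  "pdmp_semigroup M \<phi> l G t x =
     measure_of M (sets (mborel M))
       (\<lambda>A. emeasure noise {\<omega> \<in> space noise. pdmp_path \<phi> l G x \<omega> t \<in> Some ` A})"

definition invariant_measure ::
    "'a measure \<Rightarrow> (real \<Rightarrow> 'a \<Rightarrow> 'a measure) \<Rightarrow> bool" where
  "invariant_measure \<mu> P \<longleftrightarrow>
     (\<forall>t\<ge>0. \<forall>A\<in>sets \<mu>. (\<integral>\<^sup>+ x. emeasure (P t x) A \<partial>\<mu>) = emeasure \<mu> A)"

text \<open>The extended generator on \<open>C\<^sup>1\<close> functions with compact support.\<close>

definition generator ::
    "'a::euclidean_space set \<Rightarrow> (real \<Rightarrow> 'a \<Rightarrow> 'a) \<Rightarrow> ('a \<Rightarrow> real) \<Rightarrow> ('a \<Rightarrow> 'a measure) \<Rightarrow>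
     ('a \<Rightarrow> real) \<Rightarrow> 'a \<Rightarrow> real" where
  "generator M \<phi> l Q f x =
     vector_derivative (\<lambda>t. \<phi> t x) (at 0 within {0..}) \<bullet> mgrad M f x
     + l x * (kernel_apply Q f x - f x)"


section \<open>Approximability\<close>

definition bounded_displacement ::
    "'a::euclidean_space set \<Rightarrow> (real \<Rightarrow> 'a \<Rightarrow> 'a) \<Rightarrow> ('a \<Rightarrow> real) \<Rightarrow> ('a \<Rightarrow> real \<Rightarrow> 'a) \<Rightarrow> bool"
  where
  "bounded_displacement M \<phi> l G \<longleftrightarrow>
     non_explosive M \<phi> l G \<and>
     (\<forall>T\<ge>0. \<exists>r\<ge>0. \<forall>x\<in>M. \<forall>t\<in>{0..T}.
        msupport (pdmp_semigroup M \<phi> l G t x) \<subseteq> riem_cball M x r)"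

text \<open>The requirement that \<open>K\<^sub>i\<close> depends only on \<open>t\<^sub>1, \<dots>, t\<^sub>i\<close> is expressed by taking
  \<open>K\<^sub>i = \<K> [t\<^sub>1, \<dots>, t\<^sub>i]\<close> for a single function \<open>\<K>\<close> chosen before \<open>n\<close> and the times.
  Lists being indexed from 0, \<open>ts ! i\<close> is \<open>t\<^sub>i\<^sub>+\<^sub>1\<close>.\<close>

definition compactly_compatible ::
    "'a::euclidean_space set \<Rightarrow> (real \<Rightarrow> 'a \<Rightarrow> 'a) \<Rightarrow> ('a \<Rightarrow> 'a measure) \<Rightarrow> bool" where
  "compactly_compatible M \<phi> Q \<longleftrightarrow>
     (\<forall>K T. compact K \<and> K \<subseteq> M \<and> 0 \<le> T \<longrightarrow>
       (\<exists>K' \<K>. compact K' \<and> K' \<subseteq> M \<and> \<K> [] = K \<and>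
         (\<forall>ts. ts \<noteq> [] \<and> (\<forall>t\<in>set ts. 0 \<le> t) \<and> sum_list ts \<le> T \<longrightarrow>
           (\<forall>i\<in>{1..length ts}. compact (\<K> (take i ts)) \<and> \<K> (take i ts) \<subseteq> M) \<and>
           (\<Union>i\<in>{0..length ts}. \<K> (take i ts)) \<subseteq> K' \<and>
           (\<forall>i<length ts.
              (\<Union>x\<in>\<K> (take i ts). msupport (Q (\<phi> (ts ! i) x))) \<subseteq> \<K> (take (Suc i) ts) \<and>
              (\<forall>s\<in>{0..ts ! i}. \<phi> s ` \<K> (take i ts) \<subseteq> K')) \<and>
           (\<forall>s\<in>{0..T - sum_list ts}. \<phi> s ` \<K> ts \<subseteq> K'))))"

definition locally_bounded :: "'a::euclidean_space set \<Rightarrow> ('a \<Rightarrow> real) \<Rightarrow> bool" where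
  "locally_bounded M \<psi> \<longleftrightarrow> (\<forall>x\<in>M. \<exists>U. open U \<and> x \<in> U \<and> bounded (\<psi> ` (U \<inter> M)))"

definition stability ::
    "'a::euclidean_space set \<Rightarrow> (real \<Rightarrow> 'a \<Rightarrow> 'a) \<Rightarrow> ('a \<Rightarrow> real) \<Rightarrow> ('a \<Rightarrow> 'a measure) \<Rightarrow> bool"
  where
  "stability M \<phi> l Q \<longleftrightarrow>
     compactly_compatible M \<phi> Q \<and>
     (C1_on M l \<and>
      (\<forall>f. C1_on M f \<longrightarrow> C1_on M (\<lambda>x. l x * kernel_apply Q f x)) \<and>
      (\<exists>\<psi>. locally_bounded M \<psi> \<and> (\<forall>x\<in>M. 0 \<le> \<psi> x) \<and>
        (\<forall>f K x. C1_on M f \<and> compact K \<and> K \<subseteq> M \<and> x \<in> K \<longrightarrow>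
           norm (mgrad M (\<lambda>x. l x * kernel_apply Q f x) x)
           \<le> (SUP z\<in>K. \<bar>\<psi> z\<bar>) * (SUP y\<in>msupport (Q x). \<bar>f y\<bar> + norm (mgrad M f y))))) \<and>
     (C1_on ({0..} \<times> M) (\<lambda>(t, x). \<phi> t x) \<and>
      (\<forall>K t. compact K \<and> K \<subseteq> M \<and> 0 \<le> t \<longrightarrow>
        bdd_above ((\<lambda>(s, x). mdiff_norm M (\<phi> s) x) ` ({0..t} \<times> K))))"

definition smoothly_compactly_approximable ::
    "'a::euclidean_space set \<Rightarrow> (real \<Rightarrow> 'a \<Rightarrow> 'a) \<Rightarrow> ('a \<Rightarrow> real) \<Rightarrow> ('a \<Rightarrow> 'a measure) \<Rightarrow> bool"
  where
  "smoothly_compactly_approximable M \<phi> l Q \<longleftrightarrow>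
     (\<forall>\<epsilon>>0. \<exists>l' Q' G'.
        characteristics M \<phi> l' Q' \<and> simulates M G' Q' \<and>
        bounded_displacement M \<phi> l' G' \<and> stability M \<phi> l' Q' \<and>
        (\<forall>x\<in>M. \<forall>A\<in>sets (mborel M).
           min (l' x) (l x) * \<bar>measure (Q' x) A - measure (Q x) A\<bar> + \<bar>l' x - l x\<bar> \<le> \<epsilon>))"

end

theory Submission
  imports Defs
begin

text \<open>
  Write \<open>T\<^sub>t f = f \<circ> \<phi>\<^sub>t\<close>, \<open>S\<^sub>t f = exp (- \<Lambda>\<^sub>t) * T\<^sub>t f\<close> with
  \<open>\<Lambda>\<^sub>t x\<close> the integral of the rate along the orbit, and \<open>J f = l * Q f\<close>.
  The transport semigroup \<open>T\<close> preserves \<open>C\<^sup>1\<close> functions with compact support, and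
  \<open>d/dt (T\<^sub>t g) = \<langle>b, \<nabla>(T\<^sub>t g)\<rangle>\<close>. Hence integrating the hypothesis for
  \<open>T\<^sub>s g\<close> over \<open>s \<in> [0, t]\<close> gives
  \<open>\<mu> T\<^sub>t + \<integral>\<^sub>0\<^sup>t (\<mu> J) T\<^sub>s ds = \<mu> + \<integral>\<^sub>0\<^sup>t (l \<mu>) T\<^sub>s ds\<close>,
  an identity between finite measures because the rate is \<open>\<mu>\<close>-integrable. No regularity of the
  test functions is needed any more: Duhamel's formula for \<open>T\<close> and \<open>S\<close> turns it into
  \<open>\<mu> = \<mu> S\<^sub>t + \<integral>\<^sub>0\<^sup>t (\<mu> J) S\<^sub>s ds\<close>, and iterating this along the jumps gives
  \<open>\<mu> P\<^sub>t \<le> \<mu>\<close>. By non-explosion both sides have mass one, so they are equal.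

  Approximability enters only through the joint \<open>C\<^sup>1\<close> regularity of the flow, which makes the vector
  field \<open>b\<close> continuous.
\<close>

section \<open>C1 maps and the tangent space\<close>

text \<open>The obstacle is regularity. The rate is only measurable and bounded on compact sets and
  \<open>Q\<close> is only measurable, so neither the killed semigroup nor \<open>P\<close> need map
  C1 functions to C1 functions, and the hypothesis cannot be applied to \<open>P\<^sub>t f\<close>.
  Composition with the flow does keep the test class. The generator identity is therefore used along
  the flow and turned into an identity of measures; the rate is put back by exact algebra with
  exponentials of its primitive along orbits. All measure identities have the form
  \<open>a + b = c + d\<close> in \<open>ennreal\<close>, since they are tested with arbitrary
  nonnegative measurable functions; a common term is cancelled only once it is known to be finite.
  The iteration over jumps leaves a nonnegative remainder that is discarded, whence an inequality.
  Non-explosion, taken with \<open>\<mu>\<close> itself as initial law, restores equality: the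
  inequality for a set and for its complement leaves no room for a loss of mass.\<close>

lemma Ck_on_1I:
  assumes "\<And>x. x \<in> U \<Longrightarrow> (F has_derivative F' x) (at x)"
    and "\<And>v. continuous_on U (\<lambda>x. F' x v)"
  shows "Ck_on 1 U F"
proof -
  have "frechet_derivative F (at x) = F' x" if "x \<in> U" for x
    using assms(1)[OF that] by (metis frechet_derivative_at)
  then have "continuous_on U (\<lambda>x. frechet_derivative F (at x) v)" for v
    using assms(2)[of v] by (simp cong: continuous_on_cong)
  then show ?thesis
    using assms(1) by (auto simp: differentiable_def)
qed

lemma Ck_on_1_has_derivative:
  assumes "Ck_on 1 U F" "x \<in> U"
  shows "(F has_derivative frechet_derivative F (at x)) (at x)"
  using assms by (simp add: frechet_derivative_works)

lemma Ck_on_1_continuous_derivative: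
  assumes "Ck_on 1 U F"
  shows "continuous_on U (\<lambda>x. frechet_derivative F (at x) v)"
  using assms by simp

lemma Ck_on_1_continuous:
  assumes "Ck_on 1 U F"
  shows "continuous_on U F"
proof (rule differentiable_imp_continuous_on)
  have "\<forall>x\<in>U. F differentiable (at x)" using assms by simp
  then show "F differentiable_on U"
    unfolding differentiable_on_def by (blast intro: differentiable_at_withinI)
qed

lemma Ck_on_1_subset: "Ck_on 1 U F \<Longrightarrow> V \<subseteq> U \<Longrightarrow> Ck_on 1 V F"
  by (auto intro: continuous_on_subset)

lemma linear_eq_sum_Basis:
  fixes L :: "'a::euclidean_space \<Rightarrow> 'b::real_vector"
  assumes "linear L"
  shows "L w = (\<Sum>i\<in>Basis. (w \<bullet> i) *\<^sub>R L i)"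
proof -
  have "L w = L (\<Sum>i\<in>Basis. (w \<bullet> i) *\<^sub>R i)"
    by (simp add: euclidean_representation)
  also have "\<dots> = (\<Sum>i\<in>Basis. (w \<bullet> i) *\<^sub>R L i)"
    by (simp add: linear_sum[OF assms] linear_scale[OF assms] o_def)
  finally show ?thesis .
qed

text \<open>\<open>Ck_on\<close> gives continuity of the derivative only in fixed directions, while
  in the chain rule the direction fed to the derivative of \<open>H\<close> moves with
  \<open>x\<close>. Expanding that direction in the basis leaves only fixed directions.\<close>

lemma Ck_on_1_compose:
  assumes F: "Ck_on 1 U F" and H: "Ck_on 1 V H" and "F ` U \<subseteq> V"
  shows "Ck_on 1 U (\<lambda>x. H (F x))"
proof (rule Ck_on_1I)
  let ?F = "\<lambda>x. frechet_derivative F (at x)" and ?H = "\<lambda>y. frechet_derivative H (at y)"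
  fix x assume x: "x \<in> U"
  then have "F x \<in> V" using assms by auto
  show "((\<lambda>x. H (F x)) has_derivative (\<lambda>v. \<Sum>i\<in>Basis. (?F x v \<bullet> i) *\<^sub>R ?H (F x) i)) (at x)"
  proof -
    have lin: "linear (?H (F x))"
      using Ck_on_1_has_derivative[OF H \<open>F x \<in> V\<close>] has_derivative_linear by blast
    have "((\<lambda>x. H (F x)) has_derivative (\<lambda>v. ?H (F x) (?F x v))) (at x)"
      by (rule has_derivative_compose[OF Ck_on_1_has_derivative[OF F x]
            Ck_on_1_has_derivative[OF H \<open>F x \<in> V\<close>]])
    then show ?thesis
      by (subst (asm) linear_eq_sum_Basis[OF lin])
  qed
next
  fix v
  have "continuous_on U (\<lambda>x. frechet_derivative H (at (F x)) i)" for i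
    using continuous_on_compose2[OF Ck_on_1_continuous_derivative[OF H]
        Ck_on_1_continuous[OF F] assms(3)] .
  then show "continuous_on U (\<lambda>x. \<Sum>i\<in>Basis. (frechet_derivative F (at x) v \<bullet> i) *\<^sub>R
      frechet_derivative H (at (F x)) i)"
    by (intro continuous_intros Ck_on_1_continuous_derivative[OF F])
qed

lemma C1_onE:
  assumes "C1_on S f" "p \<in> S"
  obtains U F where "open U" "p \<in> U" "Ck_on 1 U F" "\<And>x. x \<in> U \<inter> S \<Longrightarrow> F x = f x"
  using assms unfolding C1_on_def by meson

lemma C1_onI:
  assumes "\<And>p. p \<in> S \<Longrightarrow> \<exists>U F. open U \<and> p \<in> U \<and> Ck_on 1 U F \<and> (\<forall>x\<in>U \<inter> S. F x = f x)"
  shows "C1_on S f"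
  using assms unfolding C1_on_def by blast

lemma C1_on_Ck_on: "Ck_on 1 UNIV f \<Longrightarrow> C1_on S f"
  by (rule C1_onI) blast

lemma C1_on_continuous_on:
  assumes "C1_on S f"
  shows "continuous_on S f"
proof (clarsimp simp: continuous_on_eq_continuous_within)
  fix x assume x: "x \<in> S"
  obtain U F where U: "open U" "x \<in> U" "Ck_on 1 U F" "\<And>x. x \<in> U \<inter> S \<Longrightarrow> F x = f x"
    using C1_onE[OF assms x] by metis
  have "continuous (at x within S) F"
    using Ck_on_1_continuous[OF U(3)] U(1,2)
    by (meson continuous_at_imp_continuous_within continuous_on_eq_continuous_at)
  moreover have "eventually (\<lambda>y. F y = f y) (at x within S)"
    using U by (auto simp: eventually_at_topological)
  ultimately show "continuous (at x within S) f"
    using U x by (metis IntI continuous_within Lim_cong_within tendsto_cong)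
qed

lemma C1_on_compose:
  assumes f: "C1_on S f" and g: "C1_on S' g" and im: "f ` S \<subseteq> S'"
  shows "C1_on S (\<lambda>x. g (f x))"
proof (rule C1_onI)
  fix p assume p: "p \<in> S"
  obtain U F where U: "open U" "p \<in> U" "Ck_on 1 U F" "\<And>x. x \<in> U \<inter> S \<Longrightarrow> F x = f x"
    using C1_onE[OF f p] by metis
  obtain V H where V: "open V" "f p \<in> V" "Ck_on 1 V H" "\<And>x. x \<in> V \<inter> S' \<Longrightarrow> H x = g x"
    using C1_onE[OF g, of "f p"] p im by blast
  let ?W = "U \<inter> F -` V"
  have "open ?W"
    using Ck_on_1_continuous[OF U(3)] U(1) V(1) by (metis Int_commute continuous_on_open_vimage)
  moreover have "p \<in> ?W" using U V p by simp
  moreover have "Ck_on 1 ?W (\<lambda>x. H (F x))"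
    by (rule Ck_on_1_compose[OF Ck_on_1_subset[OF U(3)] V(3)]) auto
  moreover have "\<forall>x\<in>?W \<inter> S. H (F x) = g (f x)"
    using U(4) V(4) im by fastforce
  ultimately show "\<exists>U F. open U \<and> p \<in> U \<and> Ck_on 1 U F \<and> (\<forall>x\<in>U \<inter> S. F x = g (f x))"
    by (intro exI[of _ ?W] exI[of _ "\<lambda>x. H (F x)"]) auto
qed

lemma C1_on_mult:
  fixes f g :: "'a::euclidean_space \<Rightarrow> real"
  assumes f: "C1_on S f" and g: "C1_on S g"
  shows "C1_on S (\<lambda>x. f x * g x)"
proof (rule C1_onI)
  fix p assume p: "p \<in> S"
  obtain U F where U: "open U" "p \<in> U" "Ck_on 1 U F" "\<And>x. x \<in> U \<inter> S \<Longrightarrow> F x = f x"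
    using C1_onE[OF f p] by metis
  obtain V H where V: "open V" "p \<in> V" "Ck_on 1 V H" "\<And>x. x \<in> V \<inter> S \<Longrightarrow> H x = g x"
    using C1_onE[OF g p] by metis
  have "Ck_on 1 (U \<inter> V) (\<lambda>x. F x * H x)"
  proof (rule Ck_on_1I)
    show "((\<lambda>x. F x * H x) has_derivative
        (\<lambda>v. F x * frechet_derivative H (at x) v + frechet_derivative F (at x) v * H x)) (at x)"
      if "x \<in> U \<inter> V" for x
      using that by (intro has_derivative_mult Ck_on_1_has_derivative[OF U(3)]
          Ck_on_1_has_derivative[OF V(3)]) auto
    show "continuous_on (U \<inter> V)
        (\<lambda>x. F x * frechet_derivative H (at x) v + frechet_derivative F (at x) v * H x)" for v
      by (intro continuous_intros continuous_on_subset[OF Ck_on_1_continuous[OF U(3)]]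
          continuous_on_subset[OF Ck_on_1_continuous[OF V(3)]]
          continuous_on_subset[OF Ck_on_1_continuous_derivative[OF U(3)]]
          continuous_on_subset[OF Ck_on_1_continuous_derivative[OF V(3)]]) auto
  qed
  then show "\<exists>U F. open U \<and> p \<in> U \<and> Ck_on 1 U F \<and> (\<forall>x\<in>U \<inter> S. F x = f x * g x)"
    using U V by (intro exI[of _ "U \<inter> V"] exI[of _ "\<lambda>x. F x * H x"]) auto
qed

lemma Ck_on_1_real:
  fixes h :: "real \<Rightarrow> real"
  assumes "\<And>u. (h has_real_derivative h' u) (at u)" and "continuous_on UNIV h'"
  shows "Ck_on 1 UNIV h"
proof (rule Ck_on_1I)
  show "(h has_derivative (\<lambda>v. h' x * v)) (at x)" for x
    using assms(1) by (simp add: has_field_derivative_def)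
  show "continuous_on UNIV (\<lambda>x. h' x * v)" for v
    using assms(2) by (intro continuous_intros)
qed

lemma Ck_on_cong:
  assumes "open U" "\<And>x. x \<in> U \<Longrightarrow> f x = g x"
  shows "Ck_on k U f \<longleftrightarrow> Ck_on k U g"
  using assms(2)
proof (induction k arbitrary: f g)
  case 0
  then show ?case by (simp cong: continuous_on_cong)
next
  case (Suc k)
  have der: "(f has_derivative D) (at x) \<longleftrightarrow> (g has_derivative D) (at x)" if "x \<in> U" for x D
    using has_derivative_transform_within_open[OF _ \<open>open U\<close> that, of f D UNIV g]
      has_derivative_transform_within_open[OF _ \<open>open U\<close> that, of g D UNIV f] Suc.prems
    by auto
  have fd: "frechet_derivative f (at x) = frechet_derivative g (at x)" if "x \<in> U" for x
    unfolding frechet_derivative_def using der[OF that] by simp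
  have "Ck_on k U (\<lambda>x. frechet_derivative f (at x) v) =
      Ck_on k U (\<lambda>x. frechet_derivative g (at x) v)" for v
    by (rule Suc.IH) (simp add: fd)
  then show ?case
    using der by (auto simp: differentiable_def)
qed

text \<open>Differentiating along the line yields a directional derivative of \<open>f\<close> on
  the same line, so the induction closes. Applied to an inverse chart this produces the smooth
  curves that realise prescribed tangent vectors.\<close>

lemma Ck_on_affine_line:
  fixes f :: "'a::euclidean_space \<Rightarrow> 'b::euclidean_space" and I :: "real set"
  assumes "Ck_on k V f" "open I" "\<And>s. s \<in> I \<Longrightarrow> p + s *\<^sub>R w \<in> V"
  shows "Ck_on k I (\<lambda>s. f (p + s *\<^sub>R w))"
  using assms(1)
proof (induction k arbitrary: f)
  case 0
  then show ?case
    using assms(3) by (auto intro!: continuous_on_compose2[of V f] continuous_intros)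
next
  case (Suc k)
  have der: "((\<lambda>s. f (p + s *\<^sub>R w)) has_derivative
      (\<lambda>v. frechet_derivative f (at (p + s *\<^sub>R w)) (v *\<^sub>R w))) (at s)" if "s \<in> I" for s
  proof -
    have "(f has_derivative frechet_derivative f (at (p + s *\<^sub>R w))) (at (p + s *\<^sub>R w))"
      using Suc.prems assms(3)[OF that] by (simp add: frechet_derivative_works)
    moreover have "((\<lambda>s. p + s *\<^sub>R w) has_derivative (\<lambda>v. v *\<^sub>R w)) (at s)"
      by (auto intro!: derivative_eq_intros)
    ultimately show ?thesis
      by (rule has_derivative_compose[rotated])
  qed
  have fd: "frechet_derivative (\<lambda>s. f (p + s *\<^sub>R w)) (at s) =
      (\<lambda>v. frechet_derivative f (at (p + s *\<^sub>R w)) (v *\<^sub>R w))" if "s \<in> I" for s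
    using der[OF that] by (metis frechet_derivative_at)
  have "Ck_on k I (\<lambda>s. frechet_derivative f (at (p + s *\<^sub>R w)) (v *\<^sub>R w))" for v
    using Suc.IH[of "\<lambda>x. frechet_derivative f (at x) (v *\<^sub>R w)"] Suc.prems by simp
  then have "Ck_on k I (\<lambda>s. frechet_derivative (\<lambda>s. f (p + s *\<^sub>R w)) (at s) v)" for v
    by (subst Ck_on_cong[OF \<open>open I\<close>,
          where g = "\<lambda>s. frechet_derivative f (at (p + s *\<^sub>R w)) (v *\<^sub>R w)"]) (auto simp: fd)
  then show ?case
    using der by (auto simp: differentiable_def)
qed

section \<open>Tangent vectors and gradients from one-sided curves\<close>

lemma at_within_Ici: "at s within {s..} = at_right (s::real)"
proof -
  have "{s..} - {s} = {s<..} - {s}" by auto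
  then show ?thesis unfolding at_within_def by simp
qed

text \<open>Right difference quotients stay in \<open>L\<close>, which is closed. A right derivative
  is all that is available at time 0, because the flow runs in nonnegative time.\<close>

lemma subspace_right_derivative:
  fixes h :: "real \<Rightarrow> 'a::euclidean_space"
  assumes L: "subspace L" and der: "(h has_vector_derivative v) (at 0 within {0..})"
    and ev: "\<forall>\<^sub>F t in at_right 0. h t \<in> L" and h0: "h 0 \<in> L"
  shows "v \<in> L"
proof -
  note at0 = at_within_Ici[of "0::real"]
  have "((\<lambda>t. (1 / norm (t - 0)) *\<^sub>R (h t - (h 0 + (t - 0) *\<^sub>R v))) \<longlongrightarrow> 0) (at_right 0)"
    using der unfolding has_vector_derivative_def has_derivative_within at0 by simp
  then have "((\<lambda>t. (1 / norm (t - 0)) *\<^sub>R (h t - (h 0 + (t - 0) *\<^sub>R v)) + v) \<longlongrightarrow> 0 + v)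
      (at_right 0)"
    by (intro tendsto_intros)
  moreover have "\<forall>\<^sub>F t in at_right (0::real).
      (1 / norm (t - 0)) *\<^sub>R (h t - (h 0 + (t - 0) *\<^sub>R v)) + v = (1 / t) *\<^sub>R (h t - h 0)"
    using eventually_at_right_less[of 0]
    by eventually_elim (simp add: algebra_simps)
  ultimately have lim: "((\<lambda>t. (1 / t) *\<^sub>R (h t - h 0)) \<longlongrightarrow> v) (at_right 0)"
    by (simp add: filterlim_cong)
  have "\<forall>\<^sub>F t in at_right 0. (1 / t) *\<^sub>R (h t - h 0) \<in> L"
    using ev by eventually_elim (intro subspace_scale subspace_diff L h0)
  then show ?thesis
    by (rule Lim_in_closed_set[OF closed_subspace[OF L] _ _ lim]) simp
qed

lemma vector_derivative_compose:
  assumes "(\<gamma> has_vector_derivative v) (at s within S)" "(F has_derivative D) (at (\<gamma> s))"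
  shows "((\<lambda>t. F (\<gamma> t)) has_vector_derivative D v) (at s within S)"
  using vector_derivative_diff_chain_within[OF assms(1) has_derivative_at_withinI[OF assms(2)]]
  by (simp add: o_def)

lemma eventually_curve_in_open:
  assumes "(\<gamma> has_vector_derivative v) (at s within S)" "open U" "\<gamma> s \<in> U"
  shows "\<forall>\<^sub>F t in at s within S. \<gamma> t \<in> U"
  using has_vector_derivative_continuous[OF assms(1)] assms(2,3)
  by (simp add: continuous_within topological_tendstoD)

text \<open>In a chart flattening \<open>M\<close> to the subspace \<open>L\<close>, the tangent
  space is the preimage of \<open>L\<close> under the derivative of the chart. The second claim
  serves the orbits, which are one-sided and merely C1 and so do not qualify for
  \<open>curve_at\<close>: their velocity is shown to be mapped into \<open>L\<close>, and a
  different, smooth curve with the same velocity is then built in the chart.\<close>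

lemma submanifold_tangent_space:
  fixes M :: "'a::euclidean_space set"
  assumes M: "smooth_submanifold M" and x: "x \<in> M"
  shows "subspace (tangent_space M x)" (is ?A)
    and "(\<gamma> has_vector_derivative v) (at 0 within {0..}) \<Longrightarrow> \<gamma> 0 = x \<Longrightarrow>
      (\<And>t. t \<ge> 0 \<Longrightarrow> \<gamma> t \<in> M) \<Longrightarrow> v \<in> tangent_space M x"
proof -
  obtain U V \<Phi> \<Psi> and L :: "'a set" where
    UV: "open U" "open V" "x \<in> U" "homeomorphism U V \<Phi> \<Psi>" "smooth_on U \<Phi>" "smooth_on V \<Psi>"
      "subspace L" "\<Phi> ` (U \<inter> M) = V \<inter> L"
    using M x unfolding smooth_submanifold_def by metis
  have Phi: "(\<Phi> has_derivative frechet_derivative \<Phi> (at x)) (at x)" (is "(_ has_derivative ?D) _")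
    using UV unfolding smooth_on_def by (blast intro: Ck_on_1_has_derivative)
  have xV: "\<Phi> x \<in> V \<inter> L" using UV(3,8) x by blast
  have Psi: "(\<Psi> has_derivative frechet_derivative \<Psi> (at (\<Phi> x))) (at (\<Phi> x))"
      (is "(_ has_derivative ?E) _")
    using UV xV unfolding smooth_on_def by (blast intro: Ck_on_1_has_derivative)
  have inv: "\<Psi> (\<Phi> y) = y" if "y \<in> U" for y
    using UV(4) that by (simp add: homeomorphism_def)
  \<comment> \<open>The derivative of the inverse chart undoes that of the chart, which makes the
    velocity of the curve built below equal to \<open>v\<close>.\<close>
  have ED: "?E (?D v) = v" for v
  proof -
    have "((\<lambda>y. \<Psi> (\<Phi> y)) has_derivative (\<lambda>v. ?E (?D v))) (at x)"
      by (rule has_derivative_compose[OF Phi Psi])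
    moreover have "((\<lambda>y. \<Psi> (\<Phi> y)) has_derivative (\<lambda>v. v)) (at x)"
      by (rule has_derivative_transform_within_open[OF has_derivative_ident UV(1,3)])
        (simp add: inv)
    ultimately show ?thesis by (metis has_derivative_unique)
  qed
  have right: "?D v \<in> L"
    if "(\<gamma> has_vector_derivative v) (at 0 within {0..})" "\<gamma> 0 = x" "\<forall>\<^sub>F t in at_right 0. \<gamma> t \<in> M"
    for \<gamma> v
  proof (rule subspace_right_derivative[OF UV(7)])
    show "((\<lambda>t. \<Phi> (\<gamma> t)) has_vector_derivative ?D v) (at 0 within {0..})"
      by (rule vector_derivative_compose[OF that(1)]) (simp add: that(2) Phi)
    show "\<Phi> (\<gamma> 0) \<in> L" using xV that by simp
    have "\<forall>\<^sub>F t in at_right 0. \<gamma> t \<in> U"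
      using eventually_curve_in_open[OF that(1) UV(1)] UV(3) that(2) by (simp add: at_within_Ici)
    then show "\<forall>\<^sub>F t in at_right 0. \<Phi> (\<gamma> t) \<in> L"
      using that(3) by eventually_elim (use UV(8) in blast)
  qed
  have T: "tangent_space M x = {v. ?D v \<in> L}"
  proof (intro equalityI subsetI CollectI)
    fix v assume "v \<in> tangent_space M x"
    then obtain \<gamma> e where g: "e > 0" "\<gamma> ` {-e<..<e} \<subseteq> M" "\<gamma> 0 = x"
      "(\<gamma> has_vector_derivative v) (at 0)"
      unfolding tangent_space_def curve_at_def by blast
    have "\<forall>\<^sub>F t in at_right 0. \<gamma> t \<in> M"
      using eventually_at_right_less[of 0] eventually_at_right_real[OF g(1)]
      by eventually_elim (use g(2) in auto)
    then show "?D v \<in> L"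
      by (rule right[OF has_vector_derivative_at_within[OF g(4)] g(3)])
  next
    fix v assume "v \<in> {v. ?D v \<in> L}"
    then have v: "?D v \<in> L" by simp
    \<comment> \<open>A straight line in the flat chart, pulled back: it stays in \<open>L\<close>
      because both \<open>\<Phi> x\<close> and \<open>?D v\<close> lie there.\<close>
    define \<gamma> where "\<gamma> s = \<Psi> (\<Phi> x + s *\<^sub>R ?D v)" for s :: real
    have "open ((\<lambda>s. \<Phi> x + s *\<^sub>R ?D v) -` V)"
      by (rule open_vimage[OF UV(2)]) (intro continuous_intros)
    moreover have "(0::real) \<in> (\<lambda>s. \<Phi> x + s *\<^sub>R ?D v) -` V" using xV by simp
    ultimately obtain e where e: "e > 0" "ball 0 e \<subseteq> (\<lambda>s. \<Phi> x + s *\<^sub>R ?D v) -` V"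
      by (meson open_contains_ball)
    have inV: "\<Phi> x + s *\<^sub>R ?D v \<in> V" if "s \<in> {-e<..<e}" for s
      using e(2) that by (force simp: dist_real_def)
    have "curve_at M x v \<gamma>"
      unfolding curve_at_def
    proof (intro conjI exI[of _ e])
      show "smooth_on {-e<..<e} \<gamma>"
        unfolding smooth_on_def \<gamma>_def
        using UV(6) inV by (auto simp: smooth_on_def intro!: Ck_on_affine_line[of _ V])
      show "\<gamma> ` {-e<..<e} \<subseteq> M"
      proof
        fix y assume "y \<in> \<gamma> ` {-e<..<e}"
        then obtain s where s: "s \<in> {-e<..<e}" "y = \<gamma> s" by blast
        have "\<Phi> x + s *\<^sub>R ?D v \<in> V \<inter> L"
          using inV[OF s(1)] xV v by (auto intro: subspace_add subspace_scale UV(7))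
        then obtain z where "z \<in> U \<inter> M" "\<Phi> x + s *\<^sub>R ?D v = \<Phi> z" using UV(8) by blast
        then show "y \<in> M" using s inv by (simp add: \<gamma>_def)
      qed
      show "\<gamma> 0 = x" using inv UV(3) by (simp add: \<gamma>_def)
      have "((\<lambda>s. \<Phi> x + s *\<^sub>R ?D v) has_vector_derivative ?D v) (at 0)"
        by (auto intro!: derivative_eq_intros simp: has_vector_derivative_def)
      from vector_derivative_compose[OF this, of \<Psi> ?E]
      show "(\<gamma> has_vector_derivative v) (at 0)"
        unfolding \<gamma>_def using Psi by (simp add: ED)
    qed (fact e)
    then show "v \<in> tangent_space M x" unfolding tangent_space_def by blast
  qed
  have "linear ?D" using Phi by (rule has_derivative_linear)
  then show ?A
    unfolding T using UV(7) by (simp add: subspace_def linear_add linear_scale linear_0)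
  show "v \<in> tangent_space M x" if "(\<gamma> has_vector_derivative v) (at 0 within {0..})" "\<gamma> 0 = x"
    "\<And>t. t \<ge> 0 \<Longrightarrow> \<gamma> t \<in> M"
  proof -
    have "\<forall>\<^sub>F t in at_right (0::real). \<gamma> t \<in> M"
      using eventually_at_right_less by (rule eventually_mono) (auto intro: that(3))
    then show ?thesis unfolding T using right[OF that(1,2)] by simp
  qed
qed

text \<open>Along every admissible curve the chain rule for the local extension gives the same
  value. The definite description is then determined because \<open>v\<close> is tangent, so at
  least one such curve exists.\<close>

lemma mdiff_eq:
  assumes F: "(F has_derivative D) (at x)" and U: "open U" "x \<in> U" "\<And>y. y \<in> U \<inter> M \<Longrightarrow> F y = f y"
    and v: "v \<in> tangent_space M x"
  shows "mdiff M f x v = D v"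
proof -
  have *: "((\<lambda>t. f (\<gamma> t)) has_vector_derivative D v) (at 0)" if c: "curve_at M x v \<gamma>" for \<gamma>
  proof -
    obtain e where e: "e > 0" "\<gamma> ` {-e<..<e} \<subseteq> M" "\<gamma> 0 = x" "(\<gamma> has_vector_derivative v) (at 0)"
      using c unfolding curve_at_def by blast
    have "((\<lambda>t. F (\<gamma> t)) has_vector_derivative D v) (at 0)"
      by (rule vector_derivative_compose[OF e(4)]) (simp add: e(3) F)
    moreover have "\<forall>\<^sub>F t in nhds 0. F (\<gamma> t) = f (\<gamma> t)"
    proof -
      have "isCont \<gamma> 0" using e(4) has_vector_derivative_continuous by blast
      then have "\<forall>\<^sub>F t in nhds 0. \<gamma> t \<in> U"
        using U(1,2) e(3) unfolding isCont_def tendsto_at_iff_tendsto_nhds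
        by (metis topological_tendstoD)
      moreover have "\<forall>\<^sub>F t in nhds 0. t \<in> {-e<..<e}"
        using e(1) by (intro eventually_nhds_in_open) auto
      ultimately show ?thesis
        by eventually_elim (use U(3) e(2) in blast)
    qed
    ultimately show ?thesis
      using has_vector_derivative_cong_ev[of UNIV "\<lambda>t. F (\<gamma> t)" "\<lambda>t. f (\<gamma> t)" 0 "D v"]
        eventually_nhds_x_imp_x[of "\<lambda>t. F (\<gamma> t) = f (\<gamma> t)" 0] by simp
  qed
  obtain \<gamma>0 where "curve_at M x v \<gamma>0" using v unfolding tangent_space_def by blast
  then show ?thesis
    unfolding mdiff_def using * by (intro the_equality) (auto intro: vector_derivative_unique_at)
qed

text \<open>The gradient on \<open>M\<close> is the tangential part of the ambient gradient of a
  local extension. The velocity is tangent, so pairing it with either vector gives the derivative of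
  the extension along the curve.\<close>

lemma inner_mgrad_right_derivative:
  fixes M :: "'a::euclidean_space set" and f :: "'a \<Rightarrow> real"
  assumes M: "smooth_submanifold M" and x: "x \<in> M" and f: "C1_on M f"
    and \<gamma>: "(\<gamma> has_vector_derivative v) (at 0 within {0..})" "\<gamma> 0 = x" "\<And>t. t \<ge> 0 \<Longrightarrow> \<gamma> t \<in> M"
  shows "((\<lambda>t. f (\<gamma> t)) has_vector_derivative v \<bullet> mgrad M f x) (at 0 within {0..})"
proof -
  let ?T = "tangent_space M x"
  obtain U F where U: "open U" "x \<in> U" "Ck_on 1 U F" "\<And>x. x \<in> U \<inter> M \<Longrightarrow> F x = f x"
    using C1_onE[OF f x] by metis
  define D where "D = frechet_derivative F (at x)"
  have FD: "(F has_derivative D) (at x)"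
    unfolding D_def by (rule Ck_on_1_has_derivative[OF U(3,2)])
  have lin: "linear D" using FD by (rule has_derivative_linear)
  have sub: "subspace ?T" by (rule submanifold_tangent_space(1)[OF M x])
  \<comment> \<open>The ambient gradient of the extension at \<open>x\<close>; its tangential part
    \<open>g\<close> is taken below.\<close>
  define g0 where "g0 = (\<Sum>i\<in>Basis. D i *\<^sub>R i)"
  have g0: "g0 \<bullet> w = D w" for w
    by (simp add: linear_eq_sum_Basis[OF lin, of w] g0_def inner_sum_left inner_commute[of w] mult.commute)
  obtain g z where gz: "g \<in> span ?T" "\<And>w. w \<in> span ?T \<Longrightarrow> orthogonal z w" "g0 = g + z"
    using orthogonal_subspace_decomp_exists by metis
  have span: "span ?T = ?T" using sub by (rule span_eq_iff[THEN iffD2])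
  have g: "g \<in> ?T \<and> (\<forall>w\<in>?T. g \<bullet> w = mdiff M f x w)"
  proof (intro conjI ballI)
    fix w assume w: "w \<in> ?T"
    have "g \<bullet> w = g0 \<bullet> w"
      using gz(2)[of w] w span gz(3) by (simp add: orthogonal_def inner_add_left)
    then show "g \<bullet> w = mdiff M f x w"
      using mdiff_eq[OF FD U(1,2,4) w] g0 by simp
  qed (use gz span in simp)
  have "mgrad M f x = g"
    unfolding mgrad_def
  proof (rule the_equality)
    show "g \<in> ?T \<and> (\<forall>w\<in>?T. g \<bullet> w = mdiff M f x w)" by (fact g)
  next
    \<comment> \<open>Uniqueness: the difference of two candidates is tangent and orthogonal to
      every tangent vector, in particular to itself.\<close>
    fix h assume h: "h \<in> ?T \<and> (\<forall>w\<in>?T. h \<bullet> w = mdiff M f x w)"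
    then have "h - g \<in> ?T" using g sub by (auto intro: subspace_diff)
    then have "(h - g) \<bullet> (h - g) = 0" using h g by (simp add: inner_diff_left)
    then show "h = g" by simp
  qed
  moreover have vT: "v \<in> ?T" using submanifold_tangent_space(2)[OF M x \<gamma>] .
  ultimately have *: "v \<bullet> mgrad M f x = D v"
    using g mdiff_eq[OF FD U(1,2,4) vT] by (simp add: inner_commute[of v])
  have "((\<lambda>t. F (\<gamma> t)) has_vector_derivative D v) (at 0 within {0..})"
    by (rule vector_derivative_compose[OF \<gamma>(1)]) (simp add: \<gamma>(2) FD)
  moreover have "\<forall>\<^sub>F t in nhds 0. t \<in> {0..} \<longrightarrow> F (\<gamma> t) = f (\<gamma> t)"
  proof -
    have "\<forall>\<^sub>F t in at 0 within {0..}. \<gamma> t \<in> U"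
      using eventually_curve_in_open[OF \<gamma>(1) U(1)] U(2) \<gamma>(2) by simp
    then show ?thesis
      unfolding eventually_at_filter
      by eventually_elim (use U(2,4) \<gamma>(2,3) in force)
  qed
  ultimately show ?thesis
    unfolding * using has_vector_derivative_cong_ev[of "{0..}" "\<lambda>t. F (\<gamma> t)" "\<lambda>t. f (\<gamma> t)" 0 "D v"]
      U(2,4) x \<gamma>(2) by auto
qed

section \<open>C1 flows and compactly supported test functions\<close>

text \<open>Squaring removes the kink of the positive part at 0, which turns it into a C1
  truncation.\<close>

lemma has_real_derivative_max0_square:
  "((\<lambda>u. (max 0 u)\<^sup>2) has_real_derivative 2 * max 0 u) (at u)"
proof (cases "u = 0")
  case True
  have "((\<lambda>h. ((max 0 h)\<^sup>2 - (max 0 0)\<^sup>2) / h) \<longlongrightarrow> 0) (at (0::real))"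
  proof (rule Lim_transform_bound)
    show "\<forall>\<^sub>F h in at 0. norm (((max 0 h)\<^sup>2 - (max 0 0)\<^sup>2) / h) \<le> norm (h::real)"
      by (rule always_eventually) (auto simp: max_def power2_eq_square)
  qed (rule tendsto_ident_at)
  then show ?thesis using True by (simp add: DERIV_def)
next
  case False
  then consider "u > 0" | "u < 0" by linarith
  then show ?thesis
  proof cases
    case 1
    have "((\<lambda>u. u\<^sup>2) has_real_derivative 2 * max 0 u) (at u)"
      using 1 by (auto intro!: derivative_eq_intros)
    then show ?thesis
      by (rule has_field_derivative_transform_within_open[of _ _ _ "{0<..}"]) (use 1 in auto)
  next
    case 2
    have "((\<lambda>u. 0) has_real_derivative 2 * max 0 u) (at u)"
      using 2 by (auto intro!: derivative_eq_intros)
    then show ?thesis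
      by (rule has_field_derivative_transform_within_open[of _ _ _ "{..<0}"]) (use 2 in auto)
  qed
qed

text \<open>The witness is the squared positive part of
  \<open>r\<^sup>2 - (x - c) \<bullet> (x - c)\<close>. Closedness of \<open>M\<close> makes its
  trace on the closed ball compact. Prescribing the exact set where the function is nonzero lets
  balls be reached by C1 test functions.\<close>

lemma C1c_on_ball:
  fixes M :: "'a::euclidean_space set"
  assumes "closed M" "r > 0"
  obtains g where "C1c_on M g" "\<And>x. g x \<noteq> 0 \<longleftrightarrow> x \<in> ball c r"
proof
  let ?g = "\<lambda>x. (max 0 (r\<^sup>2 - (x - c) \<bullet> (x - c)))\<^sup>2"
  have 1: "Ck_on 1 UNIV (\<lambda>x. r\<^sup>2 - (x - c) \<bullet> (x - c))"
  proof (rule Ck_on_1I)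
    show "((\<lambda>x. r\<^sup>2 - (x - c) \<bullet> (x - c)) has_derivative (\<lambda>v. - (2 * ((x - c) \<bullet> v)))) (at x)" for x
      by (auto intro!: derivative_eq_intros simp: inner_commute)
  qed (intro continuous_intros)
  have 2: "Ck_on 1 UNIV (\<lambda>u::real. (max 0 u)\<^sup>2)"
    by (rule Ck_on_1_real[OF has_real_derivative_max0_square]) (intro continuous_intros)
  have *: "?g x \<noteq> 0 \<longleftrightarrow> x \<in> ball c r" for x
  proof -
    have "?g x \<noteq> 0 \<longleftrightarrow> (norm (x - c))\<^sup>2 < r\<^sup>2"
      by (auto simp: power2_norm_eq_inner max_def)
    also have "\<dots> \<longleftrightarrow> norm (x - c) < r"
      using assms(2) by (smt (verit) norm_ge_zero power2_less_imp_less power_strict_mono zero_less_numeral)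
    finally show ?thesis by (simp add: dist_norm norm_minus_commute)
  qed
  show "C1c_on M ?g"
    unfolding C1c_on_def
  proof (intro conjI exI[of _ "cball c r \<inter> M"] ballI)
    show "C1_on M ?g" using Ck_on_1_compose[OF 1 2] by (intro C1_on_Ck_on) auto
    show "compact (cball c r \<inter> M)" using assms(1) by (simp add: compact_Int_closed)
    show "?g x = 0" if "x \<in> M - cball c r \<inter> M" for x
      using *[of x] that by auto
  qed simp
  show "?g x \<noteq> 0 \<longleftrightarrow> x \<in> ball c r" for x by (rule *)
qed

lemma C1c_on_mult:
  assumes "C1c_on M f" "C1c_on M g"
  shows "C1c_on M (\<lambda>x. f x * g x)"
proof -
  obtain K where "compact K" "K \<subseteq> M" "\<And>x. x \<in> M - K \<Longrightarrow> f x = 0"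
    using assms(1) unfolding C1c_on_def by blast
  then show ?thesis
    using assms C1_on_mult[of M f g] unfolding C1c_on_def by (auto intro!: exI[of _ K])
qed

text \<open>As \<open>n\<close> grows these functions increase to the indicator of \<open>{x. g x \<noteq> 0}\<close>.\<close>

lemma C1c_on_saturate:
  assumes g: "C1c_on M g"
  shows "C1c_on M (\<lambda>x. real n * (g x)\<^sup>2 / (1 + real n * (g x)\<^sup>2))"
proof -
  have pos: "1 + real n * u\<^sup>2 > 0" for u by (smt (verit) mult_nonneg_nonneg of_nat_0_le_iff zero_le_power2)
  have "Ck_on 1 UNIV (\<lambda>u. real n * u\<^sup>2 / (1 + real n * u\<^sup>2))"
  proof (rule Ck_on_1_real)
    show "((\<lambda>u. real n * u\<^sup>2 / (1 + real n * u\<^sup>2)) has_real_derivative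
       (real n * (2 * u) * (1 + real n * u\<^sup>2) - real n * u\<^sup>2 * (real n * (2 * u))) /
       ((1 + real n * u\<^sup>2) * (1 + real n * u\<^sup>2))) (at u)" for u
      using pos[of u] by (auto intro!: derivative_eq_intros)
    show "continuous_on UNIV (\<lambda>u. (real n * (2 * u) * (1 + real n * u\<^sup>2) -
        real n * u\<^sup>2 * (real n * (2 * u))) / ((1 + real n * u\<^sup>2) * (1 + real n * u\<^sup>2)))"
      using pos by (intro continuous_intros) (metis less_irrefl mult_eq_0_iff)
  qed
  then have "C1_on UNIV (\<lambda>u. real n * u\<^sup>2 / (1 + real n * u\<^sup>2))" by (rule C1_on_Ck_on)
  from C1_on_compose[OF _ this, of M g]
  have "C1_on M (\<lambda>x. real n * (g x)\<^sup>2 / (1 + real n * (g x)\<^sup>2))"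
    using g by (simp add: C1c_on_def)
  moreover obtain K where "compact K" "K \<subseteq> M" "\<And>x. x \<in> M - K \<Longrightarrow> g x = 0"
    using g unfolding C1c_on_def by blast
  ultimately show ?thesis unfolding C1c_on_def by (auto intro!: exI[of _ K])
qed

lemma C1_on_has_vector_derivative:
  fixes h :: "real \<Rightarrow> 'b::euclidean_space"
  assumes "C1_on S h" "s \<in> S"
  shows "\<exists>d. (h has_vector_derivative d) (at s within S)"
proof -
  obtain U F where U: "open U" "s \<in> U" "Ck_on 1 U F" "\<And>x. x \<in> U \<inter> S \<Longrightarrow> F x = h x"
    using C1_onE[OF assms] by metis
  have "F differentiable (at s)" using U by simp
  then have "(F has_vector_derivative vector_derivative F (at s)) (at s within S)"
    using vector_derivative_works has_vector_derivative_at_within by blast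
  moreover have "\<forall>\<^sub>F x in nhds s. x \<in> S \<longrightarrow> F x = h x"
    using eventually_nhds_in_open[OF U(1,2)] by eventually_elim (use U(4) in blast)
  ultimately show ?thesis
    using has_vector_derivative_cong_ev[of S F h s] U(2,4) assms(2) by blast
qed

section \<open>Differentiation along the flow\<close>

locale C1_flow =
  fixes M :: "'a::euclidean_space set" and \<phi> :: "real \<Rightarrow> 'a \<Rightarrow> 'a"
  assumes submanifold: "smooth_submanifold M" and closed_M: "closed M"
    and flow: "differential_flow M \<phi>"
    and C1_flow: "C1_on ({0..} \<times> M) (\<lambda>(t, x). \<phi> t x)"
begin

lemma flow_in: "0 \<le> t \<Longrightarrow> x \<in> M \<Longrightarrow> \<phi> t x \<in> M"
  using flow unfolding differential_flow_def C1_diffeo_def bij_betw_def by blast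

lemma flow_0: "x \<in> M \<Longrightarrow> \<phi> 0 x = x"
  using flow unfolding differential_flow_def by blast

lemma flow_add: "0 \<le> s \<Longrightarrow> 0 \<le> t \<Longrightarrow> x \<in> M \<Longrightarrow> \<phi> (t + s) x = \<phi> s (\<phi> t x)"
  using flow unfolding differential_flow_def by blast

lemma C1_on_orbit: "x \<in> M \<Longrightarrow> C1_on {0..} (\<lambda>t. \<phi> t x)"
  using flow unfolding differential_flow_def by blast

lemma C1_on_flow: "0 \<le> t \<Longrightarrow> C1_on M (\<phi> t)"
  using flow unfolding differential_flow_def C1_diffeo_def by blast

lemma C1_on_along_orbit: "C1_on M g \<Longrightarrow> x \<in> M \<Longrightarrow> C1_on {0..} (\<lambda>t. g (\<phi> t x))"
  by (rule C1_on_compose[OF C1_on_orbit]) (auto intro: flow_in)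

text \<open>The Lie derivative along the vector field of the flow, encoded as a one-sided time
  derivative. Gradients on \<open>M\<close> appear only in \<open>inner_mgrad_flow\<close>, which
  identifies it with the drift term of the generator.\<close>

definition lie :: "('a \<Rightarrow> real) \<Rightarrow> 'a \<Rightarrow> real" where
  "lie g y = vector_derivative (\<lambda>r. g (\<phi> r y)) (at 0 within {0..})"

lemma lie_eqI:
  assumes "((\<lambda>r. g (\<phi> r y)) has_vector_derivative d) (at 0 within {0..})"
  shows "lie g y = d"
  unfolding lie_def by (rule vector_derivative_within[OF _ assms]) (simp add: at_within_Ici)

text \<open>Existence of the derivative at \<open>s\<close> comes from the C1 regularity of the
  orbit; its value is transported to time 0 by the flow property.\<close>

lemma lie_flow:
  assumes g: "C1_on M g" and x: "x \<in> M" and s: "0 \<le> s"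
  shows "((\<lambda>r. g (\<phi> r x)) has_vector_derivative lie g (\<phi> s x)) (at s within {0..})"
proof -
  let ?h = "\<lambda>r. g (\<phi> r x)"
  obtain d where d: "(?h has_vector_derivative d) (at s within {0..})"
    using C1_on_has_vector_derivative[OF C1_on_along_orbit[OF g x], of s] s by auto
  \<comment> \<open>The shift by \<open>s\<close> maps the half-line onto \<open>{s..}\<close>;
    restricting to this set prepares the one-sided chain rule.\<close>
  have "(?h has_vector_derivative d) (at (s + 0) within (+) s ` {0..})"
    using has_vector_derivative_within_subset[OF d, of "{s..}"] s by simp
  then have "((?h \<circ> (+) s) has_vector_derivative 1 *\<^sub>R d) (at 0 within {0..})"
    by (rule vector_diff_chain_within[rotated]) (auto intro!: derivative_eq_intros)
  then have "((?h \<circ> (+) s) has_vector_derivative d) (at 0 within {0..})" by simp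
  then have "((\<lambda>r. g (\<phi> r (\<phi> s x))) has_vector_derivative d) (at 0 within {0..})"
    by (rule has_vector_derivative_transform[rotated 2, where f = "?h \<circ> (+) s"])
      (use s x in \<open>auto simp: flow_add\<close>)
  then have "lie g (\<phi> s x) = d" by (rule lie_eqI)
  with d show ?thesis by simp
qed

text \<open>Flow maps commute, so \<open>\<phi> s (\<phi> r x)\<close> is differentiated as
  \<open>\<phi> r (\<phi> s x)\<close>. This converts the generator identity for \<open>g\<close>
  composed with \<open>\<phi> s\<close> into a statement on \<open>lie g\<close> along
  orbits.\<close>

lemma lie_comp_flow:
  assumes g: "C1_on M g" and x: "x \<in> M" and s: "0 \<le> s"
  shows "lie (\<lambda>x. g (\<phi> s x)) x = lie g (\<phi> s x)"
proof (rule lie_eqI)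
  have "((\<lambda>r. g (\<phi> r (\<phi> s x))) has_vector_derivative lie g (\<phi> 0 (\<phi> s x))) (at 0 within {0..})"
    by (rule lie_flow[OF g]) (use s x flow_in in auto)
  then show "((\<lambda>r. g (\<phi> s (\<phi> r x))) has_vector_derivative lie g (\<phi> s x)) (at 0 within {0..})"
    by (rule has_vector_derivative_transform[rotated 2, THEN has_vector_derivative_eq_rhs])
      (use s x in \<open>auto simp: flow_add[symmetric] add.commute flow_0 flow_in\<close>)
qed

text \<open>Near \<open>(0, y)\<close> the map sending \<open>(t, x)\<close> to
  \<open>g (\<phi> t x)\<close> has a C1 extension to an open set of times and ambient points, and
  \<open>lie g\<close> is the derivative of this extension at time 0 in the fixed direction
  \<open>(1, 0)\<close>.\<close>

lemma continuous_on_lie: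
  assumes g: "C1_on M g"
  shows "continuous_on M (lie g)"
proof (clarsimp simp: continuous_on_eq_continuous_within)
  fix y assume y: "y \<in> M"
  have "C1_on ({0..} \<times> M) (\<lambda>p. g (case p of (t, x) \<Rightarrow> \<phi> t x))"
    by (rule C1_on_compose[OF C1_flow g]) (auto intro: flow_in)
  then obtain W E where W: "open W" "(0, y) \<in> W" "Ck_on 1 W E"
      "\<And>p. p \<in> W \<inter> {0..} \<times> M \<Longrightarrow> E p = g (case p of (t, x) \<Rightarrow> \<phi> t x)"
    using y by (auto elim: C1_onE[where p = "(0, y)"])
  let ?d = "\<lambda>z. frechet_derivative E (at (0, z)) (1, 0)"
  let ?V = "Pair 0 -` W"
  have V: "open ?V" "y \<in> ?V"
    using W(1,2) by (auto intro!: open_vimage continuous_intros)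
  have "continuous_on ?V ?d"
    by (rule continuous_on_compose2[OF Ck_on_1_continuous_derivative[OF W(3)]])
      (auto intro!: continuous_intros)
  then have "isCont ?d y" using V continuous_on_eq_continuous_at by blast
  moreover have lie: "lie g z = ?d z" if "z \<in> ?V" "z \<in> M" for z
  proof (rule lie_eqI)
    have pair: "((\<lambda>r. (r, z)) has_vector_derivative (1, 0)) (at 0 within {0..})"
      by (intro derivative_intros)
    have "((\<lambda>r. E (r, z)) has_vector_derivative ?d z) (at 0 within {0..})"
      by (rule vector_derivative_compose[OF pair]) (use Ck_on_1_has_derivative[OF W(3)] that in auto)
    moreover have "\<forall>\<^sub>F r in nhds 0. r \<in> {0..} \<longrightarrow> E (r, z) = g (\<phi> r z)"
    proof -
      have "\<forall>\<^sub>F r in nhds 0. r \<in> (\<lambda>r. (r, z)) -` W"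
        using that W(1) by (intro eventually_nhds_in_open open_vimage continuous_intros) auto
      then show ?thesis by eventually_elim (use W(4) that in auto)
    qed
    ultimately show "((\<lambda>r. g (\<phi> r z)) has_vector_derivative ?d z) (at 0 within {0..})"
      using has_vector_derivative_cong_ev[of "{0..}" "\<lambda>r. E (r, z)" "\<lambda>r. g (\<phi> r z)" 0]
        W(4)[of "(0, z)"] that by auto
  qed
  moreover have "\<forall>\<^sub>F z in at y within M. ?d z = lie g z"
    unfolding eventually_at_topological using V lie by (intro exI[of _ ?V]) auto
  ultimately show "continuous (at y within M) (lie g)"
    using lie[OF V(2) y] Lim_transform_eventually[of ?d "?d y" "at y within M" "lie g"]
      continuous_at_imp_continuous_within[of y ?d M]
    unfolding continuous_within by simp
qed

text \<open>Continuity bounds \<open>lie g\<close> on the compact set \<open>K\<close>. Off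
  \<open>K\<close>, which is closed, an orbit stays outside \<open>K\<close> for a short time, so
  \<open>g\<close> vanishes along it and the derivative is 0.\<close>

lemma lie_bounded:
  assumes g: "C1c_on M g"
  obtains C where "\<And>y. y \<in> M \<Longrightarrow> \<bar>lie g y\<bar> \<le> C"
proof -
  obtain K where K: "compact K" "K \<subseteq> M" "\<And>x. x \<in> M - K \<Longrightarrow> g x = 0" and g1: "C1_on M g"
    using g unfolding C1c_on_def by blast
  have "compact (lie g ` K)"
    using continuous_on_subset[OF continuous_on_lie[OF g1] K(2)] K(1)
    by (rule compact_continuous_image)
  then obtain C where C: "\<And>y. y \<in> K \<Longrightarrow> \<bar>lie g y\<bar> \<le> C"
    using compact_imp_bounded bounded_iff by (metis image_eqI real_norm_def)
  have zero: "lie g y = 0" if y: "y \<in> M - K" for y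
  proof (rule lie_eqI)
    obtain d where d: "((\<lambda>r. \<phi> r y) has_vector_derivative d) (at 0 within {0..})"
      using C1_on_has_vector_derivative[OF C1_on_orbit, of y 0] y by auto
    have "\<forall>\<^sub>F r in at 0 within {0..}. \<phi> r y \<in> - K"
      using y K(1) flow_0 by (intro eventually_curve_in_open[OF d]) (auto simp: compact_imp_closed)
    then have "\<forall>\<^sub>F r in nhds 0. r \<in> {0..} \<longrightarrow> 0 = g (\<phi> r y)"
      unfolding eventually_at_filter
      by eventually_elim (use K(3) y flow_in flow_0 in force)
    then show "((\<lambda>r. g (\<phi> r y)) has_vector_derivative 0) (at 0 within {0..})"
      using has_vector_derivative_cong_ev[of "{0..}" "\<lambda>r. 0" "\<lambda>r. g (\<phi> r y)" 0 0] K(3)[OF y] y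
      by (simp add: flow_0)
  qed
  show ?thesis
    by (rule that[of "max C 0"]) (use C zero in \<open>force simp: max_def\<close>)
qed

text \<open>The inverse of the diffeomorphism carries the compact set \<open>K\<close> to a compact
  set outside which the composite vanishes.\<close>

lemma C1c_on_flow:
  assumes g: "C1c_on M g" and t: "0 \<le> t"
  shows "C1c_on M (\<lambda>x. g (\<phi> t x))"
proof -
  obtain K where K: "compact K" "K \<subseteq> M" "\<And>x. x \<in> M - K \<Longrightarrow> g x = 0" and g1: "C1_on M g"
    using g unfolding C1c_on_def by blast
  have bij: "bij_betw (\<phi> t) M M" and inv: "C1_on M (inv_into M (\<phi> t))"
    using flow t unfolding differential_flow_def C1_diffeo_def by auto
  let ?K = "inv_into M (\<phi> t) ` K"
  show ?thesis
    unfolding C1c_on_def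
  proof (intro conjI exI[of _ ?K] ballI)
    show "C1_on M (\<lambda>x. g (\<phi> t x))"
      by (rule C1_on_compose[OF C1_on_flow[OF t] g1]) (use t flow_in in auto)
    show "compact ?K"
      using continuous_on_subset[OF C1_on_continuous_on[OF inv] K(2)] K(1)
      by (rule compact_continuous_image)
    show "?K \<subseteq> M"
      using bij K(2) by (metis bij_betw_def image_mono bij_betw_inv_into)
    show "g (\<phi> t x) = 0" if x: "x \<in> M - ?K" for x
    proof (rule K(3))
      have "\<phi> t x \<notin> K"
        using x bij by (metis Diff_iff bij_betw_inv_into_left image_eqI)
      then show "\<phi> t x \<in> M - K" using flow_in[OF t] x by blast
    qed
  qed
qed

lemma inner_mgrad_flow:
  assumes "C1_on M f" "x \<in> M"
  shows "vector_derivative (\<lambda>t. \<phi> t x) (at 0 within {0..}) \<bullet> mgrad M f x = lie f x"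
proof -
  obtain d where d: "((\<lambda>r. \<phi> r x) has_vector_derivative d) (at 0 within {0..})"
    using C1_on_has_vector_derivative[OF C1_on_orbit, of x 0] assms by auto
  then have "vector_derivative (\<lambda>t. \<phi> t x) (at 0 within {0..}) = d"
    by (intro vector_derivative_within) (auto simp: at_within_Ici)
  moreover have "lie f x = d \<bullet> mgrad M f x"
    by (intro lie_eqI inner_mgrad_right_derivative[OF submanifold assms(2,1) d])
      (use assms flow_0 flow_in in auto)
  ultimately show ?thesis by simp
qed

lemma lie_FTC:
  assumes g: "C1_on M g" and x: "x \<in> M" and t: "0 \<le> t"
  shows "(LBINT s:{0..t}. lie g (\<phi> s x)) = g (\<phi> t x) - g x"
proof -
  have "(LBINT s:{0..t}. lie g (\<phi> s x)) = g (\<phi> t x) - g (\<phi> 0 x)"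
    unfolding set_lebesgue_integral_def
  proof (rule integral_FTC_atLeastAtMost[OF t])
    show "((\<lambda>r. g (\<phi> r x)) has_vector_derivative lie g (\<phi> s x)) (at s within {0..t})"
      if "0 \<le> s" "s \<le> t" for s
      using has_vector_derivative_within_subset[OF lie_flow[OF g x that(1)], of "{0..t}"] by auto
    show "continuous_on {0..t} (\<lambda>s. lie g (\<phi> s x))"
      by (rule continuous_on_compose2[OF continuous_on_lie[OF g]
            continuous_on_subset[OF C1_on_continuous_on[OF C1_on_orbit[OF x]]]])
        (use x flow_in in auto)
  qed
  then show ?thesis using x by (simp add: flow_0)
qed

end

section \<open>Primitives of bounded measurable rates\<close>

lemma set_integrable_bounded_Icc:
  fixes f :: "real \<Rightarrow> real"
  assumes "f \<in> borel_measurable borel" "\<And>s. s \<in> {a..b} \<Longrightarrow> \<bar>f s\<bar> \<le> B"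
  shows "set_integrable lborel {a..b} f"
  unfolding set_integrable_def
  by (rule integrableI_bounded_set_indicator[where B = B])
    (use assms in \<open>auto simp: emeasure_lborel_Icc_eq\<close>)

lemma exp_diff_le:
  fixes u v m :: real
  assumes "u \<le> m" "v \<le> m"
  shows "\<bar>exp u - exp v\<bar> \<le> exp m * \<bar>u - v\<bar>"
proof -
  have *: "exp u - exp v \<le> exp m * (u - v)" if "v \<le> u" "u \<le> m" for u v :: real
  proof -
    have "1 - exp (v - u) \<le> u - v" using exp_ge_add_one_self[of "v - u"] by linarith
    then have "exp u * (1 - exp (v - u)) \<le> exp u * (u - v)" by (intro mult_left_mono) auto
    also have "\<dots> \<le> exp m * (u - v)" using that by (intro mult_right_mono) auto
    finally show ?thesis by (simp add: right_diff_distrib flip: exp_add)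
  qed
  show ?thesis
    using *[of v u] *[of u v] assms by (cases "v \<le> u") (auto simp: abs_if)
qed

text \<open>Convexity gives \<open>exp v * (u - v) \<le> exp u - exp v\<close> and
  \<open>exp u - exp v \<le> exp u * (u - v)\<close>; the gap between the two bounds is
  \<open>(exp u - exp v) * (u - v)\<close>, which is already of second order.\<close>

lemma exp_diff_linear_le:
  fixes u v m :: real
  assumes "u \<le> m" "v \<le> m"
  shows "\<bar>exp u - exp v - exp v * (u - v)\<bar> \<le> exp m * (u - v)\<^sup>2"
proof -
  have 1: "exp v * (u - v) \<le> exp u - exp v"
    using mult_left_mono[OF exp_ge_add_one_self[of "u - v"], of "exp v"]
    by (simp add: algebra_simps flip: exp_add)
  have 2: "exp u - exp v \<le> exp u * (u - v)"
    using mult_left_mono[OF exp_ge_add_one_self[of "v - u"], of "exp u"]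
    by (simp add: algebra_simps flip: exp_add)
  have "\<bar>exp u - exp v - exp v * (u - v)\<bar> \<le> (exp u - exp v) * (u - v)"
    using 1 2 by (simp add: algebra_simps)
  also have "\<dots> \<le> \<bar>exp u - exp v\<bar> * \<bar>u - v\<bar>"
    by (metis abs_ge_self abs_mult)
  also have "\<dots> \<le> exp m * \<bar>u - v\<bar> * \<bar>u - v\<bar>"
    by (intro mult_right_mono exp_diff_le assms) auto
  finally show ?thesis by (simp add: power2_eq_square)
qed

text \<open>Such increments force a zero derivative everywhere. The criterion applies to a
  difference whose two terms may each fail to be differentiable at individual points, as happens
  with primitives of merely measurable functions.\<close>

lemma constant_if_quadratic_increments:
  fixes D :: "real \<Rightarrow> real"
  assumes "0 \<le> t" and D: "\<And>a b. 0 \<le> a \<Longrightarrow> a \<le> b \<Longrightarrow> b \<le> t \<Longrightarrow> \<bar>D b - D a\<bar> \<le> K * (b - a)\<^sup>2"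
  shows "D t = D 0"
proof -
  have D': "\<bar>D y - D x\<bar> \<le> \<bar>K\<bar> * (y - x)\<^sup>2" if "x \<in> {0..t}" "y \<in> {0..t}" for x y
  proof -
    have "K * (y - x)\<^sup>2 \<le> \<bar>K\<bar> * (y - x)\<^sup>2" by (intro mult_right_mono) auto
    moreover have "\<bar>D y - D x\<bar> \<le> K * (y - x)\<^sup>2"
    proof (cases "x \<le> y")
      case True
      then show ?thesis using D[of x y] that by auto
    next
      case False
      then have "\<bar>D x - D y\<bar> \<le> K * (x - y)\<^sup>2" using that by (intro D) auto
      then show ?thesis by (simp add: power2_commute abs_minus_commute)
    qed
    ultimately show ?thesis by linarith
  qed
  have "(D has_derivative (\<lambda>h. 0)) (at x within {0..t})" if x: "x \<in> {0..t}" for x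
    unfolding has_derivative_within
  proof (intro conjI)
    show "((\<lambda>y. (1 / norm (y - x)) *\<^sub>R (D y - (D x + 0))) \<longlongrightarrow> 0) (at x within {0..t})"
    proof (rule Lim_null_comparison)
      have "\<forall>\<^sub>F y in at x within {0..t}. y \<in> {0..t} \<and> y \<noteq> x"
        unfolding eventually_at_filter by (rule always_eventually) auto
      then show "\<forall>\<^sub>F y in at x within {0..t}.
          norm ((1 / norm (y - x)) *\<^sub>R (D y - (D x + 0))) \<le> \<bar>K\<bar> * \<bar>y - x\<bar>"
      proof eventually_elim
        case (elim y)
        then have "\<bar>D y - D x\<bar> / \<bar>y - x\<bar> \<le> (\<bar>K\<bar> * (y - x)\<^sup>2) / \<bar>y - x\<bar>"
          using D'[of x y] x by (intro divide_right_mono) auto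
        also have "\<dots> = \<bar>K\<bar> * \<bar>y - x\<bar>"
        proof -
          have *: "(y - x)\<^sup>2 = \<bar>y - x\<bar> * \<bar>y - x\<bar>" by (simp add: power2_eq_square)
          show ?thesis unfolding * using elim by (simp del: abs_mult_self_eq)
        qed
        finally show ?case by (simp add: abs_divide)
      qed
      have "((\<lambda>y. \<bar>K\<bar> * \<bar>y - x\<bar>) \<longlongrightarrow> \<bar>K\<bar> * \<bar>x - x\<bar>) (at x within {0..t})"
        by (intro tendsto_intros)
      then show "((\<lambda>y. \<bar>K\<bar> * \<bar>y - x\<bar>) \<longlongrightarrow> 0) (at x within {0..t})" by simp
    qed
  qed simp
  then have "\<exists>c. \<forall>x\<in>{0..t}. D x = c"
    by (intro has_derivative_zero_constant) auto
  then show ?thesis using assms(1) by auto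
qed

text \<open>The fundamental theorem of calculus for \<open>exp (c * F)\<close>, where \<open>F\<close> is merely the primitive of
  a bounded measurable function.\<close>

lemma integral_exp_primitive:
  fixes f :: "real \<Rightarrow> real"
  assumes f[measurable]: "f \<in> borel_measurable borel" and "0 \<le> t"
    and bound: "\<And>s. s \<in> {0..t} \<Longrightarrow> 0 \<le> f s \<and> f s \<le> B"
    and F: "\<And>r. F r = (LBINT s:{0..r}. f s)"
  shows "(LBINT s:{0..t}. c * f s * exp (c * F s)) = exp (c * F t) - 1"
proof -
  have F_eq: "F = (\<lambda>r. \<integral>s. (if 0 \<le> s \<and> s \<le> r then f s else 0) \<partial>lborel)"
    unfolding F set_lebesgue_integral_def by (intro ext Bochner_Integration.integral_cong) auto
  have F_meas[measurable]: "F \<in> borel_measurable borel"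
    unfolding F_eq by measurable
  have int: "f integrable_on {a..b}" "set_integrable lborel {a..b} f" if "0 \<le> a" "b \<le> t" for a b
  proof -
    show "set_integrable lborel {a..b} f"
      by (rule set_integrable_bounded_Icc[where B = B]) (use bound that in auto)
    then show "f integrable_on {a..b}" by (rule set_borel_integral_eq_integral)
  qed
  have F_HK: "F r = integral {0..r} f" if "r \<le> t" for r
    unfolding F using int[of 0 r] that by (intro set_borel_integral_eq_integral) auto
  have F_diff: "F b - F a = integral {a..b} f" if "0 \<le> a" "a \<le> b" "b \<le> t" for a b
    using Henstock_Kurzweil_Integration.integral_combine[OF that(1,2) int(1)] that
    by (auto simp: F_HK)
  have B0: "0 \<le> B" using bound[of 0] \<open>0 \<le> t\<close> by auto
  have F_lip: "0 \<le> F b - F a \<and> F b - F a \<le> B * (b - a)" if "0 \<le> a" "a \<le> b" "b \<le> t" for a b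
  proof
    show "0 \<le> F b - F a"
      unfolding F_diff[OF that] by (intro integral_nonneg int) (use bound that in auto)
    have "integral {a..b} f \<le> integral {a..b} (\<lambda>_. B)"
      by (intro integral_le int) (use bound that in auto)
    then show "F b - F a \<le> B * (b - a)" unfolding F_diff[OF that] using that by (simp add: mult.commute)
  qed
  have F0: "F 0 = 0" using F_HK[of 0] \<open>0 \<le> t\<close> by simp
  \<comment> \<open>An upper bound of the exponent on \<open>{0..t}\<close> for either sign of
    \<open>c\<close>.\<close>
  define m where "m = \<bar>c\<bar> * F t"
  have m: "c * F s \<le> m" if "s \<in> {0..t}" for s
  proof -
    have "F s \<le> F t" "0 \<le> F s" using F_lip[of s t] F_lip[of 0 s] that F0 by auto
    then have "c * F s \<le> \<bar>c\<bar> * F s" by (intro mult_right_mono) auto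
    also have "\<dots> \<le> m" unfolding m_def using \<open>F s \<le> F t\<close> by (intro mult_left_mono) auto
    finally show ?thesis .
  qed
  let ?h = "\<lambda>s. c * f s * exp (c * F s)"
  have h_bd: "\<bar>?h s\<bar> \<le> \<bar>c\<bar> * B * exp m" if "s \<in> {0..t}" for s
    unfolding abs_mult using bound[OF that] m[OF that] by (intro mult_mono) auto
  have h_int: "?h integrable_on {a..b}" "set_integrable lborel {a..b} ?h" if "0 \<le> a" "b \<le> t" for a b
  proof -
    show "set_integrable lborel {a..b} ?h"
      by (rule set_integrable_bounded_Icc[where B = "\<bar>c\<bar> * B * exp m"]) (use h_bd that in auto)
    then show "?h integrable_on {a..b}" by (rule set_borel_integral_eq_integral)
  qed
  \<comment> \<open>Over \<open>{a..b}\<close> each of the two terms changes by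
    \<open>c * exp (c * F a) * (F b - F a)\<close> up to an error of order
    \<open>(b - a)\<^sup>2\<close>, so the first-order parts cancel in \<open>D\<close>.\<close>
  define D where "D r = exp (c * F r) - integral {0..r} ?h" for r
  have "\<bar>D b - D a\<bar> \<le> (2 * c\<^sup>2 * B\<^sup>2 * exp m) * (b - a)\<^sup>2" if ab: "0 \<le> a" "a \<le> b" "b \<le> t" for a b
  proof -
    let ?\<delta> = "F b - F a"
    have *: "integral {0..b} ?h - integral {0..a} ?h = integral {a..b} ?h"
      using Henstock_Kurzweil_Integration.integral_combine[OF ab(1,2) h_int(1)] ab by auto
    have **: "c * exp (c * F a) * ?\<delta> = integral {a..b} (\<lambda>s. c * exp (c * F a) * f s)"
      unfolding F_diff[OF ab] by simp
    have "integral {a..b} ?h - c * exp (c * F a) * ?\<delta> =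
        integral {a..b} (\<lambda>s. ?h s - c * exp (c * F a) * f s)"
      unfolding ** by (rule integral_diff[symmetric])
        (use h_int(1) int(1) ab in \<open>auto intro!: integrable_on_mult_right\<close>)
    also have "norm \<dots> \<le> (c\<^sup>2 * B\<^sup>2 * exp m * (b - a)) * measure lborel (cbox a b)"
    proof (rule has_integral_bound)
      show "0 \<le> c\<^sup>2 * B\<^sup>2 * exp m * (b - a)" using ab by simp
      show "((\<lambda>s. ?h s - c * exp (c * F a) * f s) has_integral
          integral {a..b} (\<lambda>s. ?h s - c * exp (c * F a) * f s)) (cbox a b)"
        unfolding cbox_interval by (intro integrable_integral integrable_diff)
          (use h_int(1) int(1) ab in \<open>auto intro!: integrable_on_mult_right\<close>)
      fix s assume s: "s \<in> cbox a b"
      then have s': "s \<in> {0..t}" "a \<le> s" using ab by auto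
      have "\<bar>?h s - c * exp (c * F a) * f s\<bar> = \<bar>c\<bar> * f s * \<bar>exp (c * F s) - exp (c * F a)\<bar>"
      proof -
        have "?h s - c * exp (c * F a) * f s = c * f s * (exp (c * F s) - exp (c * F a))"
          by (simp add: algebra_simps)
        then show ?thesis using bound[OF s'(1)] by (simp add: abs_mult)
      qed
      also have "\<dots> \<le> \<bar>c\<bar> * B * (exp m * \<bar>c * F s - c * F a\<bar>)"
        using bound[OF s'(1)] m ab s' by (intro mult_mono exp_diff_le) auto
      also have "\<bar>c * F s - c * F a\<bar> = \<bar>c\<bar> * (F s - F a)"
        using F_lip[of a s] s' ab by (simp flip: right_diff_distrib add: abs_mult)
      also have "\<bar>c\<bar> * B * (exp m * (\<bar>c\<bar> * (F s - F a))) \<le> \<bar>c\<bar> * B * (exp m * (\<bar>c\<bar> * (B * (b - a))))"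
      proof (intro mult_left_mono)
        have "F s - F a \<le> B * (s - a)" using F_lip[of a s] s' ab by auto
        also have "\<dots> \<le> B * (b - a)" using s B0 by (intro mult_left_mono) auto
        finally show "F s - F a \<le> B * (b - a)" .
      qed (use B0 in auto)
      also have "\<dots> = c\<^sup>2 * B\<^sup>2 * exp m * (b - a)"
      proof -
        have "\<bar>c\<bar> * \<bar>c\<bar> = c\<^sup>2" by (simp add: power2_eq_square)
        then show ?thesis by (simp add: power2_eq_square)
      qed
      finally show "norm (?h s - c * exp (c * F a) * f s) \<le> c\<^sup>2 * B\<^sup>2 * exp m * (b - a)" by simp
    qed
    finally have 1: "\<bar>integral {a..b} ?h - c * exp (c * F a) * ?\<delta>\<bar> \<le> c\<^sup>2 * B\<^sup>2 * exp m * (b - a)\<^sup>2"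
      using ab by (simp add: power2_eq_square algebra_simps)
    have "\<bar>exp (c * F b) - exp (c * F a) - exp (c * F a) * (c * F b - c * F a)\<bar>
        \<le> exp m * (c * F b - c * F a)\<^sup>2"
      using m ab by (intro exp_diff_linear_le) auto
    also have "(c * F b - c * F a)\<^sup>2 = c\<^sup>2 * ?\<delta>\<^sup>2" by (simp add: power_mult_distrib flip: right_diff_distrib)
    also have "exp m * (c\<^sup>2 * ?\<delta>\<^sup>2) \<le> exp m * (c\<^sup>2 * (B * (b - a))\<^sup>2)"
      using F_lip[OF ab] by (intro mult_left_mono power_mono) auto
    also have "\<dots> = c\<^sup>2 * B\<^sup>2 * exp m * (b - a)\<^sup>2"
      by (simp only: power_mult_distrib mult_ac)
    also have "exp (c * F a) * (c * F b - c * F a) = c * exp (c * F a) * ?\<delta>"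
      by (simp add: right_diff_distrib)
    finally have 2: "\<bar>exp (c * F b) - exp (c * F a) - c * exp (c * F a) * ?\<delta>\<bar>
        \<le> c\<^sup>2 * B\<^sup>2 * exp m * (b - a)\<^sup>2" .
    have "D b - D a = (exp (c * F b) - exp (c * F a) - c * exp (c * F a) * ?\<delta>)
        - (integral {a..b} ?h - c * exp (c * F a) * ?\<delta>)"
      unfolding D_def using * by simp
    also have "\<bar>\<dots>\<bar> \<le> c\<^sup>2 * B\<^sup>2 * exp m * (b - a)\<^sup>2 + c\<^sup>2 * B\<^sup>2 * exp m * (b - a)\<^sup>2"
      using 1 2 by linarith
    finally show ?thesis by (simp add: mult_ac)
  qed
  from constant_if_quadratic_increments[OF \<open>0 \<le> t\<close> this]
  have "D t = D 0" by simp
  then have "integral {0..t} ?h = exp (c * F t) - 1"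
    by (simp add: D_def F0)
  then show ?thesis
    using set_borel_integral_eq_integral(2)[OF h_int(2)[of 0 t]] by simp
qed

text \<open>Both sides are compatible with sums, scaling and increasing limits in \<open>g\<close>,
  so equality on sets propagates to functions. Nothing is subtracted, hence infinite values do no
  harm.\<close>

lemma nn_integral_sum_eqI:
  assumes [measurable_cong]: "sets a1 = sets N" "sets a2 = sets N" "sets b1 = sets N" "sets b2 = sets N"
    and eq: "\<And>A. A \<in> sets N \<Longrightarrow> emeasure a1 A + emeasure a2 A = emeasure b1 A + emeasure b2 A"
    and "g \<in> borel_measurable N"
  shows "integral\<^sup>N a1 g + integral\<^sup>N a2 g = integral\<^sup>N b1 g + integral\<^sup>N b2 g"
  using assms(6)
proof (induction rule: borel_measurable_induct)
  case (cong f g)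
  then show ?case
    using assms(1-4)[THEN sets_eq_imp_space_eq] by (simp cong: nn_integral_cong_simp)
next
  case (set A)
  then show ?case using eq by simp
next
  case (mult u c)
  then show ?case by (simp add: nn_integral_cmult flip: distrib_left)
next
  case (add u v)
  then show ?case by (simp add: nn_integral_add ac_simps)
next
  case (seq U)
  have *: "integral\<^sup>N a (\<Squnion>i. U i) = (\<Squnion>i. integral\<^sup>N a (U i))" if [measurable_cong]: "sets a = sets N" for a
  proof -
    have "integral\<^sup>N a (\<lambda>x. \<Squnion>i. U i x) = (\<Squnion>i. integral\<^sup>N a (U i))"
      using seq by (intro nn_integral_monotone_convergence_SUP) auto
    then show ?thesis by (simp add: image_comp SUP_apply[abs_def])
  qed
  have inc: "incseq (\<lambda>i. integral\<^sup>N a (U i))" for a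
    using \<open>incseq U\<close> by (auto simp: incseq_def le_fun_def intro!: nn_integral_mono)
  show ?case
    using assms(1-4) seq.IH by (simp add: * ennreal_SUP_add[OF inc inc, symmetric] del: SUP_apply Sup_apply)
qed

section \<open>The killed flow\<close>

text \<open>From here on only measurable structure matters. \<open>\<psi>\<close> is total in time
  so that joint measurability can be stated over the whole line, while the semigroup law concerns
  nonnegative times. Boundedness of the rate on orbit segments keeps the cumulative rate
  finite.\<close>

locale flow_with_rate =
  fixes N :: "'a measure" and \<psi> :: "real \<Rightarrow> 'a \<Rightarrow> 'a" and l :: "'a \<Rightarrow> real" and Q :: "'a \<Rightarrow> 'a measure"
  assumes psi_meas: "(\<lambda>(s, x). \<psi> s x) \<in> borel \<Otimes>\<^sub>M N \<rightarrow>\<^sub>M N"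
    and psi_0: "x \<in> space N \<Longrightarrow> \<psi> 0 x = x"
    and psi_add: "0 \<le> s \<Longrightarrow> 0 \<le> t \<Longrightarrow> x \<in> space N \<Longrightarrow> \<psi> (t + s) x = \<psi> s (\<psi> t x)"
    and rate_meas [measurable]: "l \<in> borel_measurable N"
    and rate_nonneg: "x \<in> space N \<Longrightarrow> 0 \<le> l x"
    and rate_bounded: "x \<in> space N \<Longrightarrow> 0 \<le> t \<Longrightarrow> \<exists>B. \<forall>s\<in>{0..t}. l (\<psi> s x) \<le> B"
    and kernel: "Q \<in> N \<rightarrow>\<^sub>M prob_algebra N"
begin

lemma psi_measurable [measurable (raw)]:
  assumes "f \<in> borel_measurable A" "g \<in> A \<rightarrow>\<^sub>M N"
  shows "(\<lambda>a. \<psi> (f a) (g a)) \<in> A \<rightarrow>\<^sub>M N"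
  using measurable_compose[OF measurable_Pair[OF assms] psi_meas] by simp

lemma psi_space: "x \<in> space N \<Longrightarrow> \<psi> s x \<in> space N"
  using measurable_space[OF psi_meas, of "(s, x)"] by (simp add: space_pair_measure)

lemma kernel_subprob [measurable]: "Q \<in> N \<rightarrow>\<^sub>M subprob_algebra N"
  by (rule measurable_prob_algebraD[OF kernel])

definition \<Lambda> :: "real \<Rightarrow> 'a \<Rightarrow> real" where
  "\<Lambda> r x = (LBINT s:{0..r}. l (\<psi> s x))"

lemma cumulative_rate_meas: "(\<lambda>p. \<Lambda> (fst p) (snd p)) \<in> borel_measurable (borel \<Otimes>\<^sub>M N)"
proof -
  have "(\<lambda>p. \<Lambda> (fst p) (snd p)) =
      (\<lambda>p. \<integral>s. (if 0 \<le> s \<and> s \<le> fst p then l (\<psi> s (snd p)) else 0) \<partial>lborel)"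
    unfolding \<Lambda>_def set_lebesgue_integral_def
    by (intro ext Bochner_Integration.integral_cong) auto
  also have "\<dots> \<in> borel_measurable (borel \<Otimes>\<^sub>M N)" by measurable
  finally show ?thesis .
qed

lemma cumulative_rate_measurable [measurable (raw)]:
  assumes "f \<in> borel_measurable A" "g \<in> A \<rightarrow>\<^sub>M N"
  shows "(\<lambda>a. \<Lambda> (f a) (g a)) \<in> borel_measurable A"
  using measurable_compose[OF measurable_Pair[OF assms] cumulative_rate_meas] by simp

lemma rate_orbit_meas: "x \<in> space N \<Longrightarrow> (\<lambda>s. l (\<psi> s x)) \<in> borel_measurable borel"
  by measurable

lemma rate_orbit_integrable:
  assumes "x \<in> space N" "0 \<le> a"
  shows "set_integrable lborel {a..b} (\<lambda>s. l (\<psi> s x))"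
proof (cases "a \<le> b")
  case True
  then obtain B where "\<forall>s\<in>{0..b}. l (\<psi> s x) \<le> B" using rate_bounded[of x b] assms by auto
  then show ?thesis
    using assms rate_nonneg psi_space rate_orbit_meas
    by (intro set_integrable_bounded_Icc[where B = B]) auto
qed (simp add: set_integrable_def)

lemma cumulative_rate_HK:
  assumes "x \<in> space N"
  shows "\<Lambda> r x = integral {0..r} (\<lambda>s. l (\<psi> s x))"
  unfolding \<Lambda>_def using rate_orbit_integrable[OF assms, of 0]
  by (intro set_borel_integral_eq_integral) auto

lemma cumulative_rate_0: "x \<in> space N \<Longrightarrow> \<Lambda> 0 x = 0"
  by (simp add: cumulative_rate_HK)

lemma cumulative_rate_diff:
  assumes "x \<in> space N" "0 \<le> a" "a \<le> b"
  shows "\<Lambda> b x - \<Lambda> a x = integral {a..b} (\<lambda>s. l (\<psi> s x))"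
proof -
  have "(\<lambda>s. l (\<psi> s x)) integrable_on {0..b}"
    using rate_orbit_integrable[OF assms(1), of 0 b] by (intro set_borel_integral_eq_integral) auto
  then show ?thesis
    using Henstock_Kurzweil_Integration.integral_combine[OF assms(2,3)] assms(1)
    by (force simp: cumulative_rate_HK)
qed

lemma cumulative_rate_mono:
  assumes "x \<in> space N" "0 \<le> a" "a \<le> b"
  shows "\<Lambda> a x \<le> \<Lambda> b x"
proof -
  have "0 \<le> integral {a..b} (\<lambda>s. l (\<psi> s x))"
    using rate_nonneg psi_space assms(1)
    by (intro Henstock_Kurzweil_Integration.integral_nonneg
        set_borel_integral_eq_integral(1)[OF rate_orbit_integrable] assms) auto
  then show ?thesis using cumulative_rate_diff[OF assms] by simp
qed

text \<open>This cocycle property makes the survival factor \<open>exp (- \<Lambda> r x)\<close>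
  multiplicative along orbits.\<close>

lemma cumulative_rate_add:
  assumes x: "x \<in> space N" and s: "0 \<le> s" and r: "0 \<le> r"
  shows "\<Lambda> (s + r) x = \<Lambda> s x + \<Lambda> r (\<psi> s x)"
proof -
  have "\<Lambda> r (\<psi> s x) = integral {0..r} (\<lambda>u. l (\<psi> u (\<psi> s x)))"
    using cumulative_rate_diff[of "\<psi> s x" 0 r] cumulative_rate_0 psi_space x r by simp
  also have "\<dots> = integral {0..r} ((\<lambda>u. l (\<psi> u x)) \<circ> (+) s)"
    by (intro Henstock_Kurzweil_Integration.integral_cong) (use x s in \<open>auto simp: psi_add\<close>)
  also have "\<dots> = integral {s..s + r} (\<lambda>u. l (\<psi> u x))"
    using integral_shift_Icc_real[of 0 r "\<lambda>u. l (\<psi> u x)" s]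
    by (simp add: o_def add.commute)
  also have "\<dots> = \<Lambda> (s + r) x - \<Lambda> s x"
    using cumulative_rate_diff[of x s "s + r"] x s r by simp
  finally show ?thesis by simp
qed

lemma cumulative_rate_continuous:
  assumes x: "x \<in> space N"
  shows "continuous_on {0..} (\<lambda>r. \<Lambda> r x)"
proof -
  have "continuous_on {0..t} (\<lambda>r. \<Lambda> r x)" for t
  proof -
    have "continuous_on {0..t} (\<lambda>r. integral {0..r} (\<lambda>s. l (\<psi> s x)))"
      by (rule indefinite_integral_continuous_1)
        (rule set_borel_integral_eq_integral(1)[OF rate_orbit_integrable[OF x]], simp)
    then show ?thesis
      by (rule continuous_on_eq) (use cumulative_rate_diff[OF x, of 0] cumulative_rate_0[OF x] in auto)
  qed
  then have *: "continuous (at r within {0..t}) (\<lambda>r. \<Lambda> r x)" if "0 \<le> r" "r \<le> t" for r t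
    using that by (simp add: continuous_on_eq_continuous_within)
  have "continuous (at r within {0..}) (\<lambda>r. \<Lambda> r x)" if "0 \<le> r" for r
  proof -
    have "at r within {0..r + 1} = at r within {0..}"
      by (rule at_within_nhd[of _ "{..<r + 1}"]) auto
    then show ?thesis using *[of r "r + 1"] that by auto
  qed
  then show ?thesis by (simp add: continuous_on_eq_continuous_within)
qed

text \<open>The cases \<open>c = -1\<close> and \<open>c = 1\<close> of
  \<open>integral_exp_primitive\<close>. With the minus sign the integrand is the density of the
  waiting time until the next jump; with the plus sign it is the weight left over in Duhamel's
  formula.\<close>

lemma nn_integral_exp_rate:
  assumes x: "x \<in> space N" and t: "0 \<le> t"
  shows "(\<integral>\<^sup>+s. indicator {0..t} s * ennreal (l (\<psi> s x) * exp (- \<Lambda> s x)) \<partial>lborel)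
      = ennreal (1 - exp (- \<Lambda> t x))" (is ?A)
    and "(\<integral>\<^sup>+s. indicator {0..t} s * ennreal (l (\<psi> s x) * exp (\<Lambda> s x)) \<partial>lborel)
      = ennreal (exp (\<Lambda> t x) - 1)" (is ?B)
proof -
  obtain B where B: "\<forall>s\<in>{0..t}. l (\<psi> s x) \<le> B" using rate_bounded[OF x t] by auto
  have *: "(LBINT s:{0..t}. c * l (\<psi> s x) * exp (c * \<Lambda> s x)) = exp (c * \<Lambda> t x) - 1" for c
    by (rule integral_exp_primitive[where B = B])
      (use B x t rate_nonneg psi_space in \<open>auto simp: \<Lambda>_def\<close>)
  have **: "(\<integral>\<^sup>+s. indicator {0..t} s * ennreal (l (\<psi> s x) * exp (c * \<Lambda> s x)) \<partial>lborel)
      = ennreal (LBINT s:{0..t}. l (\<psi> s x) * exp (c * \<Lambda> s x))" if "\<bar>c\<bar> = 1" for c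
  proof -
    have "set_integrable lborel {0..t} (\<lambda>s. l (\<psi> s x) * exp (c * \<Lambda> s x))"
    proof (rule set_integrable_bounded_Icc[where B = "B * exp (\<Lambda> t x)"])
      fix s assume s: "s \<in> {0..t}"
      have "\<Lambda> s x \<le> \<Lambda> t x" "0 \<le> \<Lambda> s x"
        using cumulative_rate_mono[OF x, of s t] cumulative_rate_mono[OF x, of 0 s]
          cumulative_rate_0[OF x] s by auto
      then have "c * \<Lambda> s x \<le> \<Lambda> t x" using that by (cases "c \<ge> 0") auto
      moreover have "0 \<le> l (\<psi> s x)" "l (\<psi> s x) \<le> B" using B s rate_nonneg[OF psi_space[OF x]] by auto
      ultimately show "\<bar>l (\<psi> s x) * exp (c * \<Lambda> s x)\<bar> \<le> B * exp (\<Lambda> t x)"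
        by (simp add: abs_mult mult_mono)
    qed (use x in measurable)
    then show ?thesis
      unfolding set_lebesgue_integral_def set_integrable_def
      by (subst nn_integral_eq_integral[symmetric])
        (use rate_nonneg psi_space x in \<open>auto intro!: nn_integral_cong simp: indicator_def\<close>)
  qed
  have "(LBINT s:{0..t}. l (\<psi> s x) * exp (- \<Lambda> s x)) = 1 - exp (- \<Lambda> t x)"
  proof -
    have "- (LBINT s:{0..t}. l (\<psi> s x) * exp (- \<Lambda> s x)) = exp (- \<Lambda> t x) - 1"
      using *[of "-1"] by (simp add: set_lebesgue_integral_def)
    then show ?thesis by linarith
  qed
  then show ?A using **[of "-1"] by simp
  show ?B using *[of 1] **[of 1] by simp
qed

definition killed :: "real \<Rightarrow> ('a \<Rightarrow> ennreal) \<Rightarrow> 'a \<Rightarrow> ennreal" where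
  "killed r g x = ennreal (exp (- \<Lambda> r x)) * g (\<psi> r x)"

definition jump :: "('a \<Rightarrow> ennreal) \<Rightarrow> 'a \<Rightarrow> ennreal" where
  "jump g x = ennreal (l x) * (\<integral>\<^sup>+y. g y \<partial>Q x)"

lemma killed_measurable [measurable (raw)]:
  assumes [measurable]: "f \<in> borel_measurable A" "h \<in> A \<rightarrow>\<^sub>M N" "(\<lambda>p. g (fst p) (snd p)) \<in> borel_measurable (A \<Otimes>\<^sub>M N)"
  shows "(\<lambda>a. killed (f a) (g a) (h a)) \<in> borel_measurable A"
proof -
  have "(\<lambda>a. g a (\<psi> (f a) (h a))) \<in> borel_measurable A"
    using measurable_compose[OF _ assms(3), of "\<lambda>a. (a, \<psi> (f a) (h a))" A] by simp
  then show ?thesis unfolding killed_def by measurable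
qed

lemma jump_measurable [measurable (raw)]:
  assumes [measurable]: "h \<in> A \<rightarrow>\<^sub>M N" "(\<lambda>p. g (fst p) (snd p)) \<in> borel_measurable (A \<Otimes>\<^sub>M N)"
  shows "(\<lambda>a. jump (g a) (h a)) \<in> borel_measurable A"
proof -
  have "(\<lambda>a. Q (h a)) \<in> A \<rightarrow>\<^sub>M subprob_algebra N" by measurable
  from nn_integral_measurable_subprob_algebra2[OF _ this, of g] assms(2)
  have "(\<lambda>a. \<integral>\<^sup>+y. g a y \<partial>Q (h a)) \<in> borel_measurable A" by (simp add: split_beta')
  then show ?thesis unfolding jump_def by measurable
qed

text \<open>The integrand of Duhamel's formula: flow freely for time \<open>u\<close>, pick up the
  rate there, then flow with killing for time \<open>r\<close>.\<close>

abbreviation "killed_rate r h u x \<equiv> ennreal (l (\<psi> u x)) * killed r h (\<psi> u x)"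

text \<open>By the cocycle property, killing over \<open>{s..t}\<close> has weight
  \<open>exp (\<Lambda> s x) * exp (- \<Lambda> t x)\<close>, so the end point
  \<open>g (\<psi> t x)\<close> factors out of the integral; what remains is the integral of the
  rate times \<open>exp (\<Lambda> s x)\<close>, known in closed form.\<close>

lemma flow_Duhamel:
  assumes x: "x \<in> space N" and t: "0 \<le> t" and g: "g \<in> borel_measurable N"
  shows "g (\<psi> t x) = killed t g x +
    (\<integral>\<^sup>+s. indicator {0..t} s * (killed_rate (t - s) g s x) \<partial>lborel)"
proof -
  have "(\<integral>\<^sup>+s. indicator {0..t} s * (killed_rate (t - s) g s x) \<partial>lborel) =
     (\<integral>\<^sup>+s. (indicator {0..t} s * ennreal (l (\<psi> s x) * exp (\<Lambda> s x))) *
        (ennreal (exp (- \<Lambda> t x)) * g (\<psi> t x)) \<partial>lborel)"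
  proof (rule nn_integral_cong)
    fix s
    show "indicator {0..t} s * (killed_rate (t - s) g s x) =
      (indicator {0..t} s * ennreal (l (\<psi> s x) * exp (\<Lambda> s x))) *
        (ennreal (exp (- \<Lambda> t x)) * g (\<psi> t x))"
    proof (cases "s \<in> {0..t}")
      case True
      have "\<Lambda> (t - s) (\<psi> s x) = \<Lambda> t x - \<Lambda> s x"
        using cumulative_rate_add[OF x, of s "t - s"] True by simp
      then have "exp (- \<Lambda> (t - s) (\<psi> s x)) = exp (\<Lambda> s x) * exp (- \<Lambda> t x)"
        by (simp flip: exp_add)
      moreover have "\<psi> (t - s) (\<psi> s x) = \<psi> t x"
        using psi_add[of "t - s" s x] True x by simp
      ultimately show ?thesis
        using rate_nonneg[OF psi_space[OF x], of s] True unfolding killed_def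
        by (simp add: ennreal_mult mult.assoc)
    qed simp
  qed
  also have "\<dots> = ennreal (exp (\<Lambda> t x) - 1) * (ennreal (exp (- \<Lambda> t x)) * g (\<psi> t x))"
    using x by (subst nn_integral_multc) (auto simp: nn_integral_exp_rate(2)[OF x t])
  also have "\<dots> = ennreal (1 - exp (- \<Lambda> t x)) * g (\<psi> t x)"
  proof -
    have "0 \<le> \<Lambda> t x" using cumulative_rate_mono[OF x, of 0 t] cumulative_rate_0[OF x] t by simp
    then show ?thesis
      by (simp add: mult.assoc[symmetric] ennreal_mult'[symmetric] left_diff_distrib flip: exp_add)
  qed
  finally show ?thesis
    using cumulative_rate_mono[OF x, of 0 t] cumulative_rate_0[OF x] t
    by (simp add: killed_def flip: distrib_right ennreal_plus)
qed

end

section \<open>The forward equation\<close>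

lemma triangle_pred [measurable]:
  "Measurable.pred (borel \<Otimes>\<^sub>M borel) (\<lambda>p. snd p \<in> {0..fst p :: real})"
  by (simp only: atLeastAtMost_iff) measurable

lemma indicator_mult_cong:
  shows "(x \<in> A \<Longrightarrow> f = g) \<Longrightarrow> indicator A x * f = (indicator A x * g :: ennreal)"
  by (cases "x \<in> A") auto

lemma lborel_swap:
  fixes f :: "real \<Rightarrow> real \<Rightarrow> ennreal"
  assumes "(\<lambda>(x, y). f x y) \<in> borel_measurable (borel \<Otimes>\<^sub>M borel)"
  shows "(\<integral>\<^sup>+x. \<integral>\<^sup>+y. f x y \<partial>lborel \<partial>lborel) = (\<integral>\<^sup>+y. \<integral>\<^sup>+x. f x y \<partial>lborel \<partial>lborel)"
proof -
  have "(\<lambda>(x, y). f x y) \<in> borel_measurable (lborel \<Otimes>\<^sub>M lborel)"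
    using assms by (simp cong: measurable_cong_sets add: sets_pair_measure_cong[of lborel borel lborel borel])
  from lborel_pair.Fubini'[OF this] show ?thesis by simp
qed

lemma nn_integral_lborel_reflect:
  fixes f :: "real \<Rightarrow> ennreal"
  assumes "f \<in> borel_measurable borel"
  shows "(\<integral>\<^sup>+s. f s \<partial>lborel) = (\<integral>\<^sup>+s. f (c - s) \<partial>lborel)"
  using nn_integral_real_affine[OF assms, of "-1" c] by simp

lemma nn_integral_lborel_shift:
  fixes f :: "real \<Rightarrow> ennreal"
  assumes "f \<in> borel_measurable borel"
  shows "(\<integral>\<^sup>+s. f s \<partial>lborel) = (\<integral>\<^sup>+s. f (s + c) \<partial>lborel)"
  using nn_integral_real_affine[OF assms, of 1 c] by (simp add: add.commute)

text \<open>For fixed \<open>u\<close> the substitution \<open>v = t + u - s\<close> reflects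
  \<open>{u..t}\<close> onto itself and turns \<open>t - s\<close> into
  \<open>v - u\<close>.\<close>

lemma nn_integral_triangle_reflect:
  fixes H :: "real \<Rightarrow> real \<Rightarrow> ennreal"
  assumes [measurable]: "(\<lambda>(r, u). H r u) \<in> borel_measurable (borel \<Otimes>\<^sub>M borel)"
  shows "(\<integral>\<^sup>+s. indicator {0..t} s * (\<integral>\<^sup>+u. indicator {0..s} u * H (t - s) u \<partial>lborel) \<partial>lborel) =
    (\<integral>\<^sup>+v. indicator {0..t} v * (\<integral>\<^sup>+u. indicator {0..v} u * H (v - u) u \<partial>lborel) \<partial>lborel)"
proof -
  let ?B = "\<lambda>v u. (if 0 \<le> u \<and> u \<le> v \<and> v \<le> t then H (v - u) u else 0)"
  let ?A = "\<lambda>s u. (if 0 \<le> u \<and> u \<le> s \<and> s \<le> t then H (t - s) u else 0)"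
  have "(\<integral>\<^sup>+s. indicator {0..t} s * (\<integral>\<^sup>+u. indicator {0..s} u * H (t - s) u \<partial>lborel) \<partial>lborel) =
    (\<integral>\<^sup>+s. \<integral>\<^sup>+u. ?A s u \<partial>lborel \<partial>lborel)"
    by (subst nn_integral_cmult[symmetric], measurable)
      (auto intro!: nn_integral_cong simp: indicator_def)
  also have "\<dots> =
    (\<integral>\<^sup>+u. \<integral>\<^sup>+s. ?A s u \<partial>lborel \<partial>lborel)"
    by (rule lborel_swap) measurable
  also have "\<dots> =
    (\<integral>\<^sup>+u. \<integral>\<^sup>+v. ?B v u \<partial>lborel \<partial>lborel)"
  proof (rule nn_integral_cong)
    fix u :: real
    let ?f = "\<lambda>s. if 0 \<le> u \<and> u \<le> s \<and> s \<le> t then H (t - s) u else 0"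
    have "?f \<in> borel_measurable borel" by measurable
    from nn_integral_lborel_reflect[OF this, of "t + u"]
    have "(\<integral>\<^sup>+s. ?f s \<partial>lborel) = (\<integral>\<^sup>+v. ?f (t + u - v) \<partial>lborel)" .
    also have "\<dots> = (\<integral>\<^sup>+v. ?B v u \<partial>lborel)"
      by (intro nn_integral_cong) auto
    finally show "(\<integral>\<^sup>+s. ?A s u \<partial>lborel) = \<dots>" .
  qed
  also have "\<dots> =
    (\<integral>\<^sup>+v. \<integral>\<^sup>+u. ?B v u \<partial>lborel \<partial>lborel)"
    by (rule lborel_swap) measurable
  also have "\<dots> =
    (\<integral>\<^sup>+v. indicator {0..t} v * (\<integral>\<^sup>+u. indicator {0..v} u * H (v - u) u \<partial>lborel) \<partial>lborel)"
    by (subst nn_integral_cmult[symmetric], measurable)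
      (auto intro!: nn_integral_cong simp: indicator_def)
  finally show ?thesis .
qed

text \<open>For fixed \<open>r\<close> the substitution shifts \<open>s\<close> by \<open>r\<close>.
  In its use the outer time changes from that of the later jump to that of the earlier one,
  \<open>r\<close> being the delay between them.\<close>

lemma nn_integral_triangle_shift:
  fixes h :: "real \<Rightarrow> real \<Rightarrow> ennreal"
  assumes [measurable]: "(\<lambda>(s, r). h s r) \<in> borel_measurable (borel \<Otimes>\<^sub>M borel)"
  shows "(\<integral>\<^sup>+s. indicator {0..t} s * (\<integral>\<^sup>+r. indicator {0..s} r * h s r \<partial>lborel) \<partial>lborel) =
    (\<integral>\<^sup>+s. indicator {0..t} s * (\<integral>\<^sup>+r. indicator {0..t - s} r * h (s + r) r \<partial>lborel) \<partial>lborel)"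
proof -
  let ?B = "\<lambda>s r. (if 0 \<le> r \<and> 0 \<le> s \<and> s + r \<le> t then h (s + r) r else 0)"
  let ?A = "\<lambda>s r. (if 0 \<le> r \<and> r \<le> s \<and> s \<le> t then h s r else 0)"
  have "(\<integral>\<^sup>+s. indicator {0..t} s * (\<integral>\<^sup>+r. indicator {0..s} r * h s r \<partial>lborel) \<partial>lborel) =
    (\<integral>\<^sup>+s. \<integral>\<^sup>+r. ?A s r \<partial>lborel \<partial>lborel)"
    by (subst nn_integral_cmult[symmetric], measurable)
      (auto intro!: nn_integral_cong simp: indicator_def)
  also have "\<dots> = (\<integral>\<^sup>+r. \<integral>\<^sup>+s. ?A s r \<partial>lborel \<partial>lborel)"
    by (rule lborel_swap) measurable
  also have "\<dots> =
    (\<integral>\<^sup>+r. \<integral>\<^sup>+s. ?B s r \<partial>lborel \<partial>lborel)"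
  proof (rule nn_integral_cong)
    fix r :: real
    let ?f = "\<lambda>s. if 0 \<le> r \<and> r \<le> s \<and> s \<le> t then h s r else 0"
    have "?f \<in> borel_measurable borel" by measurable
    from nn_integral_lborel_shift[OF this, of r]
    have "(\<integral>\<^sup>+s. ?f s \<partial>lborel) = (\<integral>\<^sup>+s. ?f (s + r) \<partial>lborel)" .
    also have "\<dots> = (\<integral>\<^sup>+s. ?B s r \<partial>lborel)"
      by (intro nn_integral_cong) auto
    finally show "(\<integral>\<^sup>+s. ?A s r \<partial>lborel) = \<dots>" .
  qed
  also have "\<dots> =
    (\<integral>\<^sup>+s. \<integral>\<^sup>+r. ?B s r \<partial>lborel \<partial>lborel)"
    by (rule lborel_swap) measurable
  also have "\<dots> =
    (\<integral>\<^sup>+s. indicator {0..t} s * (\<integral>\<^sup>+r. indicator {0..t - s} r * h (s + r) r \<partial>lborel) \<partial>lborel)"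
    by (subst nn_integral_cmult[symmetric], measurable)
      (auto intro!: nn_integral_cong simp: indicator_def)
  finally show ?thesis .
qed

lemma nn_integral_reflect_Icc:
  fixes f :: "real \<Rightarrow> ennreal"
  assumes [measurable]: "f \<in> borel_measurable borel"
  shows "(\<integral>\<^sup>+s. indicator {0..t} s * f (t - s) \<partial>lborel) = (\<integral>\<^sup>+s. indicator {0..t} s * f s \<partial>lborel)"
proof -
  have "(\<integral>\<^sup>+s. indicator {0..t} s * f s \<partial>lborel) =
      (\<integral>\<^sup>+s. indicator {0..t} (t - s) * f (t - s) \<partial>lborel)"
    by (rule nn_integral_lborel_reflect[where f = "\<lambda>s. indicator {0..t} s * f s"]) measurable
  also have "\<dots> = (\<integral>\<^sup>+s. indicator {0..t} s * f (t - s) \<partial>lborel)"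
    by (intro nn_integral_cong) (auto simp: indicator_def)
  finally show ?thesis by simp
qed

lemma nn_integral_lborel_swap:
  assumes "finite_measure nu" and f: "(\<lambda>(s, x). f s x) \<in> borel_measurable (borel \<Otimes>\<^sub>M nu)"
  shows "(\<integral>\<^sup>+s. (\<integral>\<^sup>+x. f s x \<partial>nu) \<partial>(lborel :: real measure)) = (\<integral>\<^sup>+x. (\<integral>\<^sup>+s. f s x \<partial>lborel) \<partial>nu)"
proof -
  interpret finite_measure nu by fact
  interpret pair_sigma_finite lborel nu ..
  have "(\<lambda>(s, x). f s x) \<in> borel_measurable (lborel \<Otimes>\<^sub>M nu)"
    using f by (simp cong: measurable_cong_sets add: sets_pair_measure_cong[of lborel borel nu nu])
  from Fubini'[OF this] show ?thesis by simp
qed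

context flow_with_rate
begin

text \<open>\<open>rate_flux\<close> and \<open>jump_flux\<close> are the measures
  \<open>l \<mu>\<close> and \<open>\<mu> J\<close>: the mass that leaves, respectively enters, a
  set by jumps per unit time when the state has law \<open>\<mu>\<close>.\<close>

definition rate_flux :: "'a measure \<Rightarrow> 'a measure" where
  "rate_flux \<mu> = density \<mu> (\<lambda>x. ennreal (l x))"

definition jump_flux :: "'a measure \<Rightarrow> 'a measure" where
  "jump_flux \<mu> = rate_flux \<mu> \<bind> Q"

lemma sets_rate_flux [simp, measurable_cong]: "sets (rate_flux \<mu>) = sets \<mu>"
  by (simp add: rate_flux_def)

lemma nn_integral_rate_flux:
  assumes [measurable_cong]: "sets \<mu> = sets N" and [measurable]: "g \<in> borel_measurable N"
  shows "(\<integral>\<^sup>+x. g x \<partial>rate_flux \<mu>) = (\<integral>\<^sup>+x. ennreal (l x) * g x \<partial>\<mu>)"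
  unfolding rate_flux_def by (subst nn_integral_density) measurable

lemma sets_jump_flux:
  assumes [measurable_cong]: "sets \<mu> = sets N" and "space N \<noteq> {}"
  shows "sets (jump_flux \<mu>) = sets N"
  unfolding jump_flux_def
  by (rule sets_bind[where N = N])
    (use assms sets_eq_imp_space_eq[OF assms(1)] measurable_space[OF kernel_subprob] in
      \<open>auto simp: rate_flux_def space_subprob_algebra\<close>)

lemma nn_integral_jump_flux:
  assumes [measurable_cong]: "sets \<mu> = sets N" and g[measurable]: "g \<in> borel_measurable N"
  shows "(\<integral>\<^sup>+x. g x \<partial>jump_flux \<mu>) = (\<integral>\<^sup>+x. jump g x \<partial>\<mu>)"
proof -
  have "Q \<in> rate_flux \<mu> \<rightarrow>\<^sub>M subprob_algebra N" by measurable
  from nn_integral_bind[OF g this]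
  show ?thesis
    unfolding jump_flux_def jump_def
    by (simp add: nn_integral_rate_flux[OF assms(1)])
qed

lemma kernel_one: "x \<in> space N \<Longrightarrow> (\<integral>\<^sup>+y. 1 \<partial>Q x) = 1"
  using measurable_space[OF kernel, of x]
  by (simp add: space_prob_algebra prob_space.emeasure_space_1)

text \<open>Both total masses equal the integral of the rate, because \<open>Q\<close> has mass
  one.\<close>

lemma flux_finite:
  assumes [measurable_cong]: "sets \<mu> = sets N" and "(\<integral>\<^sup>+x. ennreal (l x) \<partial>\<mu>) < \<infinity>"
  shows "finite_measure (rate_flux \<mu>)" "finite_measure (jump_flux \<mu>)"
proof -
  show "finite_measure (rate_flux \<mu>)"
  proof (rule finite_measureI)
    have "emeasure (rate_flux \<mu>) (space (rate_flux \<mu>)) = (\<integral>\<^sup>+x. 1 \<partial>rate_flux \<mu>)" by simp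
    also have "\<dots> = (\<integral>\<^sup>+x. ennreal (l x) \<partial>\<mu>)"
      by (subst nn_integral_rate_flux[OF assms(1)]) auto
    finally show "emeasure (rate_flux \<mu>) (space (rate_flux \<mu>)) \<noteq> \<infinity>" using assms(2) by simp
  qed
  show "finite_measure (jump_flux \<mu>)"
  proof (rule finite_measureI)
    have "emeasure (jump_flux \<mu>) (space (jump_flux \<mu>)) = (\<integral>\<^sup>+x. 1 \<partial>jump_flux \<mu>)" by simp
    also have "\<dots> = (\<integral>\<^sup>+x. jump (\<lambda>_. 1) x \<partial>\<mu>)"
      by (rule nn_integral_jump_flux[OF assms(1)]) simp
    also have "\<dots> = (\<integral>\<^sup>+x. ennreal (l x) \<partial>\<mu>)"
      using sets_eq_imp_space_eq[OF assms(1)] kernel_one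
      by (intro nn_integral_cong) (simp add: jump_def)
    finally show "emeasure (jump_flux \<mu>) (space (jump_flux \<mu>)) \<noteq> \<infinity>" using assms(2) by simp
  qed
qed

text \<open>The integral of \<open>nu T\<^sub>s\<close> over \<open>s\<close> in
  \<open>{0..t}\<close>, realised as an image of Lebesgue measure times \<open>nu\<close>. Being a
  measure by construction, it can enter identities that are checked on sets.
  \<open>killed_occupation\<close> is the analogue with killing.\<close>

definition occupation :: "'a measure \<Rightarrow> real \<Rightarrow> 'a measure" where
  "occupation nu t = distr (density lborel (indicator {0..t}) \<Otimes>\<^sub>M nu) N (\<lambda>(s, x). \<psi> s x)"

definition killed_occupation :: "'a measure \<Rightarrow> real \<Rightarrow> 'a measure" where
  "killed_occupation nu t =
     distr (density (density lborel (indicator {0..t}) \<Otimes>\<^sub>M nu) (\<lambda>(s, x). ennreal (exp (- \<Lambda> s x))))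
       N (\<lambda>(s, x). \<psi> s x)"

lemma nn_integral_occupation:
  assumes [measurable_cong]: "sets nu = sets N" and fin: "finite_measure nu"
    and [measurable]: "g \<in> borel_measurable N"
  shows "(\<integral>\<^sup>+x. g x \<partial>occupation nu t) =
      (\<integral>\<^sup>+s. indicator {0..t} s * (\<integral>\<^sup>+x. g (\<psi> s x) \<partial>nu) \<partial>lborel)"
    and "(\<integral>\<^sup>+x. g x \<partial>killed_occupation nu t) =
      (\<integral>\<^sup>+s. indicator {0..t} s * (\<integral>\<^sup>+x. killed s g x \<partial>nu) \<partial>lborel)"
proof -
  interpret finite_measure nu by fact
  show "(\<integral>\<^sup>+x. g x \<partial>occupation nu t) =
      (\<integral>\<^sup>+s. indicator {0..t} s * (\<integral>\<^sup>+x. g (\<psi> s x) \<partial>nu) \<partial>lborel)"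
    unfolding occupation_def
    by (subst nn_integral_distr, measurable, subst nn_integral_fst[symmetric], measurable,
        subst nn_integral_density) measurable
  show "(\<integral>\<^sup>+x. g x \<partial>killed_occupation nu t) =
      (\<integral>\<^sup>+s. indicator {0..t} s * (\<integral>\<^sup>+x. killed s g x \<partial>nu) \<partial>lborel)"
    unfolding killed_occupation_def killed_def
    by (subst nn_integral_distr, measurable, subst nn_integral_density, measurable,
        subst nn_integral_fst[symmetric], measurable, subst nn_integral_density) measurable
qed

text \<open>Duhamel's formula integrated over \<open>nu\<close> and over \<open>v\<close> in
  \<open>{0..t}\<close>. The double integral is reflected so that the killed part lasts
  \<open>t - s\<close>, the form that arises when an identity at time \<open>s\<close> is tested
  with the rate times a function killed over the remaining time.\<close>

lemma Duhamel_occupation: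
  assumes [measurable_cong]: "sets nu = sets N" and fin: "finite_measure nu"
    and [measurable]: "h \<in> borel_measurable N"
  shows "(\<integral>\<^sup>+s. indicator {0..t} s * (\<integral>\<^sup>+u. indicator {0..s} u *
        (\<integral>\<^sup>+x. killed_rate (t - s) h u x \<partial>nu) \<partial>lborel) \<partial>lborel)
      + (\<integral>\<^sup>+v. indicator {0..t} v * (\<integral>\<^sup>+x. killed v h x \<partial>nu) \<partial>lborel)
    = (\<integral>\<^sup>+v. indicator {0..t} v * (\<integral>\<^sup>+x. h (\<psi> v x) \<partial>nu) \<partial>lborel)"
proof -
  let ?K = "\<lambda>v. (\<integral>\<^sup>+x. killed v h x \<partial>nu)"
  let ?R = "\<lambda>v u. (\<integral>\<^sup>+x. killed_rate (v - u) h u x \<partial>nu)"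
  interpret finite_measure nu by fact
  have sp: "space nu = space N" by (rule sets_eq_imp_space_eq[OF assms(1)])
  have inner: "(\<integral>\<^sup>+u. indicator {0..v} u *
      ?R v u \<partial>lborel)
      + ?K v = (\<integral>\<^sup>+x. h (\<psi> v x) \<partial>nu)" if v: "0 \<le> v" for v
  proof -
    have "(\<integral>\<^sup>+u. indicator {0..v} u *
        ?R v u \<partial>lborel) =
        (\<integral>\<^sup>+u. (\<integral>\<^sup>+x. indicator {0..v} u * (killed_rate (v - u) h u x) \<partial>nu) \<partial>lborel)"
      by (intro nn_integral_cong nn_integral_cmult[symmetric]) measurable
    also have "\<dots> = (\<integral>\<^sup>+x. (\<integral>\<^sup>+u. indicator {0..v} u *
        (killed_rate (v - u) h u x) \<partial>lborel) \<partial>nu)"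
      by (rule nn_integral_lborel_swap[OF fin]) measurable
    finally have "(\<integral>\<^sup>+u. indicator {0..v} u *
        ?R v u \<partial>lborel)
        + ?K v =
        (\<integral>\<^sup>+x. (\<integral>\<^sup>+u. indicator {0..v} u *
        (killed_rate (v - u) h u x) \<partial>lborel) + killed v h x \<partial>nu)"
      by (subst nn_integral_add) measurable
    also have "\<dots> = (\<integral>\<^sup>+x. h (\<psi> v x) \<partial>nu)"
      by (intro nn_integral_cong) (simp add: sp flow_Duhamel[OF _ v, of _ h] add.commute)
    finally show ?thesis .
  qed
  have tri: "(\<integral>\<^sup>+s. indicator {0..t} s * (\<integral>\<^sup>+u. indicator {0..s} u *
        (\<integral>\<^sup>+x. killed_rate (t - s) h u x \<partial>nu) \<partial>lborel) \<partial>lborel)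
     = (\<integral>\<^sup>+v. indicator {0..t} v * (\<integral>\<^sup>+u. indicator {0..v} u *
        ?R v u \<partial>lborel) \<partial>lborel)"
    by (rule nn_integral_triangle_reflect[where H = "\<lambda>r u.
          \<integral>\<^sup>+x. killed_rate r h u x \<partial>nu"]) measurable
  have "(\<integral>\<^sup>+v. indicator {0..t} v * (\<integral>\<^sup>+u. indicator {0..v} u *
        ?R v u \<partial>lborel) \<partial>lborel)
     + (\<integral>\<^sup>+v. indicator {0..t} v * ?K v \<partial>lborel) =
     (\<integral>\<^sup>+v. indicator {0..t} v * (\<integral>\<^sup>+u. indicator {0..v} u *
        ?R v u \<partial>lborel)
        + indicator {0..t} v * ?K v \<partial>lborel)"
    by (rule nn_integral_add[symmetric]) measurable
  also have "\<dots> = (\<integral>\<^sup>+v. indicator {0..t} v * (\<integral>\<^sup>+x. h (\<psi> v x) \<partial>nu) \<partial>lborel)"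
  proof (rule nn_integral_cong)
    fix v
    show "indicator {0..t} v * (\<integral>\<^sup>+u. indicator {0..v} u *
        ?R v u \<partial>lborel)
        + indicator {0..t} v * ?K v =
      indicator {0..t} v * (\<integral>\<^sup>+x. h (\<psi> v x) \<partial>nu)"
    proof (cases "v \<in> {0..t}")
      case True
      then have "indicator {0..t} v = (1::ennreal)" "0 \<le> v" by auto
      then show ?thesis by (simp only: mult_1_left inner)
    qed simp
  qed
  finally show ?thesis unfolding tri .
qed

end

locale forward_equation = flow_with_rate +
  fixes \<mu> :: "'a measure"
  assumes sets_mu: "sets \<mu> = sets N" and prob_mu: "prob_space \<mu>"
    and rate_integrable: "(\<integral>\<^sup>+x. ennreal (l x) \<partial>\<mu>) < \<infinity>"
    and forward: "g \<in> borel_measurable N \<Longrightarrow> 0 \<le> t \<Longrightarrow>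
      (\<integral>\<^sup>+x. g (\<psi> t x) \<partial>\<mu>) + (\<integral>\<^sup>+x. g x \<partial>occupation (jump_flux \<mu>) t) =
      (\<integral>\<^sup>+x. g x \<partial>\<mu>) + (\<integral>\<^sup>+x. g x \<partial>occupation (rate_flux \<mu>) t)"
begin

lemma space_mu: "space \<mu> = space N"
  by (rule sets_eq_imp_space_eq[OF sets_mu])

lemma sets_flux [simp]: "sets (jump_flux \<mu>) = sets N" "sets (rate_flux \<mu>) = sets N"
  using sets_jump_flux[OF sets_mu] prob_space.not_empty[OF prob_mu] space_mu sets_mu by auto

lemma finite_flux: "finite_measure (jump_flux \<mu>)" "finite_measure (rate_flux \<mu>)" "finite_measure \<mu>"
  using flux_finite[OF sets_mu rate_integrable] prob_mu by (auto intro: prob_space.finite_measure)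

text \<open>The forward identity at time \<open>s\<close> is tested with
  \<open>l S\<^sub>t\<^sub>-\<^sub>s h\<close> and integrated over \<open>s\<close>. Duhamel's
  formula for \<open>\<mu>\<close>, \<open>jump_flux \<mu>\<close> and
  \<open>rate_flux \<mu>\<close> converts the resulting terms into free-flow ones, and these are
  balanced by the forward identity at time \<open>t\<close>.\<close>

lemma killed_equation:
  assumes g: "g \<in> borel_measurable N" and t: "0 \<le> t"
  shows "(\<integral>\<^sup>+x. killed t g x \<partial>\<mu>) +
      (\<integral>\<^sup>+s. indicator {0..t} s * (\<integral>\<^sup>+x. killed s g x \<partial>jump_flux \<mu>) \<partial>lborel) = (\<integral>\<^sup>+x. g x \<partial>\<mu>)"
proof -
  note [measurable_cong] = sets_mu sets_flux
  \<comment> \<open>The bound on \<open>h\<close> makes \<open>?e\<close> finite, which permits the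
    one cancellation; general \<open>g\<close> is reached afterwards through indicators.\<close>
  have bounded: "(\<integral>\<^sup>+x. killed t h x \<partial>\<mu>) +
      (\<integral>\<^sup>+s. indicator {0..t} s * (\<integral>\<^sup>+x. killed s h x \<partial>jump_flux \<mu>) \<partial>lborel) = (\<integral>\<^sup>+x. h x \<partial>\<mu>)"
    if [measurable]: "h \<in> borel_measurable N" and h1: "\<And>x. h x \<le> 1" for h
  proof -
    interpret finite_measure \<mu> by (rule finite_flux)
    interpret jf: finite_measure "jump_flux \<mu>" by (rule finite_flux)
    interpret rf: finite_measure "rate_flux \<mu>" by (rule finite_flux)
    let ?a = "\<integral>\<^sup>+x. killed t h x \<partial>\<mu>"
    let ?b = "\<integral>\<^sup>+s. indicator {0..t} s * (\<integral>\<^sup>+x. killed s h x \<partial>jump_flux \<mu>) \<partial>lborel"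
    let ?c = "\<integral>\<^sup>+s. indicator {0..t} s *
        (\<integral>\<^sup>+x. killed_rate (t - s) h s x \<partial>\<mu>) \<partial>lborel"
    let ?X = "\<lambda>nu. \<integral>\<^sup>+s. indicator {0..t} s * (\<integral>\<^sup>+u. indicator {0..s} u *
        (\<integral>\<^sup>+x. killed_rate (t - s) h u x \<partial>nu) \<partial>lborel) \<partial>lborel"
    let ?d = "\<integral>\<^sup>+s. indicator {0..t} s * (\<integral>\<^sup>+x. killed s h x \<partial>rate_flux \<mu>) \<partial>lborel"
    let ?e = "\<integral>\<^sup>+s. indicator {0..t} s * (\<integral>\<^sup>+x. h (\<psi> s x) \<partial>rate_flux \<mu>) \<partial>lborel"
    have X: "?X (jump_flux \<mu>) + ?b =
        (\<integral>\<^sup>+v. indicator {0..t} v * (\<integral>\<^sup>+x. h (\<psi> v x) \<partial>jump_flux \<mu>) \<partial>lborel)"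
        "?X (rate_flux \<mu>) + ?d = ?e"
      by (rule Duhamel_occupation; (rule finite_flux sets_flux that(1)))+
    have ac: "?a + ?c = (\<integral>\<^sup>+x. h (\<psi> t x) \<partial>\<mu>)"
    proof -
      have "?c = (\<integral>\<^sup>+s. (\<integral>\<^sup>+x. indicator {0..t} s *
          (killed_rate (t - s) h s x) \<partial>\<mu>) \<partial>lborel)"
        by (intro nn_integral_cong nn_integral_cmult[symmetric]) measurable
      also have "\<dots> = (\<integral>\<^sup>+x. (\<integral>\<^sup>+s. indicator {0..t} s *
          (killed_rate (t - s) h s x) \<partial>lborel) \<partial>\<mu>)"
        by (rule nn_integral_lborel_swap[OF finite_flux(3)]) measurable
      finally have "?a + ?c = (\<integral>\<^sup>+x. killed t h x + (\<integral>\<^sup>+s. indicator {0..t} s *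
          (killed_rate (t - s) h s x) \<partial>lborel) \<partial>\<mu>)"
        by (subst nn_integral_add) measurable
      also have "\<dots> = (\<integral>\<^sup>+x. h (\<psi> t x) \<partial>\<mu>)"
        by (intro nn_integral_cong) (simp add: space_mu flow_Duhamel[OF _ t, of _ h])
      finally show ?thesis .
    qed
    \<comment> \<open>On the right, the factor \<open>l\<close> of the test function is absorbed
      into \<open>rate_flux \<mu>\<close>, and reversing time then gives \<open>?d\<close>.\<close>
    have cX: "?c + ?X (jump_flux \<mu>) = ?d + ?X (rate_flux \<mu>)"
    proof -
      have *: "(\<integral>\<^sup>+x. killed_rate (t - s) h s x \<partial>\<mu>) +
          (\<integral>\<^sup>+u. indicator {0..s} u *
            (\<integral>\<^sup>+x. killed_rate (t - s) h u x \<partial>jump_flux \<mu>) \<partial>lborel) =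
          (\<integral>\<^sup>+x. killed (t - s) h x \<partial>rate_flux \<mu>) +
          (\<integral>\<^sup>+u. indicator {0..s} u *
            (\<integral>\<^sup>+x. killed_rate (t - s) h u x \<partial>rate_flux \<mu>) \<partial>lborel)"
        if s: "0 \<le> s" for s
      proof -
        have g: "(\<lambda>x. ennreal (l x) * killed (t - s) h x) \<in> borel_measurable N" by measurable
        have "(\<integral>\<^sup>+x. killed (t - s) h x \<partial>rate_flux \<mu>) = (\<integral>\<^sup>+x. ennreal (l x) * killed (t - s) h x \<partial>\<mu>)"
          by (rule nn_integral_rate_flux[OF sets_mu]) measurable
        then show ?thesis
          using forward[OF g s] by (simp only: nn_integral_occupation[OF sets_flux(1) finite_flux(1) g]
              nn_integral_occupation[OF sets_flux(2) finite_flux(2) g])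
      qed
      have "?c + ?X (jump_flux \<mu>) = (\<integral>\<^sup>+s. indicator {0..t} s *
          ((\<integral>\<^sup>+x. killed_rate (t - s) h s x \<partial>\<mu>) +
          (\<integral>\<^sup>+u. indicator {0..s} u *
            (\<integral>\<^sup>+x. killed_rate (t - s) h u x \<partial>jump_flux \<mu>) \<partial>lborel)) \<partial>lborel)"
        unfolding distrib_left by (subst nn_integral_add) measurable
      also have "\<dots> = (\<integral>\<^sup>+s. indicator {0..t} s * ((\<integral>\<^sup>+x. killed (t - s) h x \<partial>rate_flux \<mu>) +
          (\<integral>\<^sup>+u. indicator {0..s} u *
            (\<integral>\<^sup>+x. killed_rate (t - s) h u x \<partial>rate_flux \<mu>) \<partial>lborel)) \<partial>lborel)"
        by (intro nn_integral_cong indicator_mult_cong *) simp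
      also have "\<dots> = (\<integral>\<^sup>+s. indicator {0..t} s * (\<integral>\<^sup>+x. killed (t - s) h x \<partial>rate_flux \<mu>) \<partial>lborel) +
          ?X (rate_flux \<mu>)"
        unfolding distrib_left by (subst nn_integral_add) measurable
      also have "(\<integral>\<^sup>+s. indicator {0..t} s * (\<integral>\<^sup>+x. killed (t - s) h x \<partial>rate_flux \<mu>) \<partial>lborel) = ?d"
        by (rule nn_integral_reflect_Icc[where f = "\<lambda>s. \<integral>\<^sup>+x. killed s h x \<partial>rate_flux \<mu>"]) measurable
      finally show ?thesis .
    qed
    have fwd: "(\<integral>\<^sup>+x. h (\<psi> t x) \<partial>\<mu>) +
        (\<integral>\<^sup>+v. indicator {0..t} v * (\<integral>\<^sup>+x. h (\<psi> v x) \<partial>jump_flux \<mu>) \<partial>lborel) = (\<integral>\<^sup>+x. h x \<partial>\<mu>) + ?e"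
      using forward[OF that(1) t]
      by (simp only: nn_integral_occupation[OF sets_flux(1) finite_flux(1) that(1)]
          nn_integral_occupation[OF sets_flux(2) finite_flux(2) that(1)])
    have "?e \<le> (\<integral>\<^sup>+s. indicator {0..t} s * emeasure (rate_flux \<mu>) (space (rate_flux \<mu>)) \<partial>lborel)"
    proof (intro nn_integral_mono mult_left_mono)
      fix s
      have "(\<integral>\<^sup>+x. h (\<psi> s x) \<partial>rate_flux \<mu>) \<le> (\<integral>\<^sup>+x. 1 \<partial>rate_flux \<mu>)"
        by (intro nn_integral_mono h1)
      then show "(\<integral>\<^sup>+x. h (\<psi> s x) \<partial>rate_flux \<mu>) \<le> emeasure (rate_flux \<mu>) (space (rate_flux \<mu>))" by simp
    qed simp
    also have "\<dots> < \<infinity>"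
      using t rf.emeasure_finite[of "space (rate_flux \<mu>)"]
      by (subst nn_integral_multc) (simp_all add: ennreal_mult_eq_top_iff less_top[symmetric])
    finally have e: "?e \<noteq> \<infinity>" by simp
    \<comment> \<open>Regrouping only: \<open>?e\<close> is made of \<open>?d\<close> and
      \<open>?X (rate_flux \<mu>)\<close>, which \<open>cX\<close> exchanges for \<open>?c\<close>
      and \<open>?X (jump_flux \<mu>)\<close>.\<close>
    have "(a + b) + e = (a + c) + (p + b)" if "q + d = e" "c + p = d + q" for a b c d e p q :: ennreal
    proof -
      have "(a + b) + e = a + b + (d + q)" using that(1) by (simp add: ac_simps)
      also have "\<dots> = (a + c) + (p + b)" unfolding that(2)[symmetric] by (simp add: ac_simps)
      finally show ?thesis .
    qed
    from this[OF X(2) cX] have "(?a + ?b) + ?e = (?a + ?c) + (?X (jump_flux \<mu>) + ?b)" .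
    also have "\<dots> = (\<integral>\<^sup>+x. h x \<partial>\<mu>) + ?e" unfolding ac X(1) by (rule fwd)
    finally show ?thesis using e by (simp add: ennreal_add_left_cancel add.commute[of _ ?e])
  qed
  let ?K = "distr (density \<mu> (\<lambda>x. ennreal (exp (- \<Lambda> t x)))) N (\<psi> t)"
  have K: "(\<integral>\<^sup>+x. h x \<partial>?K) = (\<integral>\<^sup>+x. killed t h x \<partial>\<mu>)" if [measurable]: "h \<in> borel_measurable N" for h
    unfolding killed_def by (subst nn_integral_distr, measurable, subst nn_integral_density) measurable
  \<comment> \<open>The null measure fills the fourth slot, as the right-hand side has a single
    term.\<close>
  have "(\<integral>\<^sup>+x. g x \<partial>?K) + (\<integral>\<^sup>+x. g x \<partial>killed_occupation (jump_flux \<mu>) t) =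
      (\<integral>\<^sup>+x. g x \<partial>\<mu>) + (\<integral>\<^sup>+x. g x \<partial>null_measure N)"
  proof (rule nn_integral_sum_eqI[OF _ _ sets_mu _ _ g])
    fix A assume A: "A \<in> sets N"
    have ind: "indicator A \<in> borel_measurable N" using A by simp
    have "emeasure ?K A = (\<integral>\<^sup>+x. killed t (indicator A) x \<partial>\<mu>)"
      using K[OF ind] A by simp
    moreover have "emeasure (killed_occupation (jump_flux \<mu>) t) A =
        (\<integral>\<^sup>+s. indicator {0..t} s * (\<integral>\<^sup>+x. killed s (indicator A) x \<partial>jump_flux \<mu>) \<partial>lborel)"
      using A by (simp add: killed_occupation_def
          flip: nn_integral_occupation(2)[OF sets_flux(1) finite_flux(1) ind])
    moreover have "emeasure \<mu> A = (\<integral>\<^sup>+x. indicator A x \<partial>\<mu>)"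
      using A sets_mu by simp
    moreover have "indicator A x \<le> (1::ennreal)" for x by (simp add: indicator_def)
    ultimately show "emeasure ?K A + emeasure (killed_occupation (jump_flux \<mu>) t) A =
        emeasure \<mu> A + emeasure (null_measure N) A"
      using bounded[OF ind] by simp
  qed (simp_all add: killed_occupation_def)
  then show ?thesis
    by (simp add: K[OF g] nn_integral_occupation(2)[OF sets_flux(1) finite_flux(1) g])
qed

end

section \<open>Iterated jumps\<close>

context flow_with_rate
begin

text \<open>If \<open>u s y\<close> is the value of being at \<open>y\<close> at time \<open>s\<close> just after a jump, then
  \<open>first_jump u s y\<close> is the expected value, seen from \<open>(s, y)\<close>, at the next jump.\<close>

definition first_jump :: "(real \<Rightarrow> 'a \<Rightarrow> ennreal) \<Rightarrow> real \<Rightarrow> 'a \<Rightarrow> ennreal" where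
  "first_jump u s y = (\<integral>\<^sup>+r. indicator {0..} r * killed r (jump (u (s + r))) y \<partial>lborel)"

text \<open>\<open>jumps t f k s y\<close> stands for the expectation of \<open>f\<close> at time
  \<open>t\<close> on the event of exactly \<open>k\<close> jumps between \<open>s\<close> and
  \<open>t\<close>, starting from \<open>y\<close> at time \<open>s\<close>. The indicator makes it
  vanish for \<open>s > t\<close>, so that \<open>first_jump\<close> may integrate over all
  nonnegative delays.\<close>

primrec jumps :: "real \<Rightarrow> ('a \<Rightarrow> ennreal) \<Rightarrow> nat \<Rightarrow> real \<Rightarrow> 'a \<Rightarrow> ennreal" where
  "jumps t f 0 = (\<lambda>s y. indicator {..t} s * killed (t - s) f y)"
| "jumps t f (Suc k) = first_jump (jumps t f k)"

abbreviation jointly_measurable :: "(real \<Rightarrow> 'a \<Rightarrow> ennreal) \<Rightarrow> bool" where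
  "jointly_measurable u \<equiv> (\<lambda>p. u (fst p) (snd p)) \<in> borel_measurable (borel \<Otimes>\<^sub>M N)"

lemma curried_measurable:
  assumes "jointly_measurable u"
    and "f \<in> borel_measurable A" "h \<in> A \<rightarrow>\<^sub>M N"
  shows "(\<lambda>a. u (f a) (h a)) \<in> borel_measurable A"
  using measurable_compose[OF measurable_Pair[OF assms(2,3)] assms(1)] by simp

lemma jump_kernel_measurable:
  assumes u: "jointly_measurable u"
    and [measurable]: "f \<in> borel_measurable A" "h \<in> A \<rightarrow>\<^sub>M N"
  shows "(\<lambda>a. jump (u (f a)) (h a)) \<in> borel_measurable A"
proof (rule jump_measurable)
  show "(\<lambda>p. u (f (fst p)) (snd p)) \<in> borel_measurable (A \<Otimes>\<^sub>M N)"
    by (rule curried_measurable[OF u]) measurable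
qed measurable

lemma killed_jump_measurable:
  assumes u: "jointly_measurable u"
    and [measurable]: "r \<in> borel_measurable A" "f \<in> borel_measurable A" "h \<in> A \<rightarrow>\<^sub>M N"
  shows "(\<lambda>a. killed (r a) (jump (u (f a))) (h a)) \<in> borel_measurable A"
proof (rule killed_measurable)
  show "(\<lambda>p. jump (u (f (fst p))) (snd p)) \<in> borel_measurable (A \<Otimes>\<^sub>M N)"
    by (rule jump_kernel_measurable[OF u]) measurable
qed measurable

lemma first_jump_measurable:
  assumes u: "jointly_measurable u"
  shows "jointly_measurable (first_jump u)"
proof -
  have [measurable]: "(\<lambda>q. killed (snd q) (jump (u (fst (fst q) + snd q))) (snd (fst q)))
      \<in> borel_measurable ((borel \<Otimes>\<^sub>M N) \<Otimes>\<^sub>M borel)"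
    by (rule killed_jump_measurable[OF u]) measurable
  show ?thesis unfolding first_jump_def by measurable
qed

lemma jumps_measurable:
  assumes [measurable]: "f \<in> borel_measurable N"
  shows "jointly_measurable (jumps t f k)"
  by (induction k) (auto intro: first_jump_measurable)

lemma jumps_eq_0: "t < s \<Longrightarrow> jumps t f k s = (\<lambda>_. 0)"
proof (induction k arbitrary: s)
  case (Suc k)
  have *: "indicator {0..} r * killed r (jump (jumps t f k (s + r))) y = 0" for r y
    using Suc by (cases "r \<ge> 0") (auto simp: jump_def killed_def)
  show ?case unfolding jumps.simps first_jump_def * by simp
qed auto

end

context forward_equation
begin

text \<open>Integrating \<open>u s\<close> against \<open>jump_flux \<mu>\<close> is integrating
  \<open>jump (u s)\<close> against \<open>\<mu>\<close>, and \<open>killed_equation\<close> up to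
  time \<open>s\<close> splits the latter by the last jump before \<open>s\<close>: either none
  since time 0, or one at an earlier time, described by \<open>jump_flux \<mu>\<close>. Reordering
  by the earlier time produces \<open>first_jump\<close> in both terms.\<close>

lemma first_jump_equation:
  assumes u: "jointly_measurable u"
    and u0: "\<And>s. t < s \<Longrightarrow> u s = (\<lambda>_. 0)"
  shows "(\<integral>\<^sup>+s. indicator {0..t} s * (\<integral>\<^sup>+x. u s x \<partial>jump_flux \<mu>) \<partial>lborel) =
    (\<integral>\<^sup>+x. first_jump u 0 x \<partial>\<mu>) +
    (\<integral>\<^sup>+s. indicator {0..t} s * (\<integral>\<^sup>+x. first_jump u s x \<partial>jump_flux \<mu>) \<partial>lborel)"
proof -
  note [measurable_cong] = sets_mu sets_flux
  interpret finite_measure \<mu> by (rule finite_flux)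
  interpret jf: finite_measure "jump_flux \<mu>" by (rule finite_flux)
  have kj1 [measurable]: "(\<lambda>p. killed (fst p) (jump (u (fst p))) (snd p)) \<in> borel_measurable (borel \<Otimes>\<^sub>M \<mu>)"
    by (rule killed_jump_measurable[OF u]) measurable
  have kj2 [measurable]: "(\<lambda>q. killed (snd (fst q)) (jump (u (fst (fst q)))) (snd q))
      \<in> borel_measurable ((borel \<Otimes>\<^sub>M borel) \<Otimes>\<^sub>M jump_flux \<mu>)"
    by (rule killed_jump_measurable[OF u]) measurable
  have kj3 [measurable]: "(\<lambda>p. killed (fst p) (jump (u (s + fst p))) (snd p))
      \<in> borel_measurable (borel \<Otimes>\<^sub>M jump_flux \<mu>)" for s
    by (rule killed_jump_measurable[OF u]) measurable
  have kj: "(\<lambda>x. killed r (jump (u s)) x) \<in> borel_measurable N" for r s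
    by (rule killed_jump_measurable[OF u]) measurable
  define h where "h s r = (\<integral>\<^sup>+x. killed r (jump (u s)) x \<partial>jump_flux \<mu>)" for s r
  have h [measurable]: "(\<lambda>(s, r). h s r) \<in> borel_measurable (borel \<Otimes>\<^sub>M borel)"
    unfolding h_def split_beta' by measurable
  have zero: "killed r (jump (u s)) x = 0" if "t < s" for r s x
    using u0[OF that] by (simp add: killed_def jump_def)
  have one: "(\<integral>\<^sup>+x. u s x \<partial>jump_flux \<mu>) = (\<integral>\<^sup>+x. killed s (jump (u s)) x \<partial>\<mu>) +
      (\<integral>\<^sup>+r. indicator {0..s} r * h s r \<partial>lborel)" if s: "0 \<le> s" for s
  proof -
    have us: "u s \<in> borel_measurable N" by (rule curried_measurable[OF u]) measurable
    have "jump (u s) \<in> borel_measurable N" by (rule jump_kernel_measurable[OF u]) measurable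
    from killed_equation[OF this s] show ?thesis
      unfolding h_def nn_integral_jump_flux[OF sets_mu us] by simp
  qed
  \<comment> \<open>The integrand vanishes for times after \<open>t\<close>, so the bounded range of
    integration may be replaced by the half-line in \<open>first_jump\<close>.\<close>
  have first: "(\<integral>\<^sup>+s. indicator {0..t} s * (\<integral>\<^sup>+x. killed s (jump (u s)) x \<partial>\<mu>) \<partial>lborel) =
      (\<integral>\<^sup>+x. first_jump u 0 x \<partial>\<mu>)"
  proof -
    have "(\<integral>\<^sup>+s. indicator {0..t} s * (\<integral>\<^sup>+x. killed s (jump (u s)) x \<partial>\<mu>) \<partial>lborel) =
        (\<integral>\<^sup>+s. (\<integral>\<^sup>+x. indicator {0..t} s * killed s (jump (u s)) x \<partial>\<mu>) \<partial>lborel)"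
      by (intro nn_integral_cong nn_integral_cmult[symmetric]) (use kj sets_mu in measurable)
    also have "\<dots> = (\<integral>\<^sup>+x. (\<integral>\<^sup>+s. indicator {0..t} s * killed s (jump (u s)) x \<partial>lborel) \<partial>\<mu>)"
      by (rule nn_integral_lborel_swap[OF finite_flux(3)]) (simp add: split_beta', measurable)
    also have "\<dots> = (\<integral>\<^sup>+x. first_jump u 0 x \<partial>\<mu>)"
    proof (rule nn_integral_cong)
      fix x
      have "indicator {0..t} s * killed s (jump (u s)) x =
          indicator {0..} s * killed s (jump (u (0 + s))) x" for s
        using zero[of s s x] by (cases "s \<le> t") (auto simp: indicator_def)
      then show "(\<integral>\<^sup>+s. indicator {0..t} s * killed s (jump (u s)) x \<partial>lborel) = first_jump u 0 x"
        unfolding first_jump_def by simp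
    qed
    finally show ?thesis .
  qed
  have second: "(\<integral>\<^sup>+r. indicator {0..t - s} r * h (s + r) r \<partial>lborel) =
      (\<integral>\<^sup>+x. first_jump u s x \<partial>jump_flux \<mu>)" for s
  proof -
    have "(\<integral>\<^sup>+r. indicator {0..t - s} r * h (s + r) r \<partial>lborel) =
        (\<integral>\<^sup>+r. (\<integral>\<^sup>+x. indicator {0..t - s} r * killed r (jump (u (s + r))) x \<partial>jump_flux \<mu>) \<partial>lborel)"
      unfolding h_def
      by (intro nn_integral_cong nn_integral_cmult[symmetric]) (use kj in measurable)
    also have "\<dots> =
        (\<integral>\<^sup>+x. (\<integral>\<^sup>+r. indicator {0..t - s} r * killed r (jump (u (s + r))) x \<partial>lborel) \<partial>jump_flux \<mu>)"
      by (rule nn_integral_lborel_swap[OF finite_flux(1)]) (simp add: split_beta', measurable)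
    also have "\<dots> = (\<integral>\<^sup>+x. first_jump u s x \<partial>jump_flux \<mu>)"
    proof (rule nn_integral_cong)
      fix x
      have "indicator {0..t - s} r * killed r (jump (u (s + r))) x =
          indicator {0..} r * killed r (jump (u (s + r))) x" for r
        using zero[of "s + r" r x] by (cases "s + r \<le> t") (auto simp: indicator_def)
      then show "(\<integral>\<^sup>+r. indicator {0..t - s} r * killed r (jump (u (s + r))) x \<partial>lborel) = first_jump u s x"
        unfolding first_jump_def by simp
    qed
    finally show ?thesis .
  qed
  have "(\<integral>\<^sup>+s. indicator {0..t} s * (\<integral>\<^sup>+x. u s x \<partial>jump_flux \<mu>) \<partial>lborel) =
      (\<integral>\<^sup>+s. indicator {0..t} s * (\<integral>\<^sup>+x. killed s (jump (u s)) x \<partial>\<mu>) +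
        indicator {0..t} s * (\<integral>\<^sup>+r. indicator {0..s} r * h s r \<partial>lborel) \<partial>lborel)"
  proof (rule nn_integral_cong)
    fix s
    show "indicator {0..t} s * (\<integral>\<^sup>+x. u s x \<partial>jump_flux \<mu>) =
      indicator {0..t} s * (\<integral>\<^sup>+x. killed s (jump (u s)) x \<partial>\<mu>) +
        indicator {0..t} s * (\<integral>\<^sup>+r. indicator {0..s} r * h s r \<partial>lborel)"
    proof (cases "s \<in> {0..t}")
      case True
      then have "indicator {0..t} s = (1::ennreal)" "0 \<le> s" by auto
      then show ?thesis by (simp only: mult_1_left one)
    qed simp
  qed
  also have "\<dots> = (\<integral>\<^sup>+s. indicator {0..t} s * (\<integral>\<^sup>+x. killed s (jump (u s)) x \<partial>\<mu>) \<partial>lborel) +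
      (\<integral>\<^sup>+s. indicator {0..t} s * (\<integral>\<^sup>+r. indicator {0..s} r * h s r \<partial>lborel) \<partial>lborel)"
    by (rule nn_integral_add) measurable
  also have "(\<integral>\<^sup>+s. indicator {0..t} s * (\<integral>\<^sup>+r. indicator {0..s} r * h s r \<partial>lborel) \<partial>lborel) =
      (\<integral>\<^sup>+s. indicator {0..t} s * (\<integral>\<^sup>+r. indicator {0..t - s} r * h (s + r) r \<partial>lborel) \<partial>lborel)"
    by (rule nn_integral_triangle_shift[OF h])
  finally show ?thesis unfolding first second .
qed

text \<open>Stage 0 is \<open>killed_equation\<close> with time reversed:
  \<open>killed (t - s)\<close> accounts for states whose last jump was at time \<open>s\<close>. At
  each stage \<open>first_jump_equation\<close> splits the remainder into the term with one more
  jump from time 0 and the next remainder.\<close>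

lemma jumps_equation:
  assumes f[measurable]: "f \<in> borel_measurable N" and t: "0 \<le> t"
  shows "(\<integral>\<^sup>+x. f x \<partial>\<mu>) = (\<Sum>k\<le>n. \<integral>\<^sup>+x. jumps t f k 0 x \<partial>\<mu>) +
    (\<integral>\<^sup>+s. indicator {0..t} s * (\<integral>\<^sup>+x. jumps t f n s x \<partial>jump_flux \<mu>) \<partial>lborel)"
proof (induction n)
  case 0
  note [measurable_cong] = sets_mu sets_flux
  interpret jf: finite_measure "jump_flux \<mu>" by (rule finite_flux)
  have "(\<integral>\<^sup>+s. indicator {0..t} s * (\<integral>\<^sup>+x. jumps t f 0 s x \<partial>jump_flux \<mu>) \<partial>lborel) =
      (\<integral>\<^sup>+s. indicator {0..t} s * (\<integral>\<^sup>+x. killed (t - s) f x \<partial>jump_flux \<mu>) \<partial>lborel)"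
    by (intro nn_integral_cong indicator_mult_cong) simp
  also have "\<dots> = (\<integral>\<^sup>+s. indicator {0..t} s * (\<integral>\<^sup>+x. killed s f x \<partial>jump_flux \<mu>) \<partial>lborel)"
    by (rule nn_integral_reflect_Icc[where f = "\<lambda>s. \<integral>\<^sup>+x. killed s f x \<partial>jump_flux \<mu>"]) measurable
  finally show ?case using killed_equation[OF f t] t by simp
next
  case (Suc n)
  have "(\<integral>\<^sup>+s. indicator {0..t} s * (\<integral>\<^sup>+x. jumps t f n s x \<partial>jump_flux \<mu>) \<partial>lborel) =
    (\<integral>\<^sup>+x. jumps t f (Suc n) 0 x \<partial>\<mu>) +
    (\<integral>\<^sup>+s. indicator {0..t} s * (\<integral>\<^sup>+x. jumps t f (Suc n) s x \<partial>jump_flux \<mu>) \<partial>lborel)"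
    unfolding jumps.simps(2) by (rule first_jump_equation[OF jumps_measurable[OF f] jumps_eq_0])
  then show ?case using Suc by (simp add: add.assoc)
qed

text \<open>Nonnegativity of the remainder bounds all partial sums. No claim is made that the
  remainder tends to 0, hence the inequality.\<close>

lemma suminf_jumps_le:
  assumes f[measurable]: "f \<in> borel_measurable N" and t: "0 \<le> t"
  shows "(\<integral>\<^sup>+x. (\<Sum>k. jumps t f k 0 x) \<partial>\<mu>) \<le> (\<integral>\<^sup>+x. f x \<partial>\<mu>)"
proof -
  note [measurable_cong] = sets_mu
  have [measurable]: "(\<lambda>x. jumps t f k 0 x) \<in> borel_measurable N" for k
    by (rule curried_measurable[OF jumps_measurable[OF f]]) measurable
  have "(\<integral>\<^sup>+x. (\<Sum>k. jumps t f k 0 x) \<partial>\<mu>) = (\<Sum>k. \<integral>\<^sup>+x. jumps t f k 0 x \<partial>\<mu>)"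
    by (rule nn_integral_suminf) measurable
  also have "\<dots> \<le> (\<integral>\<^sup>+x. f x \<partial>\<mu>)"
  proof (rule suminf_le_const[OF summableI])
    fix n
    have "(\<Sum>k<n. \<integral>\<^sup>+x. jumps t f k 0 x \<partial>\<mu>) \<le> (\<Sum>k\<le>n. \<integral>\<^sup>+x. jumps t f k 0 x \<partial>\<mu>)"
      by (intro sum_mono2) auto
    also have "\<dots> \<le> (\<integral>\<^sup>+x. f x \<partial>\<mu>)" using jumps_equation[OF f t, of n] by simp
    finally show "(\<Sum>k<n. \<integral>\<^sup>+x. jumps t f k 0 x \<partial>\<mu>) \<le> (\<integral>\<^sup>+x. f x \<partial>\<mu>)" .
  qed
  finally show ?thesis .
qed

end

section \<open>The law of the process\<close>

abbreviation std_exponential :: "real measure" where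
  "std_exponential \<equiv> density lborel (exponential_density 1)"

text \<open>Open half-lines match the strict inequality in the definition of the jump times; the end
  point is a null set.\<close>

lemma emeasure_exponential_lessThan:
  assumes "0 \<le> a"
  shows "emeasure std_exponential {..<a} = ennreal (1 - exp (- a))"
proof -
  have "emeasure std_exponential {..<a} =
      emeasure std_exponential {..a}"
    by (subst (1 2) emeasure_density)
      (auto intro!: nn_integral_cong_AE eventually_mono[OF AE_lborel_singleton[of a]]
        simp: indicator_def)
  also have "\<dots> = ennreal (1 - exp (- a))"
    using emeasure_erlang_density[of 1 0 a] assms by (simp add: erlang_CDF_0)
  finally show ?thesis .
qed

locale jump_process = flow_with_rate +
  fixes \<phi> :: "real \<Rightarrow> 'a \<Rightarrow> 'a" and G :: "'a \<Rightarrow> real \<Rightarrow> 'a"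
  assumes flow_eq: "0 \<le> s \<Longrightarrow> \<phi> s = \<psi> s"
    and G_meas: "(\<lambda>(x, u). G x u) \<in> N \<Otimes>\<^sub>M unit_uniform \<rightarrow>\<^sub>M N"
    and G_law: "x \<in> space N \<Longrightarrow> A \<in> sets N \<Longrightarrow>
      emeasure (Q x) A = emeasure unit_uniform {u \<in> {0..1}. G x u \<in> A}"
begin

abbreviation "skel \<equiv> skeleton \<phi> l G"

lemma next_jump_eq:
  assumes "y \<in> space N"
  shows "next_jump \<phi> l S y e = Inf {ereal t | t. S \<le> t \<and> e < \<Lambda> (t - S) y}"
proof -
  have "(LBINT s:{S..t}. l (\<phi> (s - S) y)) = \<Lambda> (t - S) y" for t
  proof -
    have "(LBINT s:{S..t}. l (\<phi> (s - S) y)) = (LBINT s. indicator {S..t} (S + 1 * s) *\<^sub>R l (\<phi> (S + 1 * s - S) y))"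
      unfolding set_lebesgue_integral_def
      by (subst lborel_integral_real_affine[where c = 1 and t = S]) simp_all
    also have "\<dots> = \<Lambda> (t - S) y"
      unfolding \<Lambda>_def set_lebesgue_integral_def
      by (intro Bochner_Integration.integral_cong) (auto simp: indicator_def flow_eq)
    finally show ?thesis .
  qed
  then show ?thesis unfolding next_jump_def by simp
qed

text \<open>Monotonicity of the cumulative rate gives one direction. For the other, continuity lets
  the strict inequality survive slightly before \<open>r\<close>, which puts the infimum strictly
  below \<open>r\<close>. The equivalence replaces an infimum over uncountably many times by a
  measurable condition.\<close>

lemma next_jump_less:
  assumes y: "y \<in> space N"
  shows "next_jump \<phi> l S y e < ereal r \<longleftrightarrow> S < r \<and> e < \<Lambda> (r - S) y"
proof
  assume "next_jump \<phi> l S y e < ereal r"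
  then obtain t where t: "S \<le> t" "e < \<Lambda> (t - S) y" "t < r"
    unfolding next_jump_eq[OF y] Inf_less_iff by auto
  then show "S < r \<and> e < \<Lambda> (r - S) y"
    using cumulative_rate_mono[OF y, of "t - S" "r - S"] by auto
next
  assume *: "S < r \<and> e < \<Lambda> (r - S) y"
  have "((\<lambda>s. \<Lambda> s y) \<longlongrightarrow> \<Lambda> (r - S) y) (at (r - S) within {0..})"
    using cumulative_rate_continuous[OF y] * by (auto simp: continuous_on_def)
  then have "((\<lambda>s. \<Lambda> s y) \<longlongrightarrow> \<Lambda> (r - S) y) (at_left (r - S))"
    using * by (simp add: at_within_interior[of "r - S" "{0..}"] filterlim_at_split)
  then have "\<forall>\<^sub>F s in at_left (r - S). e < \<Lambda> s y" using * by (intro order_tendstoD) auto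
  moreover have "\<forall>\<^sub>F s in at_left (r - S). 0 < s \<and> s < r - S"
    using eventually_at_left_real[of 0 "r - S"] * by simp
  ultimately have "\<forall>\<^sub>F s in at_left (r - S). e < \<Lambda> s y \<and> 0 < s \<and> s < r - S"
    by eventually_elim simp
  then obtain s where s: "e < \<Lambda> s y" "0 < s" "s < r - S"
    using eventually_happens'[OF trivial_limit_at_left_real] by blast
  have "next_jump \<phi> l S y e \<le> ereal (S + s)"
    unfolding next_jump_eq[OF y] using s by (intro Inf_lower) auto
  also have "\<dots> < ereal r" using s by simp
  finally show "next_jump \<phi> l S y e < ereal r" .
qed

lemma next_jump_ge: "ereal S \<le> next_jump \<phi> l S y e"
  unfolding next_jump_def by (auto intro!: Inf_greatest)

lemma next_jump_measurable [measurable (raw)]: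
  assumes [measurable]: "S \<in> borel_measurable A" "y \<in> A \<rightarrow>\<^sub>M N" "e \<in> borel_measurable A"
  shows "(\<lambda>a. next_jump \<phi> l (S a) (y a) (e a)) \<in> borel_measurable A"
proof (rule borel_measurableI_less)
  have real: "{a \<in> space A. next_jump \<phi> l (S a) (y a) (e a) < ereal r} \<in> sets A" for r
  proof -
    have "{a \<in> space A. next_jump \<phi> l (S a) (y a) (e a) < ereal r} =
        {a \<in> space A. S a < r \<and> e a < \<Lambda> (r - S a) (y a)}"
      using measurable_space[OF assms(2)] by (auto simp: next_jump_less)
    also have "\<dots> \<in> sets A" by measurable
    finally show ?thesis .
  qed
  fix c :: ereal
  show "{a \<in> space A. next_jump \<phi> l (S a) (y a) (e a) < c} \<in> sets A"
  proof (cases c)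
    case PInf
    have "{a \<in> space A. next_jump \<phi> l (S a) (y a) (e a) < \<infinity>} =
        (\<Union>n::nat. {a \<in> space A. next_jump \<phi> l (S a) (y a) (e a) < ereal (real n)})"
      by (auto simp: less_PInf_Ex_of_nat)
    then show ?thesis using real PInf by auto
  qed (auto simp: real)
qed

text \<open>Both sides integrate \<open>h\<close> against a measure on the line,
  \<open>\<alpha>\<close> and \<open>\<beta>\<close>, and these agree on all half-lines
  \<open>{..<x}\<close> by \<open>next_jump_less\<close> and the distribution function of the
  exponential law. Draws without a further jump are discarded on the left and appear as missing mass
  of the density on the right.\<close>

lemma next_jump_law:
  assumes y: "y \<in> space N" and h[measurable]: "h \<in> borel_measurable borel"
  shows "(\<integral>\<^sup>+e. (if next_jump \<phi> l S y e = \<infinity> then 0 else h (real_of_ereal (next_jump \<phi> l S y e)))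
        \<partial>std_exponential) =
      (\<integral>\<^sup>+r. indicator {0..} r * (ennreal (l (\<psi> r y) * exp (- \<Lambda> r y)) * h (S + r)) \<partial>lborel)"
proof -
  let ?E = "std_exponential"
  let ?T = "next_jump \<phi> l S y"
  have [measurable]: "?T \<in> borel_measurable borel" by (rule next_jump_measurable) (use y in auto)
  have [measurable]: "(\<lambda>r. l (\<psi> r y)) \<in> borel_measurable borel" "(\<lambda>r. \<Lambda> r y) \<in> borel_measurable borel"
    using y by measurable
  interpret E: prob_space ?E by (rule prob_space_exponential_density) simp
  define \<alpha> where "\<alpha> = distr (density ?E (\<lambda>e. if ?T e = \<infinity> then 0 else 1)) borel (\<lambda>e. real_of_ereal (?T e))"
  define \<beta> where "\<beta> = distr (density lborel (\<lambda>r. indicator {0..} r * ennreal (l (\<psi> r y) * exp (- \<Lambda> r y))))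
      borel (\<lambda>r. S + r)"
  have T_real: "real_of_ereal (?T e) < x \<longleftrightarrow> ?T e < ereal x" if "?T e \<noteq> \<infinity>" for e x
    using next_jump_ge[of S y e] that by (cases "?T e") auto
  have a: "emeasure \<alpha> {..<x} = (if S < x then ennreal (1 - exp (- \<Lambda> (x - S) y)) else 0)" for x
  proof -
    have "emeasure \<alpha> {..<x} = (\<integral>\<^sup>+z. indicator {..<x} z \<partial>\<alpha>)"
      by (simp add: \<alpha>_def)
    also have "\<dots> = (\<integral>\<^sup>+e. (if ?T e = \<infinity> then 0 else 1) * indicator {..<x} (real_of_ereal (?T e)) \<partial>?E)"
      unfolding \<alpha>_def by (subst nn_integral_distr, measurable, subst nn_integral_density) measurable
    also have "\<dots> = (\<integral>\<^sup>+e. indicator {e. ?T e < ereal x} e \<partial>?E)"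
      by (intro nn_integral_cong) (use T_real in \<open>auto simp: indicator_def\<close>)
    also have "\<dots> = (\<integral>\<^sup>+e. (if S < x then indicator {..<\<Lambda> (x - S) y} e else 0) \<partial>?E)"
      by (intro nn_integral_cong) (auto simp: indicator_def next_jump_less[OF y])
    also have "\<dots> = (if S < x then emeasure ?E {..<\<Lambda> (x - S) y} else 0)"
      by simp
    also have "\<dots> = (if S < x then ennreal (1 - exp (- \<Lambda> (x - S) y)) else 0)"
      using cumulative_rate_mono[OF y, of 0 "x - S"] cumulative_rate_0[OF y]
        emeasure_exponential_lessThan[of "\<Lambda> (x - S) y"] by auto
    finally show ?thesis .
  qed
  have b: "emeasure \<beta> {..<x} = (if S < x then ennreal (1 - exp (- \<Lambda> (x - S) y)) else 0)" for x
  proof -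
    have "emeasure \<beta> {..<x} = (\<integral>\<^sup>+z. indicator {..<x} z \<partial>\<beta>)"
      by (simp add: \<beta>_def)
    also have "\<dots> = (\<integral>\<^sup>+r. indicator {0..} r * ennreal (l (\<psi> r y) * exp (- \<Lambda> r y)) *
        indicator {..<x} (S + r) \<partial>lborel)"
      unfolding \<beta>_def by (subst nn_integral_distr, measurable, subst nn_integral_density) measurable
    also have "\<dots> = (\<integral>\<^sup>+r. (if S < x then indicator {0..x - S} r * ennreal (l (\<psi> r y) * exp (- \<Lambda> r y)) else 0) \<partial>lborel)"
      by (intro nn_integral_cong_AE eventually_mono[OF AE_lborel_singleton[of "x - S"]])
        (auto simp: indicator_def)
    also have "\<dots> = (if S < x then ennreal (1 - exp (- \<Lambda> (x - S) y)) else 0)"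
      using nn_integral_exp_rate(1)[OF y, of "x - S"] by auto
    finally show ?thesis .
  qed
  have "\<alpha> = \<beta>"
  proof (rule measure_eqI_generator_eq[where E = "range lessThan" and \<Omega> = UNIV and A = "\<lambda>n. {..<real n}"])
    show "Int_stable (range lessThan :: real set set)"
    proof (clarsimp simp: Int_stable_def)
      show "{..<a} \<inter> {..<b} \<in> range lessThan" for a b :: real
        by (rule range_eqI[of _ _ "min a b"]) auto
    qed
    show "sets \<alpha> = sigma_sets UNIV (range lessThan)" "sets \<beta> = sigma_sets UNIV (range lessThan)"
      unfolding \<alpha>_def \<beta>_def by (simp_all add: borel_Iio)
    show "(\<Union>n. {..<real n}) = UNIV" using reals_Archimedean2 by auto
    show "emeasure \<alpha> {..<real n} \<noteq> \<infinity>" for n by (simp add: a)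
  qed (auto simp: a b)
  have "(\<integral>\<^sup>+e. (if ?T e = \<infinity> then 0 else h (real_of_ereal (?T e))) \<partial>?E) = (\<integral>\<^sup>+x. h x \<partial>\<alpha>)"
    unfolding \<alpha>_def by (subst nn_integral_distr, measurable, subst nn_integral_density)
      (auto intro!: nn_integral_cong)
  also have "\<dots> = (\<integral>\<^sup>+r. indicator {0..} r * (ennreal (l (\<psi> r y) * exp (- \<Lambda> r y)) * h (S + r)) \<partial>lborel)"
    unfolding \<open>\<alpha> = \<beta>\<close> \<beta>_def by (subst nn_integral_distr, measurable, subst nn_integral_density)
      (auto intro!: nn_integral_cong simp: mult.assoc)
  finally show ?thesis .
qed

lemma next_jump_survival:
  assumes y: "y \<in> space N" and "S \<le> t"
  shows "emeasure std_exponential {e. ereal t < next_jump \<phi> l S y e} =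
    ennreal (exp (- \<Lambda> (t - S) y))"
proof -
  let ?E = "std_exponential"
  let ?T = "next_jump \<phi> l S y"
  have [measurable]: "?T \<in> borel_measurable borel" by (rule next_jump_measurable) (use y in auto)
  interpret E: prob_space ?E by (rule prob_space_exponential_density) simp
  have nonneg: "0 \<le> \<Lambda> (t - S) y"
    using cumulative_rate_mono[OF y, of 0 "t - S"] cumulative_rate_0[OF y] assms(2) by simp
  have "emeasure ?E {e. ?T e \<le> ereal t} = (\<integral>\<^sup>+e. indicator {e. ?T e \<le> ereal t} e \<partial>?E)"
    by simp
  also have "\<dots> = (\<integral>\<^sup>+e. (if ?T e = \<infinity> then 0 else indicator {..t} (real_of_ereal (?T e))) \<partial>?E)"
  proof (rule nn_integral_cong)
    fix e
    show "indicator {e. ?T e \<le> ereal t} e =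
        (if ?T e = \<infinity> then 0 else indicator {..t} (real_of_ereal (?T e)) :: ennreal)"
      using next_jump_ge[of S y e] by (cases "?T e") (auto simp: indicator_def)
  qed
  also have "\<dots> = (\<integral>\<^sup>+r. indicator {0..} r * (ennreal (l (\<psi> r y) * exp (- \<Lambda> r y)) * indicator {..t} (S + r)) \<partial>lborel)"
    by (rule next_jump_law[OF y]) simp
  also have "\<dots> = (\<integral>\<^sup>+r. indicator {0..t - S} r * ennreal (l (\<psi> r y) * exp (- \<Lambda> r y)) \<partial>lborel)"
    by (intro nn_integral_cong) (auto simp: indicator_def)
  also have "\<dots> = ennreal (1 - exp (- \<Lambda> (t - S) y))"
    using nn_integral_exp_rate(1)[OF y, of "t - S"] assms(2) by simp
  finally have le: "emeasure ?E {e. ?T e \<le> ereal t} = ennreal (1 - exp (- \<Lambda> (t - S) y))" .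
  have "{e. ereal t < ?T e} = space ?E - {e. ?T e \<le> ereal t}" by auto
  then have "emeasure ?E {e. ereal t < ?T e} = emeasure ?E (space ?E) - emeasure ?E {e. ?T e \<le> ereal t}"
    by (simp only:) (rule emeasure_compl, simp_all add: le)
  also have "\<dots> = ennreal 1 - ennreal (1 - exp (- \<Lambda> (t - S) y))"
    unfolding le E.emeasure_space_1 by simp
  also have "\<dots> = ennreal (exp (- \<Lambda> (t - S) y))"
    using nonneg by (subst ennreal_minus) auto
  finally show ?thesis .
qed

end

section \<open>The i.i.d. noise and the independence of its coordinates\<close>

lemma prob_space_unit_uniform: "prob_space unit_uniform"
  unfolding unit_uniform_def
  by (rule prob_spaceI) (simp add: emeasure_restrict_space space_restrict_space)

lemma space_unit_uniform: "space unit_uniform = {0..1}"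
  by (simp add: unit_uniform_def space_restrict_space)

definition noise_step :: "(real \<times> real) measure" where
  "noise_step = std_exponential \<Otimes>\<^sub>M unit_uniform"

lemma noise_eq_PiM: "noise = Pi\<^sub>M UNIV (\<lambda>_. noise_step)"
  unfolding noise_def noise_step_def ..

lemma prob_space_noise_step: "prob_space noise_step"
  unfolding noise_step_def
  by (intro prob_space_pair prob_space_exponential_density prob_space_unit_uniform) simp

lemma prob_space_noise: "prob_space noise"
  unfolding noise_eq_PiM by (intro prob_space_PiM prob_space_noise_step)

text \<open>Independence of coordinate \<open>k\<close> from the earlier ones. Splicing the first
  \<open>k\<close> coordinates of one sequence with a second, independent sequence preserves the
  product law; \<open>Z\<close> then sees only the first sequence, and coordinate \<open>k\<close>
  is the initial coordinate of the second.\<close>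

lemma nn_integral_noise_split:
  assumes Z: "Z \<in> noise \<rightarrow>\<^sub>M A" and past: "\<And>w w'. (\<And>j. j < k \<Longrightarrow> w j = w' j) \<Longrightarrow> Z w = Z w'"
    and H: "(\<lambda>p. H (fst p) (snd p)) \<in> borel_measurable (A \<Otimes>\<^sub>M noise_step)"
  shows "(\<integral>\<^sup>+w. H (Z w) (w k) \<partial>noise) = (\<integral>\<^sup>+w. (\<integral>\<^sup>+z. H (Z w) z \<partial>noise_step) \<partial>noise)"
proof -
  interpret step: prob_space noise_step by (rule prob_space_noise_step)
  interpret seq: sequence_space noise_step ..
  interpret noise: prob_space noise by (rule prob_space_noise)
  have comp [measurable]: "(\<lambda>w. w i) \<in> noise \<rightarrow>\<^sub>M noise_step" for i
    unfolding noise_eq_PiM by (rule measurable_component_singleton) simp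
  have [measurable]: "(\<lambda>(w, w'). comb_seq k w w') \<in> noise \<Otimes>\<^sub>M noise \<rightarrow>\<^sub>M noise"
    unfolding noise_eq_PiM by (rule measurable_comb_seq)
  note Z [measurable]
  have [measurable]: "(\<lambda>w. H (Z w) (w k)) \<in> borel_measurable noise"
    using measurable_compose[OF measurable_Pair[OF Z comp[of k]] H] by simp
  have Hpair: "(\<lambda>p. H (Z (fst p)) (snd p 0)) \<in> borel_measurable (noise \<Otimes>\<^sub>M noise)"
  proof -
    have "(\<lambda>p. (Z (fst p), snd p 0)) \<in> noise \<Otimes>\<^sub>M noise \<rightarrow>\<^sub>M A \<Otimes>\<^sub>M noise_step" by measurable
    from measurable_compose[OF this H] show ?thesis by simp
  qed
  have distr: "distr (noise \<Otimes>\<^sub>M noise) noise (\<lambda>(w, w'). comb_seq k w w') = noise"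
    unfolding noise_eq_PiM by (rule seq.PiM_comb_seq)
  have "(\<integral>\<^sup>+w. H (Z w) (w k) \<partial>noise) =
      (\<integral>\<^sup>+w. H (Z w) (w k) \<partial>distr (noise \<Otimes>\<^sub>M noise) noise (\<lambda>(w, w'). comb_seq k w w'))"
    by (simp only: distr)
  also have "\<dots> = (\<integral>\<^sup>+p. H (Z (fst p)) (snd p 0) \<partial>(noise \<Otimes>\<^sub>M noise))"
  proof (subst nn_integral_distr)
    have "Z (comb_seq k w w') = Z w" for w w'
      by (rule past) (simp add: comb_seq_less)
    moreover have "comb_seq k w w' k = w' 0" for w w' :: "nat \<Rightarrow> real \<times> real"
      using comb_seq_add[of k w w' 0] by simp
    ultimately show "(\<integral>\<^sup>+p. H (Z (case p of (w, w') \<Rightarrow> comb_seq k w w'))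
          ((case p of (w, w') \<Rightarrow> comb_seq k w w') k) \<partial>(noise \<Otimes>\<^sub>M noise)) =
        (\<integral>\<^sup>+p. H (Z (fst p)) (snd p 0) \<partial>(noise \<Otimes>\<^sub>M noise))"
      by (simp add: split_beta')
  qed measurable
  also have "\<dots> = (\<integral>\<^sup>+w. (\<integral>\<^sup>+w'. H (Z w) (w' 0) \<partial>noise) \<partial>noise)"
    by (subst noise.nn_integral_fst[symmetric, OF Hpair]) simp
  also have "\<dots> = (\<integral>\<^sup>+w. (\<integral>\<^sup>+z. H (Z w) z \<partial>noise_step) \<partial>noise)"
  proof (rule nn_integral_cong)
    fix w assume "w \<in> space noise"
    then have "Z w \<in> space A" by (rule measurable_space[OF Z])
    then have *: "(\<lambda>z. H (Z w) z) \<in> borel_measurable noise_step"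
      using measurable_compose[OF measurable_Pair1' H, of "Z w"] by simp
    have "(\<integral>\<^sup>+z. H (Z w) z \<partial>noise_step) = (\<integral>\<^sup>+z. H (Z w) z \<partial>distr noise noise_step (\<lambda>w. w 0))"
      unfolding noise_eq_PiM by (subst distr_PiM_component) (auto intro: prob_space_noise_step)
    also have "\<dots> = (\<integral>\<^sup>+w'. H (Z w) (w' 0) \<partial>noise)"
      using * by (intro nn_integral_distr) measurable
    finally show "(\<integral>\<^sup>+w'. H (Z w) (w' 0) \<partial>noise) = (\<integral>\<^sup>+z. H (Z w) z \<partial>noise_step)" by simp
  qed
  finally show ?thesis .
qed

section \<open>The skeleton as a Markov chain\<close>

context jump_process
begin

lemma G_measurable [measurable (raw)]:
  assumes "f \<in> A \<rightarrow>\<^sub>M N" "g \<in> A \<rightarrow>\<^sub>M unit_uniform"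
  shows "(\<lambda>a. G (f a) (g a)) \<in> A \<rightarrow>\<^sub>M N"
  using measurable_compose[OF measurable_Pair[OF assms] G_meas] by simp

lemma nn_integral_G:
  assumes x: "x \<in> space N" and h[measurable]: "h \<in> borel_measurable N"
  shows "(\<integral>\<^sup>+v. h (G x v) \<partial>unit_uniform) = (\<integral>\<^sup>+y. h y \<partial>Q x)"
proof -
  have sQ: "sets (Q x) = sets N"
    using measurable_space[OF kernel_subprob x] by (simp add: space_subprob_algebra)
  have Gx: "(\<lambda>v. G x v) \<in> unit_uniform \<rightarrow>\<^sub>M N" using x by measurable
  have "Q x = distr unit_uniform N (G x)"
  proof (rule measure_eqI)
    fix A assume "A \<in> sets (Q x)"
    then have A: "A \<in> sets N" using sQ by simp
    have "{u \<in> {0..1}. G x u \<in> A} = G x -` A \<inter> space unit_uniform"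
      by (auto simp: space_unit_uniform)
    then show "emeasure (Q x) A = emeasure (distr unit_uniform N (G x)) A"
      using G_law[OF x A] A Gx by (simp add: emeasure_distr)
  qed (simp add: sQ)
  then show ?thesis using Gx by (simp add: nn_integral_distr)
qed

text \<open>The transition of the skeleton as a function of the current pair and one noise
  coordinate. It is written with \<open>\<psi>\<close> to be jointly measurable and agrees with
  \<open>skeleton\<close> because finite waiting times are nonnegative.\<close>

definition jump_step :: "ereal \<times> 'a \<Rightarrow> real \<times> real \<Rightarrow> ereal \<times> 'a" where
  "jump_step p z =
     (if fst p = \<infinity> then (\<infinity>, snd p)
      else if next_jump \<phi> l (real_of_ereal (fst p)) (snd p) (fst z) = \<infinity> then (\<infinity>, snd p)
      else (next_jump \<phi> l (real_of_ereal (fst p)) (snd p) (fst z),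
        G (\<psi> (real_of_ereal (next_jump \<phi> l (real_of_ereal (fst p)) (snd p) (fst z)) -
          real_of_ereal (fst p)) (snd p)) (snd z)))"

lemma skeleton_Suc: "skel x w (Suc k) = jump_step (skel x w k) (w k)"
proof -
  obtain S y where Sy: "skel x w k = (S, y)" by fastforce
  have "\<phi> (real_of_ereal (next_jump \<phi> l S y e) - S) = \<psi> (real_of_ereal (next_jump \<phi> l S y e) - S)"
    if "next_jump \<phi> l S y e \<noteq> \<infinity>" for S y e
    using next_jump_ge[of S y e] that by (cases "next_jump \<phi> l S y e") (auto intro!: flow_eq)
  then show ?thesis
    by (simp add: Sy jump_step_def Let_def)
qed

lemma jump_step_measurable:
  "(\<lambda>q. jump_step (fst q) (snd q)) \<in> (borel \<Otimes>\<^sub>M N) \<Otimes>\<^sub>M noise_step \<rightarrow>\<^sub>M borel \<Otimes>\<^sub>M N"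
  unfolding jump_step_def noise_step_def by measurable

lemma skeleton_measurable:
  assumes x: "x \<in> space N"
  shows "(\<lambda>w. skel x w k) \<in> noise \<rightarrow>\<^sub>M borel \<Otimes>\<^sub>M N"
proof (induction k)
  case 0
  then show ?case using x by simp
next
  case (Suc k)
  have "(\<lambda>w. w k) \<in> noise \<rightarrow>\<^sub>M noise_step"
    unfolding noise_eq_PiM by (rule measurable_component_singleton) simp
  from measurable_compose[OF measurable_Pair[OF Suc this] jump_step_measurable]
  show ?case by (simp add: skeleton_Suc del: skeleton.simps)
qed

lemma skeleton_past: "(\<And>j. j < k \<Longrightarrow> w j = w' j) \<Longrightarrow> skel x w k = skel x w' k"
  by (induction k) (simp_all add: skeleton_Suc del: skeleton.simps(2))

lemma skeleton_incseq: "incseq (\<lambda>k. fst (skel x w k))"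
  and skeleton_nonneg: "0 \<le> fst (skel x w k)"
proof -
  have mono: "fst p \<le> fst (jump_step p z)" if "0 \<le> fst p" for p z
    using next_jump_ge[of "real_of_ereal (fst p)" "snd p" "fst z"] that
    by (cases "fst p") (auto simp: jump_step_def)
  show nonneg: "0 \<le> fst (skel x w k)" for k
    by (induction k) (auto simp: skeleton_Suc simp del: skeleton.simps(2) intro: order_trans[OF _ mono])
  show "incseq (\<lambda>k. fst (skel x w k))"
    by (rule incseq_SucI) (simp add: skeleton_Suc mono nonneg del: skeleton.simps)
qed

text \<open>An infinite time means that no further jump occurs and counts as 0, in accordance with
  \<open>first_jump\<close>, which integrates over finite delays.\<close>

definition value_at :: "(real \<Rightarrow> 'a \<Rightarrow> ennreal) \<Rightarrow> ereal \<times> 'a \<Rightarrow> ennreal" where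
  "value_at u p = (if fst p = \<infinity> then 0 else u (real_of_ereal (fst p)) (snd p))"

lemma value_at_measurable:
  assumes u: "jointly_measurable u"
  shows "value_at u \<in> borel_measurable (borel \<Otimes>\<^sub>M N)"
proof -
  have [measurable]: "(\<lambda>p. u (real_of_ereal (fst p)) (snd p)) \<in> borel_measurable (borel \<Otimes>\<^sub>M N)"
    by (rule curried_measurable[OF u]) measurable
  show ?thesis unfolding value_at_def by measurable
qed

text \<open>\<open>first_jump\<close> is the transition operator of the skeleton: the uniform
  variable integrates to the kernel \<open>Q\<close>, the exponential one to the density of the
  waiting time.\<close>

lemma nn_integral_jump_step:
  assumes u: "jointly_measurable u" and p: "snd p \<in> space N"
  shows "(\<integral>\<^sup>+z. value_at u (jump_step p z) \<partial>noise_step) = value_at (first_jump u) p"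
proof (cases "fst p = \<infinity>")
  case True
  then show ?thesis by (simp add: value_at_def jump_step_def)
next
  case False
  let ?S = "real_of_ereal (fst p)" and ?y = "snd p"
  let ?T = "next_jump \<phi> l ?S ?y"
  interpret U: prob_space unit_uniform by (rule prob_space_unit_uniform)
  have vm: "(\<lambda>z. value_at u (jump_step p z)) \<in> borel_measurable noise_step"
  proof -
    have "p \<in> space (borel \<Otimes>\<^sub>M N)" using p by (cases p) (simp add: space_pair_measure)
    then have "(\<lambda>z. jump_step p z) \<in> noise_step \<rightarrow>\<^sub>M borel \<Otimes>\<^sub>M N"
      using measurable_compose[OF measurable_Pair1' jump_step_measurable] by simp
    from measurable_compose[OF this value_at_measurable[OF u]] show ?thesis .
  qed
  \<comment> \<open>The mean value of \<open>u\<close> just after the jump, given that it happens at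
    time \<open>\<tau>\<close>.\<close>
  define h where "h \<tau> = (\<integral>\<^sup>+y. u \<tau> y \<partial>Q (\<psi> (\<tau> - ?S) ?y))" for \<tau>
  have h_meas: "h \<in> borel_measurable borel"
  proof -
    have "(\<lambda>\<tau>. Q (\<psi> (\<tau> - ?S) ?y)) \<in> borel \<rightarrow>\<^sub>M subprob_algebra N" using p by measurable
    from nn_integral_measurable_subprob_algebra2[OF _ this, of u] u show ?thesis
      unfolding h_def[abs_def] by (simp add: split_beta')
  qed
  have u1: "u \<tau> \<in> borel_measurable N" for \<tau>
    by (rule curried_measurable[OF u]) measurable
  have "(\<integral>\<^sup>+z. value_at u (jump_step p z) \<partial>noise_step) =
      (\<integral>\<^sup>+e. (\<integral>\<^sup>+v. value_at u (jump_step p (e, v)) \<partial>unit_uniform) \<partial>std_exponential)"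
    using vm unfolding noise_step_def by (subst U.nn_integral_fst[symmetric]) auto
  also have "\<dots> = (\<integral>\<^sup>+e. (if ?T e = \<infinity> then 0 else h (real_of_ereal (?T e)))
      \<partial>std_exponential)"
    by (intro nn_integral_cong)
      (auto simp: value_at_def jump_step_def False h_def nn_integral_G[OF psi_space[OF p] u1])
  also have "\<dots> = (\<integral>\<^sup>+r. indicator {0..} r * (ennreal (l (\<psi> r ?y) * exp (- \<Lambda> r ?y)) * h (?S + r)) \<partial>lborel)"
    by (rule next_jump_law[OF p h_meas])
  also have "\<dots> = first_jump u ?S ?y"
    unfolding first_jump_def killed_def jump_def h_def
    using rate_nonneg[OF psi_space[OF p]]
    by (intro nn_integral_cong) (simp add: ennreal_mult mult_ac)
  finally show ?thesis using False by (simp add: value_at_def)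
qed

text \<open>The recursion of \<open>jumps\<close> peels off the first jump, whereas the skeleton
  grows at its last one. Letting \<open>j\<close> vary reconciles the two: integrating out the last
  step raises \<open>j\<close> by one and shortens the skeleton by one.\<close>

lemma nn_integral_skeleton:
  assumes x: "x \<in> space N" and f: "f \<in> borel_measurable N"
  shows "(\<integral>\<^sup>+w. value_at (jumps t f j) (skel x w k) \<partial>noise) = jumps t f (j + k) 0 x"
proof (induction k arbitrary: j)
  case 0
  interpret prob_space noise by (rule prob_space_noise)
  show ?case by (simp add: value_at_def emeasure_space_1)
next
  case (Suc k)
  have "(\<integral>\<^sup>+w. value_at (jumps t f j) (jump_step (skel x w k) (w k)) \<partial>noise) =
      (\<integral>\<^sup>+w. (\<integral>\<^sup>+z. value_at (jumps t f j) (jump_step (skel x w k) z) \<partial>noise_step) \<partial>noise)"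
    by (rule nn_integral_noise_split[where H = "\<lambda>p z. value_at (jumps t f j) (jump_step p z)",
          OF skeleton_measurable[OF x] skeleton_past])
      (auto intro: measurable_compose[OF jump_step_measurable value_at_measurable[OF jumps_measurable[OF f]]])
  also have "\<dots> = (\<integral>\<^sup>+w. value_at (jumps t f (Suc j)) (skel x w k) \<partial>noise)"
  proof (rule nn_integral_cong)
    fix w assume "w \<in> space noise"
    then have "skel x w k \<in> space (borel \<Otimes>\<^sub>M N)"
      by (rule measurable_space[OF skeleton_measurable[OF x]])
    then have "snd (skel x w k) \<in> space N"
      by (cases "skel x w k") (simp add: space_pair_measure)
    from nn_integral_jump_step[OF jumps_measurable[OF f] this]
    show "(\<integral>\<^sup>+z. value_at (jumps t f j) (jump_step (skel x w k) z) \<partial>noise_step) =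
        value_at (jumps t f (Suc j)) (skel x w k)" by simp
  qed
  finally show ?case using Suc[of "Suc j"] by (simp add: skeleton_Suc del: skeleton.simps jumps.simps)
qed

end

section \<open>The position at a fixed time, split by the number of jumps\<close>

context jump_process
begin

text \<open>Since the jump times increase, only one interval between successive jumps contains
  \<open>t\<close>, so the definite description in \<open>pdmp_path\<close> picks
  \<open>k\<close>.\<close>

lemma pdmp_path_eq:
  assumes "fst (skel x w k) \<le> ereal t" "ereal t < fst (skel x w (Suc k))"
  shows "pdmp_path \<phi> l G x w t =
    Some (\<psi> (t - real_of_ereal (fst (skel x w k))) (snd (skel x w k)))"
proof -
  let ?S = "\<lambda>k. fst (skel x w k)"
  have "ereal t < (SUP k. ?S k)"
    using assms(2) by (meson SUP_upper UNIV_I less_le_trans)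
  moreover have "(THE k. ?S k \<le> ereal t \<and> ereal t < ?S (Suc k)) = k"
  proof (rule the_equality)
    fix j assume j: "?S j \<le> ereal t \<and> ereal t < ?S (Suc j)"
    have "\<not> j < k" "\<not> k < j"
      using incseqD[OF skeleton_incseq, of "Suc j" k x w] incseqD[OF skeleton_incseq, of "Suc k" j x w]
        j assms by (auto simp: Suc_le_eq simp del: skeleton.simps)
    then show "j = k" by simp
  qed (use assms in simp)
  moreover have "\<phi> (t - real_of_ereal (?S k)) = \<psi> (t - real_of_ereal (?S k))"
    using assms(1) skeleton_nonneg[of x w k] by (cases "?S k") (auto intro!: flow_eq)
  ultimately show ?thesis
    unfolding pdmp_path_def Let_def by (simp del: skeleton.simps)
qed

lemma pdmp_path_cases:
  assumes "pdmp_path \<phi> l G x w t \<noteq> None" "0 \<le> t"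
  obtains k where "fst (skel x w k) \<le> ereal t" "ereal t < fst (skel x w (Suc k))"
proof -
  let ?S = "\<lambda>k. fst (skel x w k)"
  have "ereal t < (SUP k. ?S k)"
    using assms(1) unfolding pdmp_path_def Let_def by (auto split: if_splits)
  then have ex: "\<exists>k. ereal t < ?S k" by (auto simp: less_SUP_iff)
  define m where "m = (LEAST k. ereal t < ?S k)"
  have m: "ereal t < ?S m" unfolding m_def using ex by (rule LeastI_ex)
  then have "m \<noteq> 0" using assms(2) by (cases m) auto
  then obtain k where k: "m = Suc k" by (cases m) auto
  have "\<not> ereal t < ?S k" using not_less_Least[of k "\<lambda>k. ereal t < ?S k"] k by (simp add: m_def)
  then show ?thesis using that[of k] m k by (simp del: skeleton.simps)
qed

definition occupied :: "real \<Rightarrow> 'a set \<Rightarrow> nat \<Rightarrow> 'a \<Rightarrow> (nat \<Rightarrow> real \<times> real) set" where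
  "occupied t A k x = {w \<in> space noise. fst (skel x w k) \<le> ereal t \<and>
     ereal t < fst (skel x w (Suc k)) \<and>
     \<psi> (t - real_of_ereal (fst (skel x w k))) (snd (skel x w k)) \<in> A}"

lemma occupied_sets:
  assumes x: "x \<in> space N" and A[measurable]: "A \<in> sets N"
  shows "occupied t A k x \<in> sets noise"
proof -
  note skeleton_measurable[OF x, measurable]
  show ?thesis unfolding occupied_def by measurable
qed

lemma disjoint_occupied: "disjoint_family (\<lambda>k. occupied t A k x)"
proof -
  have *: "j = k" if "w \<in> occupied t A j x" "w \<in> occupied t A k x" for j k w
  proof -
    have "\<not> j < k" "\<not> k < j"
      using incseqD[OF skeleton_incseq, of "Suc j" k x w] incseqD[OF skeleton_incseq, of "Suc k" j x w]
        that by (auto simp: occupied_def Suc_le_eq simp del: skeleton.simps)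
    then show ?thesis by simp
  qed
  then show ?thesis unfolding disjoint_family_on_def by blast
qed

lemma pdmp_path_event:
  assumes "0 \<le> t"
  shows "{w \<in> space noise. pdmp_path \<phi> l G x w t \<in> Some ` A} = (\<Union>k. occupied t A k x)"
proof (intro equalityI subsetI)
  fix w assume w: "w \<in> {w \<in> space noise. pdmp_path \<phi> l G x w t \<in> Some ` A}"
  then have "pdmp_path \<phi> l G x w t \<noteq> None" by auto
  then obtain k where k: "fst (skel x w k) \<le> ereal t"
      "ereal t < fst (skel x w (Suc k))"
    using pdmp_path_cases assms by blast
  then have "w \<in> occupied t A k x"
    using w unfolding occupied_def by (auto simp: pdmp_path_eq[OF k] simp del: skeleton.simps)
  then show "w \<in> (\<Union>k. occupied t A k x)" by blast
next
  fix w assume "w \<in> (\<Union>k. occupied t A k x)"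
  then obtain k where "w \<in> occupied t A k x" by blast
  then show "w \<in> {w \<in> space noise. pdmp_path \<phi> l G x w t \<in> Some ` A}"
    unfolding occupied_def using pdmp_path_eq[of x w k t] by (auto simp del: skeleton.simps)
qed

text \<open>Given the first \<open>k\<close> steps, the event asks the next jump to come after
  \<open>t\<close>; its probability is the survival factor contained in \<open>jumps\<close> with 0
  jumps. The preceding steps are then integrated by \<open>nn_integral_skeleton\<close>.\<close>

lemma emeasure_occupied:
  assumes x: "x \<in> space N" and A[measurable]: "A \<in> sets N"
  shows "emeasure noise (occupied t A k x) = jumps t (indicator A) k 0 x"
proof -
  interpret U: prob_space unit_uniform by (rule prob_space_unit_uniform)
  define H :: "ereal \<times> 'a \<Rightarrow> real \<times> real \<Rightarrow> ennreal" where
    "H p z = (if fst p \<le> ereal t \<and> ereal t < fst (jump_step p z) \<and>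
        \<psi> (t - real_of_ereal (fst p)) (snd p) \<in> A then 1 else 0)" for p z
  note jump_step_measurable[measurable]
  have H: "(\<lambda>q. H (fst q) (snd q)) \<in> borel_measurable ((borel \<Otimes>\<^sub>M N) \<Otimes>\<^sub>M noise_step)"
    unfolding H_def by measurable
  have inner: "(\<integral>\<^sup>+z. H p z \<partial>noise_step) = value_at (jumps t (indicator A) 0) p"
    if y: "snd p \<in> space N" and p0: "0 \<le> fst p" for p
  proof (cases "fst p \<le> ereal t")
    case True
    then obtain S where S: "fst p = ereal S" "S \<le> t" using p0 by (cases "fst p") auto
    let ?T = "next_jump \<phi> l S (snd p)"
    have T [measurable]: "?T \<in> borel_measurable borel" by (rule next_jump_measurable) (use y in auto)
    have [measurable]: "(\<lambda>z. ?T (fst z)) \<in> borel_measurable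
        (std_exponential \<Otimes>\<^sub>M unit_uniform)"
      by (rule measurable_compose[OF _ T]) measurable
    have "(\<integral>\<^sup>+z. H p z \<partial>noise_step) =
        (\<integral>\<^sup>+z. indicator A (\<psi> (t - S) (snd p)) * (if ereal t < ?T (fst z) then 1 else 0) \<partial>noise_step)"
      by (intro nn_integral_cong) (auto simp: H_def S jump_step_def indicator_def)
    also have "\<dots> = (\<integral>\<^sup>+e. (\<integral>\<^sup>+v. indicator A (\<psi> (t - S) (snd p)) *
        (if ereal t < ?T (fst (e, v)) then 1 else 0) \<partial>unit_uniform) \<partial>std_exponential)"
      unfolding noise_step_def by (rule U.nn_integral_fst[symmetric]) measurable
    also have "\<dots> = (\<integral>\<^sup>+e. indicator A (\<psi> (t - S) (snd p)) * indicator {e. ereal t < ?T e} e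
        \<partial>std_exponential)"
      by (intro nn_integral_cong) (simp add: U.emeasure_space_1 indicator_def)
    also have "\<dots> = indicator A (\<psi> (t - S) (snd p)) *
        emeasure std_exponential {e. ereal t < ?T e}"
      by (rule nn_integral_cmult_indicator) simp
    also have "\<dots> = value_at (jumps t (indicator A) 0) p"
      using S(2) by (simp add: next_jump_survival[OF y S(2)] value_at_def S(1) killed_def mult.commute)
    finally show ?thesis .
  next
    \<comment> \<open>The current jump time lies after \<open>t\<close> or is infinite, and both
      sides are 0.\<close>
    case False
    then show ?thesis by (cases "fst p") (auto simp: H_def value_at_def)
  qed
  have "emeasure noise (occupied t A k x) = (\<integral>\<^sup>+w. indicator (occupied t A k x) w \<partial>noise)"
    using occupied_sets[OF x A] by simp
  also have "\<dots> = (\<integral>\<^sup>+w. H (skel x w k) (w k) \<partial>noise)"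
    by (intro nn_integral_cong)
      (auto simp: H_def occupied_def skeleton_Suc indicator_def simp del: skeleton.simps)
  also have "\<dots> = (\<integral>\<^sup>+w. (\<integral>\<^sup>+z. H (skel x w k) z \<partial>noise_step) \<partial>noise)"
    by (rule nn_integral_noise_split[OF skeleton_measurable[OF x] skeleton_past H])
  also have "\<dots> = (\<integral>\<^sup>+w. value_at (jumps t (indicator A) 0) (skel x w k) \<partial>noise)"
  proof (rule nn_integral_cong)
    fix w assume "w \<in> space noise"
    then have "skel x w k \<in> space (borel \<Otimes>\<^sub>M N)"
      by (rule measurable_space[OF skeleton_measurable[OF x]])
    then have "snd (skel x w k) \<in> space N"
      by (cases "skel x w k") (simp add: space_pair_measure)
    then show "(\<integral>\<^sup>+z. H (skel x w k) z \<partial>noise_step) =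
        value_at (jumps t (indicator A) 0) (skel x w k)"
      by (rule inner) (rule skeleton_nonneg)
  qed
  also have "\<dots> = jumps t (indicator A) k 0 x"
    using nn_integral_skeleton[OF x, of "indicator A" t 0 k] by simp
  finally show ?thesis .
qed

lemma pdmp_path_event_sets:
  assumes "0 \<le> t" "x \<in> space N" "A \<in> sets N"
  shows "{w \<in> space noise. pdmp_path \<phi> l G x w t \<in> Some ` A} \<in> sets noise"
  unfolding pdmp_path_event[OF assms(1)] using occupied_sets[OF assms(2,3)] by auto

lemma emeasure_pdmp_path:
  assumes "0 \<le> t" "x \<in> space N" "A \<in> sets N"
  shows "emeasure noise {w \<in> space noise. pdmp_path \<phi> l G x w t \<in> Some ` A} =
    (\<Sum>k. jumps t (indicator A) k 0 x)"
proof -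
  have "(\<Sum>k. emeasure noise (occupied t A k x)) = emeasure noise (\<Union>k. occupied t A k x)"
    using occupied_sets[OF assms(2,3)] by (intro suminf_emeasure disjoint_occupied) auto
  then show ?thesis
    by (simp add: pdmp_path_event[OF assms(1)] emeasure_occupied[OF assms(2,3)])
qed

end

text \<open>\<open>measure_of\<close> reproduces the prescribed set function once that is countably
  additive, which rests on the measurability of the path events. Disjoint sets give disjoint events
  because \<open>Some\<close> is injective.\<close>

lemma emeasure_pdmp_semigroup:
  assumes meas: "\<And>A. A \<in> sets (mborel M) \<Longrightarrow>
      {w \<in> space noise. pdmp_path \<phi> l G x w t \<in> Some ` A} \<in> sets noise"
    and A: "A \<in> sets (mborel M)"
  shows "emeasure (pdmp_semigroup M \<phi> l G t x) A =
    emeasure noise {w \<in> space noise. pdmp_path \<phi> l G x w t \<in> Some ` A}"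
proof -
  let ?f = "\<lambda>A. emeasure noise {w \<in> space noise. pdmp_path \<phi> l G x w t \<in> Some ` A}"
  show ?thesis
    unfolding pdmp_semigroup_def
  proof (rule emeasure_measure_of_sigma[OF _ _ _ A])
    have "space (mborel M) = M" by (simp add: space_restrict_space)
    then show "sigma_algebra M (sets (mborel M))"
      using sets.sigma_algebra_axioms[of "mborel M"] by simp
    show "positive (sets (mborel M)) ?f" by (simp add: positive_def)
    show "countably_additive (sets (mborel M)) ?f"
    proof (rule countably_additiveI)
      fix B :: "nat \<Rightarrow> 'a set"
      assume B: "range B \<subseteq> sets (mborel M)" "disjoint_family B" "\<Union> (range B) \<in> sets (mborel M)"
      have "(\<Sum>i. ?f (B i)) = emeasure noise (\<Union>i. {w \<in> space noise. pdmp_path \<phi> l G x w t \<in> Some ` B i})"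
      proof (rule suminf_emeasure)
        show "disjoint_family (\<lambda>i. {w \<in> space noise. pdmp_path \<phi> l G x w t \<in> Some ` B i})"
          using B(2) unfolding disjoint_family_on_def by fastforce
      qed (use B meas in auto)
      also have "(\<Union>i. {w \<in> space noise. pdmp_path \<phi> l G x w t \<in> Some ` B i}) =
          {w \<in> space noise. pdmp_path \<phi> l G x w t \<in> Some ` \<Union> (range B)}" by auto
      finally show "(\<Sum>i. ?f (B i)) = ?f (\<Union> (range B))" .
    qed
  qed
qed

text \<open>Dynkin's argument for sums of two measures. Finiteness serves the complements, where
  real values are subtracted; equality on \<open>\<Omega>\<close> is asked separately because
  \<open>\<Omega>\<close> need not belong to \<open>E\<close>.\<close>

lemma finite_measures_sum_eqI:
  assumes E: "Int_stable E" "E \<subseteq> Pow \<Omega>"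
    and sets: "sets a1 = sigma_sets \<Omega> E" "sets a2 = sigma_sets \<Omega> E"
      "sets b1 = sigma_sets \<Omega> E" "sets b2 = sigma_sets \<Omega> E"
    and fin: "finite_measure a1" "finite_measure a2" "finite_measure b1" "finite_measure b2"
    and eq: "\<And>X. X \<in> E \<Longrightarrow> emeasure a1 X + emeasure a2 X = emeasure b1 X + emeasure b2 X"
      "emeasure a1 \<Omega> + emeasure a2 \<Omega> = emeasure b1 \<Omega> + emeasure b2 \<Omega>"
    and A: "A \<in> sigma_sets \<Omega> E"
  shows "emeasure a1 A + emeasure a2 A = emeasure b1 A + emeasure b2 A"
proof -
  interpret a1: finite_measure a1 by fact
  interpret a2: finite_measure a2 by fact
  interpret b1: finite_measure b1 by fact
  interpret b2: finite_measure b2 by fact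
  have space: "space a1 = \<Omega>" "space a2 = \<Omega>" "space b1 = \<Omega>" "space b2 = \<Omega>"
    using sets E(2) by (metis sets_measure_of sets_eq_imp_space_eq space_measure_of)+
  have ennreal_iff: "emeasure a1 X + emeasure a2 X = emeasure b1 X + emeasure b2 X \<longleftrightarrow>
      measure a1 X + measure a2 X = measure b1 X + measure b2 X" for X
    by (simp add: a1.emeasure_eq_measure a2.emeasure_eq_measure b1.emeasure_eq_measure
        b2.emeasure_eq_measure flip: ennreal_plus)
  from E A show ?thesis
  proof (induction rule: sigma_sets_induct_disjoint)
    case (basic X)
    then show ?case by (rule eq)
  next
    case empty
    then show ?case by simp
  next
    case (compl X)
    then show ?case
      using eq(2) unfolding ennreal_iff
      by (simp add: a1.finite_measure_compl[unfolded space] a2.finite_measure_compl[unfolded space]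
          b1.finite_measure_compl[unfolded space] b2.finite_measure_compl[unfolded space] sets)
  next
    case (union X)
    have *: "emeasure nu (\<Union>i. X i) = (\<Sum>i. emeasure nu (X i))" if "sets nu = sigma_sets \<Omega> E" for nu
      using union(1,2) that by (intro suminf_emeasure[symmetric]) auto
    show ?case
      using union(3) by (simp add: * sets suminf_add[OF summableI summableI])
  qed
qed

section \<open>Weak stationarity\<close>

lemma C1c_on_bounded:
  assumes "C1c_on M g"
  obtains D where "0 \<le> D" "\<And>x. x \<in> M \<Longrightarrow> \<bar>g x\<bar> \<le> D"
proof -
  obtain K where K: "compact K" "K \<subseteq> M" "\<And>x. x \<in> M - K \<Longrightarrow> g x = 0" and g: "C1_on M g"
    using assms unfolding C1c_on_def by blast
  have "compact (g ` K)"
    using continuous_on_subset[OF C1_on_continuous_on[OF g] K(2)] K(1) by (rule compact_continuous_image)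
  then obtain C where C: "\<And>y. y \<in> K \<Longrightarrow> \<bar>g y\<bar> \<le> C"
    using compact_imp_bounded bounded_iff by (metis image_eqI real_norm_def)
  show ?thesis by (rule that[of "max C 0"]) (use C K(3) in \<open>force simp: max_def\<close>)+
qed

lemma C1c_on_measurable: "C1c_on M g \<Longrightarrow> g \<in> borel_measurable (mborel M)"
  by (rule borel_measurable_continuous_on_restrict, rule C1_on_continuous_on) (simp add: C1c_on_def)

locale weakly_stationary = C1_flow M \<phi>
  for M :: "'a::euclidean_space set" and \<phi> +
  fixes l :: "'a \<Rightarrow> real" and Q :: "'a \<Rightarrow> 'a measure" and \<mu> :: "'a measure"
  assumes rate: "jump_rate M l" and mkernel: "markov_kernel M Q"
    and prob: "prob_space \<mu>" and sets_mu: "sets \<mu> = sets (mborel M)"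
    and rate_int: "(\<integral>\<^sup>+x. ennreal \<bar>l x\<bar> \<partial>\<mu>) < \<infinity>"
    and generator_zero: "C1c_on M f \<Longrightarrow> (\<integral>x. generator M \<phi> l Q f x \<partial>\<mu>) = 0"
begin

text \<open>\<open>\<phi>\<close> is unspecified for negative times.\<close>

definition psi :: "real \<Rightarrow> 'a \<Rightarrow> 'a" where
  "psi s x = \<phi> (max 0 s) x"

lemma psi_eq: "0 \<le> s \<Longrightarrow> \<phi> s = psi s"
  by (simp add: psi_def fun_eq_iff max_def)

lemma space_mborel: "space (mborel M) = M"
  by (simp add: space_restrict_space)

lemma space_mu: "space \<mu> = M"
  using sets_eq_imp_space_eq[OF sets_mu] space_mborel by simp

sublocale flow_with_rate "mborel M" psi l Q
proof
  have "(\<lambda>(t, x). \<phi> t x) \<in> restrict_space borel {0..} \<Otimes>\<^sub>M mborel M \<rightarrow>\<^sub>M mborel M"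
    using flow unfolding differential_flow_def by blast
  \<comment> \<open>Clipping negative times at 0 is measurable into the half-line on which the flow
    is given.\<close>
  moreover have "(\<lambda>p. (max 0 (fst p), snd p)) \<in>
      (borel :: real measure) \<Otimes>\<^sub>M mborel M \<rightarrow>\<^sub>M restrict_space borel {0..} \<Otimes>\<^sub>M mborel M"
  proof (rule measurable_Pair)
    show "(\<lambda>p. max 0 (fst p)) \<in> (borel :: real measure) \<Otimes>\<^sub>M mborel M \<rightarrow>\<^sub>M restrict_space borel {0..}"
      by (rule measurable_restrict_space2) (simp, measurable)
  qed (rule measurable_snd)
  ultimately have "(\<lambda>p. case (max 0 (fst p), snd p) of (t, x) \<Rightarrow> \<phi> t x) \<in> borel \<Otimes>\<^sub>M mborel M \<rightarrow>\<^sub>M mborel M"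
    using measurable_compose by blast
  then show "(\<lambda>(s, x). psi s x) \<in> borel \<Otimes>\<^sub>M mborel M \<rightarrow>\<^sub>M mborel M"
    by (simp add: psi_def split_beta')
  show "l \<in> borel_measurable (mborel M)" using rate unfolding jump_rate_def by blast
  show "Q \<in> mborel M \<rightarrow>\<^sub>M prob_algebra (mborel M)" using mkernel unfolding markov_kernel_def .
  fix x assume "x \<in> space (mborel M)"
  then have x: "x \<in> M" by (simp add: space_mborel)
  show "psi 0 x = x" using flow_0[OF x] by (simp add: psi_def)
  show "0 \<le> l x" using rate x unfolding jump_rate_def by blast
  show "psi (t + s) x = psi s (psi t x)" if "0 \<le> s" "0 \<le> t" for s t
    using flow_add[OF that x] that by (simp add: psi_def)
  fix t :: real assume "0 \<le> t"
  \<comment> \<open>An orbit segment is a compact subset of \<open>M\<close>, and the rate is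
    bounded on such sets.\<close>
  have "continuous_on {0..t} (\<lambda>s. \<phi> s x)"
    by (rule continuous_on_subset[OF C1_on_continuous_on[OF C1_on_orbit[OF x]]]) auto
  then have "compact ((\<lambda>s. \<phi> s x) ` {0..t})" by (rule compact_continuous_image) simp
  moreover have "(\<lambda>s. \<phi> s x) ` {0..t} \<subseteq> M" using flow_in x by auto
  ultimately have "bounded (l ` (\<lambda>s. \<phi> s x) ` {0..t})" using rate unfolding jump_rate_def by blast
  then obtain B where B: "\<forall>y\<in>l ` (\<lambda>s. \<phi> s x) ` {0..t}. norm y \<le> B" unfolding bounded_iff by blast
  have "l (psi s x) \<le> B" if s: "s \<in> {0..t}" for s
  proof -
    have "norm (l (\<phi> s x)) \<le> B" using B s by blast
    moreover have "psi s x = \<phi> s x" using psi_eq[of s] s by simp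
    ultimately show ?thesis by simp
  qed
  then show "\<exists>B. \<forall>s\<in>{0..t}. l (psi s x) \<le> B" by blast
qed

lemma rate_int': "(\<integral>\<^sup>+x. ennreal (l x) \<partial>\<mu>) < \<infinity>"
proof -
  have "(\<integral>\<^sup>+x. ennreal (l x) \<partial>\<mu>) = (\<integral>\<^sup>+x. ennreal \<bar>l x\<bar> \<partial>\<mu>)"
    using rate_nonneg by (intro nn_integral_cong) (simp add: space_mu space_mborel)
  then show ?thesis using rate_int by simp
qed

lemma sets_flux: "sets (rate_flux \<mu>) = sets (mborel M)" "sets (jump_flux \<mu>) = sets (mborel M)"
  using sets_mu sets_jump_flux[OF sets_mu] prob_space.not_empty[OF prob] space_mu space_mborel by auto

lemma finite_flux: "finite_measure (rate_flux \<mu>)" "finite_measure (jump_flux \<mu>)"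
  by (rule flux_finite[OF sets_mu rate_int'])+

lemma integrable_C1c_flow:
  assumes g: "C1c_on M g" and nu: "finite_measure nu" "sets nu = sets (mborel M)"
  shows "integrable nu (\<lambda>x. g (psi s x))"
proof -
  interpret finite_measure nu by fact
  obtain D where D: "\<And>x. x \<in> M \<Longrightarrow> \<bar>g x\<bar> \<le> D" using C1c_on_bounded[OF g] by blast
  note C1c_on_measurable[OF g, measurable] nu(2)[measurable_cong]
  have "space nu = M" using sets_eq_imp_space_eq[OF nu(2)] space_mborel by simp
  then show ?thesis
    using D psi_space space_mborel by (intro integrable_const_bound[of _ D]) auto
qed

lemma nn_integral_C1c_flow:
  assumes g: "C1c_on M g" "\<And>x. 0 \<le> g x" and nu: "finite_measure nu" "sets nu = sets (mborel M)"
  shows "(\<integral>\<^sup>+x. ennreal (g (psi s x)) \<partial>nu) = ennreal (\<integral>x. g (psi s x) \<partial>nu)"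
  using integrable_C1c_flow[OF g(1) nu] g(2) by (intro nn_integral_eq_integral) auto

text \<open>The hypothesis is applied to \<open>g\<close> composed with \<open>\<phi> s\<close>,
  whose drift term is \<open>lie g\<close> along the flow. The generator integral may be split
  because the drift is bounded and each jump term is at most a constant times the integrable
  rate.\<close>

lemma integral_lie_flow:
  assumes g: "C1c_on M g" "\<And>x. 0 \<le> g x" and s: "0 \<le> s"
  shows "(\<integral>x. lie g (psi s x) \<partial>\<mu>) =
    (\<integral>x. g (psi s x) \<partial>rate_flux \<mu>) - (\<integral>x. g (psi s x) \<partial>jump_flux \<mu>)"
proof -
  interpret prob_space \<mu> by (rule prob)
  note [measurable_cong] = sets_mu
  let ?g = "\<lambda>x. g (\<phi> s x)"
  have psi_s: "psi s = \<phi> s" using psi_eq[OF s] by simp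
  have g1: "C1_on M g" using g(1) unfolding C1c_on_def by blast
  have c: "C1c_on M ?g" by (rule C1c_on_flow[OF g(1) s])
  then have c1: "C1_on M ?g" unfolding C1c_on_def by blast
  note gm[measurable] = C1c_on_measurable[OF c]
  obtain D where D: "0 \<le> D" "\<And>x. x \<in> M \<Longrightarrow> \<bar>?g x\<bar> \<le> D" using C1c_on_bounded[OF c] by blast
  have l_int: "integrable \<mu> l"
    using rate_int by (intro integrableI_bounded) auto
  have l0: "0 \<le> l x" if "x \<in> M" for x using rate_nonneg that by (simp add: space_mborel)
  have Qs: "sets (Q x) = sets (mborel M)" "prob_space (Q x)" if "x \<in> M" for x
    using measurable_space[OF kernel, of x] that by (auto simp: space_mborel space_prob_algebra)
  have Q_int: "integrable (Q x) ?g" if x: "x \<in> M" for x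
    using integrable_C1c_flow[OF g(1) _ Qs(1)[OF x], of s] Qs(2)[OF x]
    by (simp add: psi_s prob_space.finite_measure)
  have Q_nn: "(\<integral>\<^sup>+y. ennreal (?g y) \<partial>Q x) = ennreal (kernel_apply Q ?g x)" if x: "x \<in> M" for x
    unfolding kernel_apply_def using Q_int[OF x] g(2) by (intro nn_integral_eq_integral) auto
  have k0: "0 \<le> kernel_apply Q ?g x" for x
    unfolding kernel_apply_def using g(2) by (intro Bochner_Integration.integral_nonneg) auto
  have k_meas [measurable]: "kernel_apply Q ?g \<in> borel_measurable (mborel M)"
  proof -
    have "(\<lambda>x. \<integral>\<^sup>+y. ennreal (?g y) \<partial>Q x) \<in> borel_measurable (mborel M)"
      by (rule nn_integral_measurable_subprob_algebra2[OF _ kernel_subprob]) (simp add: split_beta')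
    then have "(\<lambda>x. enn2real (\<integral>\<^sup>+y. ennreal (?g y) \<partial>Q x)) \<in> borel_measurable (mborel M)" by measurable
    then show ?thesis
      by (rule measurable_cong[THEN iffD1, rotated]) (simp add: space_mborel Q_nn k0)
  qed
  have kD: "kernel_apply Q ?g x \<le> D" if x: "x \<in> M" for x
  proof -
    interpret Qx: prob_space "Q x" by (rule Qs(2)[OF x])
    have "space (Q x) = M" using sets_eq_imp_space_eq[OF Qs(1)[OF x]] space_mborel by simp
    then have "(\<integral>y. ?g y \<partial>Q x) \<le> (\<integral>y. D \<partial>Q x)"
      using D(2) Q_int[OF x] by (intro integral_mono) (auto simp: abs_le_iff)
    then show ?thesis by (simp add: kernel_apply_def Qx.prob_space)
  qed
  have lg_int: "integrable \<mu> (\<lambda>x. l x * ?g x)"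
    by (rule Bochner_Integration.integrable_bound[OF integrable_mult_left[OF l_int, of D]])
      (use D l0 in \<open>auto simp: abs_mult space_mu intro!: AE_I2 mult_left_mono\<close>)
  have lk_int: "integrable \<mu> (\<lambda>x. l x * kernel_apply Q ?g x)"
    by (rule Bochner_Integration.integrable_bound[OF integrable_mult_left[OF l_int, of D]])
      (use D(1) kD k0 l0 in \<open>auto simp: abs_mult space_mu intro!: AE_I2 mult_left_mono\<close>)
  obtain C where C: "\<And>y. y \<in> M \<Longrightarrow> \<bar>lie ?g y\<bar> \<le> C" using lie_bounded[OF c] by blast
  have lie_meas: "lie ?g \<in> borel_measurable (mborel M)"
    by (rule borel_measurable_continuous_on_restrict[OF continuous_on_lie[OF c1]])
  have lie_int: "integrable \<mu> (lie ?g)"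
    using C lie_meas sets_mu by (intro integrable_const_bound[of _ C]) (auto simp: space_mu)
  have "0 = (\<integral>x. generator M \<phi> l Q ?g x \<partial>\<mu>)" using generator_zero[OF c] by simp
  also have "\<dots> = (\<integral>x. lie ?g x + (l x * kernel_apply Q ?g x - l x * ?g x) \<partial>\<mu>)"
    by (intro Bochner_Integration.integral_cong refl)
      (simp add: generator_def space_mu inner_mgrad_flow[OF c1] right_diff_distrib)
  also have "\<dots> = (\<integral>x. lie ?g x \<partial>\<mu>) + ((\<integral>x. l x * kernel_apply Q ?g x \<partial>\<mu>) - (\<integral>x. l x * ?g x \<partial>\<mu>))"
    using lie_int lk_int lg_int by simp
  also have "(\<integral>x. l x * ?g x \<partial>\<mu>) = (\<integral>x. ?g x \<partial>rate_flux \<mu>)"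
    unfolding rate_flux_def by (subst integral_density) (auto simp: space_mu l0)
  \<comment> \<open>\<open>jump_flux\<close> is built with a monadic bind and evaluated by
    nonnegative integrals, so the two real integrals are compared after embedding them in
    \<open>ennreal\<close>.\<close>
  also have "(\<integral>x. l x * kernel_apply Q ?g x \<partial>\<mu>) = (\<integral>x. ?g x \<partial>jump_flux \<mu>)"
  proof -
    have "ennreal (\<integral>x. ?g x \<partial>jump_flux \<mu>) = (\<integral>\<^sup>+x. ennreal (?g x) \<partial>jump_flux \<mu>)"
      using nn_integral_C1c_flow[OF g finite_flux(2) sets_flux(2), of s] by (simp add: psi_s)
    also have "\<dots> = (\<integral>\<^sup>+x. jump (\<lambda>x. ennreal (?g x)) x \<partial>\<mu>)"
      by (rule nn_integral_jump_flux[OF sets_mu]) measurable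
    also have "\<dots> = (\<integral>\<^sup>+x. ennreal (l x * kernel_apply Q ?g x) \<partial>\<mu>)"
      by (intro nn_integral_cong) (simp add: jump_def space_mu Q_nn l0 k0 ennreal_mult)
    also have "\<dots> = ennreal (\<integral>x. l x * kernel_apply Q ?g x \<partial>\<mu>)"
      using lk_int l0 k0 by (intro nn_integral_eq_integral) (auto simp: space_mu)
    finally show ?thesis
      using l0 k0 g(2) by (subst (asm) ennreal_inj)
        (auto intro!: integral_nonneg_AE simp: space_mu)
  qed
  finally have "(\<integral>x. lie ?g x \<partial>\<mu>) = (\<integral>x. ?g x \<partial>rate_flux \<mu>) - (\<integral>x. ?g x \<partial>jump_flux \<mu>)" by simp
  moreover have "(\<integral>x. lie ?g x \<partial>\<mu>) = (\<integral>x. lie g (\<phi> s x) \<partial>\<mu>)"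
    by (intro Bochner_Integration.integral_cong refl) (simp add: space_mu lie_comp_flow[OF g1 _ s])
  ultimately show ?thesis unfolding psi_s by simp
qed

text \<open>Passage between real integrals, in which rate and jump terms can be subtracted, and
  nonnegative ones, in which the measure identities live.\<close>

lemma nn_integral_occupation_C1c:
  assumes g: "C1c_on M g" "\<And>x. 0 \<le> g x" and nu: "finite_measure nu" "sets nu = sets (mborel M)"
  shows "set_integrable lborel {0..t} (\<lambda>s. \<integral>x. g (psi s x) \<partial>nu)"
    and "(\<integral>\<^sup>+x. ennreal (g x) \<partial>occupation nu t) = ennreal (LBINT s:{0..t}. \<integral>x. g (psi s x) \<partial>nu)"
proof -
  interpret finite_measure nu by fact
  note C1c_on_measurable[OF g(1), measurable] nu(2)[measurable_cong]
  obtain D where D: "\<And>x. x \<in> M \<Longrightarrow> \<bar>g x\<bar> \<le> D" using C1c_on_bounded[OF g(1)] by blast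
  have sp: "space nu = M" using sets_eq_imp_space_eq[OF nu(2)] space_mborel by simp
  show int: "set_integrable lborel {0..t} (\<lambda>s. \<integral>x. g (psi s x) \<partial>nu)"
  proof (rule set_integrable_bounded_Icc)
    show "(\<lambda>s. \<integral>x. g (psi s x) \<partial>nu) \<in> borel_measurable borel" by measurable
    fix s
    have "\<bar>\<integral>x. g (psi s x) \<partial>nu\<bar> \<le> (\<integral>x. \<bar>g (psi s x)\<bar> \<partial>nu)" by (rule integral_abs_bound)
    also have "\<dots> \<le> (\<integral>x. D \<partial>nu)"
      using D psi_space integrable_C1c_flow[OF g(1) nu]
      by (intro integral_mono) (auto simp: sp space_mborel)
    finally show "\<bar>\<integral>x. g (psi s x) \<partial>nu\<bar> \<le> (\<integral>x. D \<partial>nu)" .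
  qed
  have "(\<integral>\<^sup>+x. ennreal (g x) \<partial>occupation nu t) =
      (\<integral>\<^sup>+s. indicator {0..t} s * (\<integral>\<^sup>+x. ennreal (g (psi s x)) \<partial>nu) \<partial>lborel)"
    by (rule nn_integral_occupation[OF nu(2,1)]) measurable
  also have "\<dots> = (\<integral>\<^sup>+s. ennreal (indicator {0..t} s *\<^sub>R (\<integral>x. g (psi s x) \<partial>nu)) \<partial>lborel)"
    by (intro nn_integral_cong) (simp add: nn_integral_C1c_flow[OF g nu] indicator_def)
  also have "\<dots> = ennreal (LBINT s:{0..t}. \<integral>x. g (psi s x) \<partial>nu)"
    unfolding set_lebesgue_integral_def
    by (rule nn_integral_eq_integral[OF int[unfolded set_integrable_def]])
      (auto intro!: AE_I2 mult_nonneg_nonneg Bochner_Integration.integral_nonneg g(2))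
  finally show "(\<integral>\<^sup>+x. ennreal (g x) \<partial>occupation nu t) = ennreal (LBINT s:{0..t}. \<integral>x. g (psi s x) \<partial>nu)" .
qed

text \<open>The increment of \<open>g\<close> along an orbit is the time integral of
  \<open>lie g\<close>; Fubini exchanges this integral with the one over \<open>\<mu>\<close>, and
  \<open>integral_lie_flow\<close> evaluates the integrand at each time.\<close>

lemma forward_equation_C1c:
  assumes g: "C1c_on M g" "\<And>x. 0 \<le> g x" and t: "0 \<le> t"
  shows "(\<integral>\<^sup>+x. ennreal (g (psi t x)) \<partial>\<mu>) + (\<integral>\<^sup>+x. ennreal (g x) \<partial>occupation (jump_flux \<mu>) t) =
    (\<integral>\<^sup>+x. ennreal (g x) \<partial>\<mu>) + (\<integral>\<^sup>+x. ennreal (g x) \<partial>occupation (rate_flux \<mu>) t)"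
proof -
  interpret prob_space \<mu> by (rule prob)
  interpret P: pair_sigma_finite lborel \<mu> ..
  note [measurable_cong] = sets_mu
  have fin: "finite_measure \<mu>" by (rule prob_space.finite_measure[OF prob])
  have g1: "C1_on M g" using g(1) unfolding C1c_on_def by blast
  obtain C where C: "\<And>y. y \<in> M \<Longrightarrow> \<bar>lie g y\<bar> \<le> C" using lie_bounded[OF g(1)] by blast
  have lie_meas [measurable]: "lie g \<in> borel_measurable (mborel M)"
    by (rule borel_measurable_continuous_on_restrict[OF continuous_on_lie[OF g1]])
  have FTC: "(\<integral>s. indicator {0..t} s *\<^sub>R lie g (psi s x) \<partial>lborel) = g (psi t x) - g x" if "x \<in> M" for x
  proof -
    have "(\<integral>s. indicator {0..t} s *\<^sub>R lie g (psi s x) \<partial>lborel) =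
        (\<integral>s. indicator {0..t} s *\<^sub>R lie g (\<phi> s x) \<partial>lborel)"
      by (intro Bochner_Integration.integral_cong) (auto simp: indicator_def psi_eq)
    then show ?thesis using lie_FTC[OF g1 that t] psi_eq[OF t] by (simp add: set_lebesgue_integral_def)
  qed
  \<comment> \<open>Fubini is justified by boundedness of \<open>lie g\<close> on a set of finite
    measure.\<close>
  have joint: "integrable (lborel \<Otimes>\<^sub>M \<mu>) (\<lambda>(s, x). indicator {0..t} s *\<^sub>R lie g (psi s x))"
  proof (rule integrableI_bounded_set[where A = "{0..t} \<times> space \<mu>" and B = C])
    show "emeasure (lborel \<Otimes>\<^sub>M \<mu>) ({0..t} \<times> space \<mu>) < \<infinity>"
      using t by (simp add: emeasure_pair_measure_Times emeasure_space_1)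
    show "AE p in lborel \<Otimes>\<^sub>M \<mu>. p \<in> {0..t} \<times> space \<mu> \<longrightarrow>
        norm (case p of (s, x) \<Rightarrow> indicator {0..t} s *\<^sub>R lie g (psi s x)) \<le> C"
      using C psi_space by (intro AE_I2) (auto simp: space_mu space_mborel)
    show "AE p in lborel \<Otimes>\<^sub>M \<mu>. p \<notin> {0..t} \<times> space \<mu> \<longrightarrow>
        (case p of (s, x) \<Rightarrow> indicator {0..t} s *\<^sub>R lie g (psi s x)) = 0"
      by (intro AE_I2) (auto simp: space_pair_measure indicator_def split: if_splits)
  qed measurable
  let ?r = "\<lambda>s. \<integral>x. g (psi s x) \<partial>rate_flux \<mu>" and ?j = "\<lambda>s. \<integral>x. g (psi s x) \<partial>jump_flux \<mu>"
  note occ_r = nn_integral_occupation_C1c[OF g finite_flux(1) sets_flux(1), of t]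
  note occ_j = nn_integral_occupation_C1c[OF g finite_flux(2) sets_flux(2), of t]
  have g_int: "integrable \<mu> g"
    using integrable_C1c_flow[OF g(1) fin sets_mu, of 0]
      Bochner_Integration.integrable_cong[of \<mu> \<mu> "\<lambda>x. g (psi 0 x)" g]
    by (simp add: space_mu psi_def flow_0)
  have "(\<integral>x. g (psi t x) \<partial>\<mu>) - (\<integral>x. g x \<partial>\<mu>) = (\<integral>x. g (psi t x) - g x \<partial>\<mu>)"
    using integrable_C1c_flow[OF g(1) fin sets_mu] g_int by simp
  also have "\<dots> = (\<integral>x. (\<integral>s. indicator {0..t} s *\<^sub>R lie g (psi s x) \<partial>lborel) \<partial>\<mu>)"
    by (intro Bochner_Integration.integral_cong refl) (simp add: FTC[unfolded real_scaleR_def] space_mu)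
  also have "\<dots> = (\<integral>s. (\<integral>x. indicator {0..t} s *\<^sub>R lie g (psi s x) \<partial>\<mu>) \<partial>lborel)"
    by (rule P.Fubini_integral[OF joint])
  also have "\<dots> = (LBINT s:{0..t}. ?r s - ?j s)"
    unfolding set_lebesgue_integral_def
    by (intro Bochner_Integration.integral_cong refl)
      (simp add: integral_lie_flow[OF g] indicator_def)
  also have "\<dots> = (LBINT s:{0..t}. ?r s) - (LBINT s:{0..t}. ?j s)"
    by (rule set_integral_diff(2)[OF occ_r(1) occ_j(1)])
  finally have eq: "(\<integral>x. g (psi t x) \<partial>\<mu>) + (LBINT s:{0..t}. ?j s) =
      (\<integral>x. g x \<partial>\<mu>) + (LBINT s:{0..t}. ?r s)" by simp
  have nonneg: "0 \<le> (LBINT s:{0..t}. ?j s)" "0 \<le> (LBINT s:{0..t}. ?r s)"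
      "0 \<le> (\<integral>x. g (psi t x) \<partial>\<mu>)" "0 \<le> (\<integral>x. g x \<partial>\<mu>)"
    unfolding set_lebesgue_integral_def
    by (auto intro!: Bochner_Integration.integral_nonneg mult_nonneg_nonneg g(2))
  have "(\<integral>\<^sup>+x. ennreal (g x) \<partial>\<mu>) = ennreal (\<integral>x. g x \<partial>\<mu>)"
    using g_int g(2) by (intro nn_integral_eq_integral) auto
  then show ?thesis
    unfolding occ_r(2) occ_j(2) nn_integral_C1c_flow[OF g fin sets_mu]
    using eq nonneg by (simp flip: ennreal_plus)
qed

end

section \<open>From C1 test functions to Borel sets\<close>

context weakly_stationary
begin

text \<open>Nonvanishing sets without closure: products of test functions make them stable under
  intersection, and saturation makes their indicators increasing limits of test functions.\<close>

definition supports :: "'a set set" where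
  "supports = {{x \<in> M. g x \<noteq> 0} | g. C1c_on M g}"

lemma Int_stable_supports: "Int_stable supports"
  unfolding Int_stable_def supports_def
proof safe
  fix f g assume "C1c_on M f" "C1c_on M g"
  then have "C1c_on M (\<lambda>x. f x * g x)" by (rule C1c_on_mult)
  moreover have "{x \<in> M. f x \<noteq> 0} \<inter> {x \<in> M. g x \<noteq> 0} = {x \<in> M. f x * g x \<noteq> 0}" by auto
  ultimately show "\<exists>h. {x \<in> M. f x \<noteq> 0} \<inter> {x \<in> M. g x \<noteq> 0} = {x \<in> M. h x \<noteq> 0} \<and> C1c_on M h"
    by (intro exI[of _ "\<lambda>x. f x * g x"] conjI)
qed

lemma ball_supports:
  assumes "0 < r"
  shows "M \<inter> ball c r \<in> supports"
proof -
  obtain g where "C1c_on M g" "\<And>x. g x \<noteq> 0 \<longleftrightarrow> x \<in> ball c r"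
    using C1c_on_ball[OF closed_M assms, where c = c] by metis
  moreover from this have "M \<inter> ball c r = {x \<in> M. g x \<noteq> 0}" by blast
  ultimately show ?thesis unfolding supports_def by blast
qed

text \<open>An open set is a countable union of balls by the Lindelof property, and the trace of
  each ball on \<open>M\<close> belongs to \<open>supports\<close>.\<close>

lemma sets_mborel_supports: "sets (mborel M) = sigma_sets M supports"
proof
  have sub: "supports \<subseteq> Pow M" by (auto simp: supports_def)
  have "supports \<subseteq> sets (mborel M)"
  proof
    fix X assume "X \<in> supports"
    then obtain g where g: "C1c_on M g" "X = {x \<in> space (mborel M). g x \<noteq> 0}"
      by (auto simp: supports_def space_mborel)
    note C1c_on_measurable[OF g(1), measurable]
    show "X \<in> sets (mborel M)" unfolding g(2) by measurable
  qed
  then show "sigma_sets M supports \<subseteq> sets (mborel M)"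
    using sets.sigma_sets_subset[of supports "mborel M"] by (simp add: space_mborel)
  have "(\<lambda>x. x) \<in> borel_measurable (sigma M supports)"
  proof (rule borel_measurableI)
    fix S :: "'a set" assume S: "open S"
    define F where "F = {ball c r | c r. 0 < r \<and> ball c r \<subseteq> S}"
    obtain F' where F': "F' \<subseteq> F" "countable F'" "\<Union>F' = \<Union>F"
      using Lindelof[of F] by (auto simp: F_def)
    have "\<Union>F = S"
    proof
      show "S \<subseteq> \<Union>F"
      proof
        fix x assume "x \<in> S"
        then obtain e where "0 < e" "ball x e \<subseteq> S" using S by (meson open_contains_ball)
        then show "x \<in> \<Union>F" unfolding F_def by (intro UnionI[of "ball x e"]) auto
      qed
    qed (auto simp: F_def)
    then have "(\<lambda>x. x) -` S \<inter> space (sigma M supports) = (\<Union>B\<in>F'. M \<inter> B)"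
      using F'(3) sub by (auto simp: space_measure_of)
    also have "\<dots> \<in> sigma_sets M supports"
    proof (rule sigma_sets_UNION)
      show "countable ((\<inter>) M ` F')" using F'(2) by simp
      show "X \<in> sigma_sets M supports" if "X \<in> (\<inter>) M ` F'" for X
        using that F'(1) ball_supports by (auto simp: F_def intro!: sigma_sets.Basic)
    qed
    finally show "(\<lambda>x. x) -` S \<inter> space (sigma M supports) \<in> sets (sigma M supports)"
      using sub by (simp add: sets_measure_of)
  qed
  from measurable_sets[OF this]
  have "S \<inter> M \<in> sigma_sets M supports" if "S \<in> sets borel" for S
    using that sub by (simp add: sets_measure_of space_measure_of)
  then show "sets (mborel M) \<subseteq> sigma_sets M supports"
    by (auto simp: sets_restrict_space Int_commute)
qed

text \<open>Monotone convergence along the saturated functions. That the integrals increase is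
  recorded too, because the supremum of a sum is split later along increasing sequences.\<close>

lemma emeasure_support:
  assumes g: "C1c_on M g" and nu: "sets nu = sets (mborel M)"
  defines "h \<equiv> (\<lambda>n x. real n * (g x)\<^sup>2 / (1 + real n * (g x)\<^sup>2))"
  shows "emeasure nu {x \<in> M. g x \<noteq> 0} = (SUP n. \<integral>\<^sup>+x. ennreal (h n x) \<partial>nu)"
    and "incseq (\<lambda>n. \<integral>\<^sup>+x. ennreal (h n x) \<partial>nu)"
proof -
  note C1c_on_measurable[OF g, measurable] nu[measurable_cong]
  have sp: "space nu = M" using sets_eq_imp_space_eq[OF nu] space_mborel by simp
  \<comment> \<open>In this form both the monotonicity in \<open>n\<close> and the limit can be read
    off.\<close>
  have h_eq: "h n x = 1 - 1 / (1 + real n * (g x)\<^sup>2)" for n x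
  proof -
    have "1 + real n * (g x)\<^sup>2 \<noteq> 0" by (smt (verit) mult_nonneg_nonneg of_nat_0_le_iff zero_le_power2)
    then show ?thesis by (simp add: h_def field_simps)
  qed
  have inc: "h m x \<le> h n x" if "m \<le> n" for m n x
    unfolding h_eq using that
    by (intro diff_left_mono divide_left_mono add_left_mono mult_right_mono mult_pos_pos)
      (auto intro: add_pos_nonneg)
  then have inc': "incseq (\<lambda>n x. ennreal (h n x))"
    by (auto simp: incseq_def le_fun_def intro!: ennreal_leI)
  show "incseq (\<lambda>n. \<integral>\<^sup>+x. ennreal (h n x) \<partial>nu)"
    using inc by (auto simp: incseq_def intro!: nn_integral_mono ennreal_leI)
  have sup: "(SUP n. ennreal (h n x)) = indicator {x \<in> M. g x \<noteq> 0} x" if x: "x \<in> M" for x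
  proof (cases "g x = 0")
    case True
    then show ?thesis by (simp add: h_def)
  next
    case False
    have "(\<lambda>n. h n x) \<longlonglongrightarrow> 1 - 0"
      unfolding h_eq
    proof (intro tendsto_intros real_tendsto_divide_at_top[where c = 1])
      show "filterlim (\<lambda>n. 1 + real n * (g x)\<^sup>2) at_top sequentially"
        using False by (intro filterlim_tendsto_add_at_top[OF tendsto_const]
            filterlim_at_top_mult_tendsto_pos[OF tendsto_const _ filterlim_real_sequentially]) auto
    qed
    then have "(\<lambda>n. ennreal (h n x)) \<longlonglongrightarrow> ennreal 1" by (intro tendsto_ennrealI) simp
    then have "(SUP n. ennreal (h n x)) = ennreal 1"
      using inc by (intro LIMSEQ_unique[OF LIMSEQ_SUP]) (auto simp: incseq_def intro!: ennreal_leI)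
    then show ?thesis using False x by simp
  qed
  have "(SUP n. \<integral>\<^sup>+x. ennreal (h n x) \<partial>nu) = (\<integral>\<^sup>+x. (SUP n. ennreal (h n x)) \<partial>nu)"
    by (rule nn_integral_monotone_convergence_SUP[OF inc', symmetric]) (simp add: h_def)
  also have "\<dots> = (\<integral>\<^sup>+x. indicator {x \<in> M. g x \<noteq> 0} x \<partial>nu)"
    by (intro nn_integral_cong) (simp add: sup sp)
  also have "\<dots> = emeasure nu {x \<in> M. g x \<noteq> 0}"
  proof (rule nn_integral_indicator)
    have "{x \<in> space nu. g x \<noteq> 0} \<in> sets nu" by measurable
    then show "{x \<in> M. g x \<noteq> 0} \<in> sets nu" by (simp add: sp)
  qed
  finally show "emeasure nu {x \<in> M. g x \<noteq> 0} = (SUP n. \<integral>\<^sup>+x. ennreal (h n x) \<partial>nu)" by simp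
qed

lemma finite_occupation:
  assumes nu: "finite_measure nu" "sets nu = sets (mborel M)" and t: "0 \<le> t"
  shows "finite_measure (occupation nu t)"
proof (rule finite_measureI)
  interpret finite_measure nu by fact
  have "emeasure (occupation nu t) (space (occupation nu t)) = (\<integral>\<^sup>+x. 1 \<partial>occupation nu t)" by simp
  also have "\<dots> = (\<integral>\<^sup>+s. indicator {0..t} s * (\<integral>\<^sup>+x. 1 \<partial>nu) \<partial>lborel)"
    by (rule nn_integral_occupation[OF nu(2,1)]) simp
  also have "\<dots> = ennreal t * emeasure nu (space nu)"
    using t by (subst nn_integral_multc) auto
  also have "\<dots> < \<infinity>" by (simp add: ennreal_mult_eq_top_iff less_top[symmetric])
  finally show "emeasure (occupation nu t) (space (occupation nu t)) \<noteq> \<infinity>" by simp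
qed

text \<open>Each side of the forward identity is a sum of two finite measures. The sums agree on the
  intersection-stable generator \<open>supports\<close> and on \<open>M\<close>, hence on all Borel
  sets and then for all nonnegative measurable functions.\<close>

sublocale forward_equation "mborel M" psi l Q \<mu>
proof (intro forward_equation.intro forward_equation_axioms.intro)
  show "flow_with_rate (mborel M) psi l Q" by unfold_locales
  show "sets \<mu> = sets (mborel M)" by (rule sets_mu)
  show "prob_space \<mu>" by (rule prob)
  show "(\<integral>\<^sup>+x. ennreal (l x) \<partial>\<mu>) < \<infinity>" by (rule rate_int')
  fix g :: "'a \<Rightarrow> ennreal" and t :: real
  assume g[measurable]: "g \<in> borel_measurable (mborel M)" and t: "0 \<le> t"
  note [measurable_cong] = sets_mu
  interpret mu: prob_space \<mu> by (rule prob)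
  let ?a1 = "distr \<mu> (mborel M) (psi t)" and ?a2 = "occupation (jump_flux \<mu>) t"
    and ?b2 = "occupation (rate_flux \<mu>) t"
  have psi_t: "psi t \<in> \<mu> \<rightarrow>\<^sub>M mborel M" by measurable
  have sets: "sets ?a1 = sets (mborel M)" "sets ?a2 = sets (mborel M)" "sets ?b2 = sets (mborel M)"
    by (simp_all add: occupation_def)
  have fin: "finite_measure ?a1" "finite_measure ?a2" "finite_measure ?b2" "finite_measure \<mu>"
    using finite_occupation finite_flux sets_flux t mu.finite_measure_distr[OF psi_t] by (auto intro: mu.finite_measure_axioms)
  \<comment> \<open>The identity for test functions is applied to the saturations of
    \<open>f\<close>, and \<open>n\<close> tends to infinity.\<close>
  have supp: "emeasure ?a1 X + emeasure ?a2 X = emeasure \<mu> X + emeasure ?b2 X" if X: "X \<in> supports" for X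
  proof -
    obtain f where f: "C1c_on M f" "X = {x \<in> M. f x \<noteq> 0}" using X by (auto simp: supports_def)
    define h where "h n x = real n * (f x)\<^sup>2 / (1 + real n * (f x)\<^sup>2)" for n x
    have h: "C1c_on M (h n)" for n unfolding h_def by (rule C1c_on_saturate[OF f(1)])
    have h0: "0 \<le> h n x" for n x by (simp add: h_def)
    note es = emeasure_support[OF f(1), folded h_def f(2)]
    have "(\<integral>\<^sup>+x. ennreal (h n x) \<partial>?a1) + (\<integral>\<^sup>+x. ennreal (h n x) \<partial>?a2) =
        (\<integral>\<^sup>+x. ennreal (h n x) \<partial>\<mu>) + (\<integral>\<^sup>+x. ennreal (h n x) \<partial>?b2)" for n
      using forward_equation_C1c[OF h h0 t, of n] C1c_on_measurable[OF h, of n] psi_t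
      by (subst nn_integral_distr) auto
    then show ?thesis
      by (simp add: es(1)[OF sets(1)] es(1)[OF sets(2)] es(1)[OF sets(3)] es(1)[OF sets_mu]
          ennreal_SUP_add[OF es(2)[OF sets(1)] es(2)[OF sets(2)], symmetric]
          ennreal_SUP_add[OF es(2)[OF sets_mu] es(2)[OF sets(3)], symmetric])
  qed
  \<comment> \<open>When \<open>M\<close> is not compact it is not the nonvanishing set of a
    compactly supported function, so its mass is reached through increasing traces of balls.\<close>
  have whole: "emeasure ?a1 M + emeasure ?a2 M = emeasure \<mu> M + emeasure ?b2 M"
  proof -
    let ?B = "\<lambda>n::nat. M \<inter> ball 0 (real (Suc n))"
    have B: "range ?B \<subseteq> sets (mborel M)"
      using ball_supports[of "real (Suc _)" 0] sets_mborel_supports by (auto intro: sigma_sets.Basic)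
    have inc: "incseq ?B" by (auto simp: incseq_def)
    have U: "(\<Union>n. ?B n) = M"
    proof -
      have "\<exists>n::nat. norm x < real (Suc n)" for x :: 'a
        using reals_Archimedean2[of "norm x"] by (meson less_trans lessI of_nat_less_iff)
      then show ?thesis by auto
    qed
    have SUP: "emeasure nu M = (SUP n. emeasure nu (?B n))" if "sets nu = sets (mborel M)" for nu
      using SUP_emeasure_incseq[of ?B nu] B inc that U by simp
    have incE: "incseq (\<lambda>n. emeasure nu (?B n))" if "sets nu = sets (mborel M)" for nu
      using B inc that by (auto simp: incseq_def intro!: emeasure_mono)
    have "emeasure ?a1 M + emeasure ?a2 M = (SUP n. emeasure ?a1 (?B n) + emeasure ?a2 (?B n))"
      unfolding SUP[OF sets(1)] SUP[OF sets(2)]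
      by (rule ennreal_SUP_add[OF incE[OF sets(1)] incE[OF sets(2)], symmetric])
    also have "\<dots> = (SUP n. emeasure \<mu> (?B n) + emeasure ?b2 (?B n))"
      by (intro SUP_cong refl supp ball_supports) simp
    also have "\<dots> = emeasure \<mu> M + emeasure ?b2 M"
      unfolding SUP[OF sets_mu] SUP[OF sets(3)]
      by (rule ennreal_SUP_add[OF incE[OF sets_mu] incE[OF sets(3)]])
    finally show ?thesis .
  qed
  have "integral\<^sup>N ?a1 g + integral\<^sup>N ?a2 g = integral\<^sup>N \<mu> g + integral\<^sup>N ?b2 g"
  proof (rule nn_integral_sum_eqI[OF sets(1,2) sets_mu sets(3) _ g])
    fix A assume A: "A \<in> sets (mborel M)"
    show "emeasure ?a1 A + emeasure ?a2 A = emeasure \<mu> A + emeasure ?b2 A"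
      by (rule finite_measures_sum_eqI[where E = supports and \<Omega> = M])
        (use Int_stable_supports sets sets_mu fin supp whole A sets_mborel_supports
          in \<open>auto simp: supports_def\<close>)
  qed
  then show "(\<integral>\<^sup>+x. g (psi t x) \<partial>\<mu>) + integral\<^sup>N ?a2 g = integral\<^sup>N \<mu> g + integral\<^sup>N ?b2 g"
    using psi_t by (simp add: nn_integral_distr)
qed

end

section \<open>Invariance from sub-invariance and conservation of mass\<close>

theorem corollary22:
  fixes M :: "'a::euclidean_space set"
    and \<phi> :: "real \<Rightarrow> 'a \<Rightarrow> 'a"
    and l :: "'a \<Rightarrow> real"
    and Q :: "'a \<Rightarrow> 'a measure"
    and G :: "'a \<Rightarrow> real \<Rightarrow> 'a"
    and \<mu> :: "'a measure"
  assumes "smooth_submanifold M" and "closed M"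
    and "characteristics M \<phi> l Q"
    and "simulates M G Q"
    and "non_explosive M \<phi> l G"
    and "prob_space \<mu>" and "sets \<mu> = sets (mborel M)"
    and "(\<integral>\<^sup>+ x. ennreal \<bar>l x\<bar> \<partial>\<mu>) < \<infinity>"
    and "smoothly_compactly_approximable M \<phi> l Q"
    and "\<And>f. C1c_on M f \<Longrightarrow> (\<integral>x. generator M \<phi> l Q f x \<partial>\<mu>) = 0"
  shows "invariant_measure \<mu> (pdmp_semigroup M \<phi> l G)"
proof -
  \<comment> \<open>The approximating characteristics share the flow, so their stability yields
    joint C1 regularity of \<open>\<phi>\<close> itself; epsilon is taken to be 1.\<close>
  obtain l' Q' where "stability M \<phi> l' Q'"
    using assms(9) unfolding smoothly_compactly_approximable_def by (meson zero_less_one)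
  then have C1: "C1_on ({0..} \<times> M) (\<lambda>(t, x). \<phi> t x)" unfolding stability_def by blast
  have chars: "differential_flow M \<phi>" "jump_rate M l" "markov_kernel M Q"
    using assms(3) unfolding characteristics_def by auto
  interpret weakly_stationary M \<phi> l Q \<mu>
    by (intro weakly_stationary.intro C1_flow.intro weakly_stationary_axioms.intro; fact)
  interpret jump_process "mborel M" psi l Q \<phi> G
  proof
    show "\<phi> s = psi s" if "0 \<le> s" for s using that by (rule psi_eq)
    show "(\<lambda>(x, u). G x u) \<in> mborel M \<Otimes>\<^sub>M unit_uniform \<rightarrow>\<^sub>M mborel M"
      using assms(4) unfolding simulates_def by blast
    show "emeasure (Q x) A = emeasure unit_uniform {u \<in> {0..1}. G x u \<in> A}"
      if "x \<in> space (mborel M)" "A \<in> sets (mborel M)" for x A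
      using assms(4) that unfolding simulates_def space_mborel by blast
  qed
  interpret mu: prob_space \<mu> by (rule assms(6))
  interpret noise: prob_space noise by (rule prob_space_noise)
  interpret mu_noise: pair_sigma_finite \<mu> noise ..
  let ?P = "pdmp_semigroup M \<phi> l G"
  \<comment> \<open>Two readings of the semigroup: the series over the number of jumps gives
    measurability and the comparison with \<open>\<mu>\<close>, the probability of a path event
    gives the total mass.\<close>
  have P: "emeasure (?P t x) A = (\<Sum>k. jumps t (indicator A) k 0 x)"
    and P_noise: "emeasure (?P t x) A = emeasure noise {w \<in> space noise. pdmp_path \<phi> l G x w t \<in> Some ` A}"
    if "0 \<le> t" "x \<in> M" "A \<in> sets (mborel M)" for t x A
    using emeasure_pdmp_semigroup[OF pdmp_path_event_sets] emeasure_pdmp_path that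
    by (simp_all add: space_mborel)
  have P_meas: "(\<lambda>x. emeasure (?P t x) A) \<in> borel_measurable \<mu>" if "0 \<le> t" "A \<in> sets (mborel M)" for t A
  proof -
    have [measurable]: "(\<lambda>x. jumps t (indicator A) k 0 x) \<in> borel_measurable (mborel M)" for k
      by (rule curried_measurable[OF jumps_measurable]) (use that in auto)
    have "(\<lambda>x. \<Sum>k. jumps t (indicator A) k 0 x) \<in> borel_measurable (mborel M)" by measurable
    then have "(\<lambda>x. \<Sum>k. jumps t (indicator A) k 0 x) \<in> borel_measurable \<mu>"
      by (simp add: measurable_cong_sets[OF sets_mu refl])
    then show ?thesis
      by (rule measurable_cong[THEN iffD1, rotated]) (simp add: P that space_mu)
  qed
  have le: "(\<integral>\<^sup>+x. emeasure (?P t x) A \<partial>\<mu>) \<le> emeasure \<mu> A" if "0 \<le> t" "A \<in> sets (mborel M)" for t A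
  proof -
    have "(\<integral>\<^sup>+x. emeasure (?P t x) A \<partial>\<mu>) = (\<integral>\<^sup>+x. (\<Sum>k. jumps t (indicator A) k 0 x) \<partial>\<mu>)"
      by (intro nn_integral_cong) (simp add: P that space_mu)
    also have "\<dots> \<le> (\<integral>\<^sup>+x. indicator A x \<partial>\<mu>)"
      using that by (intro suminf_jumps_le) auto
    also have "\<dots> = emeasure \<mu> A" using that sets_mu by simp
    finally show ?thesis .
  qed
  have M_sets: "M \<in> sets (mborel M)" using sets.top[of "mborel M"] by (simp add: space_mborel)
  \<comment> \<open>Non-explosion with initial law \<open>\<mu>\<close> holds almost surely on the
    product space, hence for almost every starting point almost surely in the noise; a path in the
    cemetery at the finite time \<open>t\<close> would have a finite explosion time.\<close>
  have total: "(\<integral>\<^sup>+x. emeasure (?P t x) M \<partial>\<mu>) = 1" if t: "0 \<le> t" for t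
  proof -
    have "AE p in \<mu> \<Otimes>\<^sub>M noise. explosion_time \<phi> l G (fst p) (snd p) = \<infinity>"
      using assms(5,6,7) unfolding non_explosive_def by blast
    then have "AE x in \<mu>. AE w in noise. explosion_time \<phi> l G x w = \<infinity>"
      using mu_noise.AE_pair by fastforce
    moreover have "emeasure (?P t x) M = 1"
      if x: "x \<in> space \<mu>" and ae: "AE w in noise. explosion_time \<phi> l G x w = \<infinity>" for x
    proof -
      have "AE w in noise. pdmp_path \<phi> l G x w t \<in> Some ` M"
        using ae AE_space
      proof eventually_elim
        case (elim w)
        have "pdmp_path \<phi> l G x w t \<noteq> None"
        proof
          assume "pdmp_path \<phi> l G x w t = None"
          then have "explosion_time \<phi> l G x w \<le> ereal t"
            unfolding explosion_time_def using t by (intro Inf_lower) auto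
          then show False using elim by simp
        qed
        then obtain k where k: "fst (skeleton \<phi> l G x w k) \<le> ereal t"
            "ereal t < fst (skeleton \<phi> l G x w (Suc k))"
          using pdmp_path_cases t by blast
        have "skeleton \<phi> l G x w k \<in> space (borel \<Otimes>\<^sub>M mborel M)"
          by (rule measurable_space[OF skeleton_measurable elim(2)]) (use x space_mu space_mborel in simp)
        then have "snd (skeleton \<phi> l G x w k) \<in> space (mborel M)"
          by (cases "skeleton \<phi> l G x w k") (simp add: space_pair_measure)
        then show ?case
          unfolding pdmp_path_eq[OF k] using psi_space space_mborel by simp
      qed
      then have "emeasure noise {w \<in> space noise. pdmp_path \<phi> l G x w t \<in> Some ` M} = 1"
        by (intro noise.emeasure_eq_1_AE)
          (use pdmp_path_event_sets[OF t _ M_sets] x space_mu space_mborel in auto)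
      then show ?thesis using P_noise[OF t _ M_sets] x space_mu by simp
    qed
    ultimately have "(\<integral>\<^sup>+x. emeasure (?P t x) M \<partial>\<mu>) = (\<integral>\<^sup>+x. 1 \<partial>\<mu>)"
      using AE_space by (intro nn_integral_cong_AE) (auto elim: eventually_elim2)
    then show ?thesis by (simp add: mu.emeasure_space_1)
  qed
  show ?thesis
    unfolding invariant_measure_def
  proof (intro allI impI ballI)
    fix t :: real and A assume t: "0 \<le> t" and "A \<in> sets \<mu>"
    then have A: "A \<in> sets (mborel M)" using sets_mu by simp
    have A': "M - A \<in> sets (mborel M)" using M_sets A by (rule sets.Diff)
    let ?I = "\<lambda>A. \<integral>\<^sup>+x. emeasure (?P t x) A \<partial>\<mu>"
    have AM: "A \<subseteq> M" using sets.sets_into_space[OF A] space_mborel by simp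
    have sum: "?I A + ?I (M - A) = 1"
    proof -
      have "emeasure (?P t x) A + emeasure (?P t x) (M - A) = emeasure (?P t x) M" for x
      proof -
        have "sets (?P t x) = sets (mborel M)"
          unfolding pdmp_semigroup_def
          using sets.space_closed[of "mborel M"] sets.sigma_sets_eq[of "mborel M"]
          by (simp add: space_mborel sets_measure_of)
        then show ?thesis
          using plus_emeasure[of A "?P t x" "M - A"] A A' AM by (simp add: Un_absorb1)
      qed
      then show ?thesis
        using total[OF t] by (subst nn_integral_add[symmetric, OF P_meas[OF t A] P_meas[OF t A']]) simp
    qed
    have mu_sum: "emeasure \<mu> A + emeasure \<mu> (M - A) = 1"
      using mu.emeasure_space_1 plus_emeasure[of A \<mu> "M - A"] A A' AM sets_mu space_mu
      by (simp add: Un_absorb1)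
    \<comment> \<open>The masses of \<open>A\<close> and of its complement add up to 1 under both
      measures, so the inequality for the complement is the reverse inequality for
      \<open>A\<close>.\<close>
    show "?I A = emeasure \<mu> A"
    proof (rule antisym[OF le[OF t A]])
      have "emeasure \<mu> (M - A) \<noteq> \<infinity>" by simp
      moreover have "emeasure \<mu> (M - A) + emeasure \<mu> A \<le> emeasure \<mu> (M - A) + ?I A"
        using le[OF t A'] sum mu_sum by (metis add.commute add_left_mono)
      ultimately show "emeasure \<mu> A \<le> ?I A" by (simp add: ennreal_add_left_cancel_le)
    qed
  qed
qed

end
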